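(* Let $G$ be an ample locally compact Hausdorff groupoid. Then $G$ is effective if and only if for any twist $(\Sigma,i,q)$ over $G$ and any normaliser $n \in C_r^*(G;\Sigma)$ of $C_0(G^{(0)})$, there exists a sequence of projections $(p_k)_{k=1}^\infty$ in $C_0(G^{(0)})$ such that for each $k \ge 1$, $$\iota(p_k)\, j(n) = \iota(p_k E(n)) = \iota(E(n) p_k) = j(n)\, \iota(p_k) \in C_r^*(G^{(0)};q^{-1}(G^{(0)})),$$ and $$\iota(E(n)) = \lim_{k \to \infty} \big(\iota(p_k)\, j(n)\big).$$
   Context: **Groupoids.** A groupoid $G$ is a small category in which every morphism is invertible; $G^{(0)}$ is its unit space, $r(\gamma)=\gamma\gamma^{-1}$, $s(\gamma)=\gamma^{-1}\gamma$, $G^x=r^{-1}(x)$ and $G_x=s^{-1}(x)$ for $x\in G^{(0)}$. A topological groupoid is a groupoid with a topology making composition and inversion continuous and with $G^{(0)}$ Hausdorff. It is étale if $r\colon G\to G^{(0)}$ is a local homeomorphism. Groupoids are not assumed second-countable. A subset $B\subseteq G$ is a bisection if it is contained in an open set $U\subseteq G$ such that $r|_U$ and $s|_U$ are homeomorphisms onto open subsets of $G^{(0)}$. A topological groupoid is ample if it has a basis of compact open bisections (ample groupoids are étale). The isotropy is $\mathrm{Iso}(G)=\{\gamma\in G: r(\gamma)=s(\gamma)\}$, with topological interior $\mathrm{Iso}(G)^\circ$; $G$ is effective if $\mathrm{Iso}(G)^\circ=G^{(0)}$. **Twists.** A twist $(\Sigma,i,q)$ over a locally compact Hausdorff étale groupoid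 $G$ is a sequence $G^{(0)}\times\mathbb{T}\xrightarrow{i}\Sigma\xrightarrow{q}G$, where $G^{(0)}\times\mathbb{T}$ is the trivial group bundle with fibres $\mathbb{T}$ (the circle group) and $\Sigma$ is a Hausdorff (topological) groupoid with unit space $\Sigma^{(0)}=i(G^{(0)}\times\{1\})$, such that: $i$ and $q$ are continuous groupoid homomorphisms restricting to homeomorphisms of unit spaces (so $\Sigma^{(0)}$ is identified with $G^{(0)}$); $i$ is injective, $q$ is surjective, and $q^{-1}(G^{(0)})=i(G^{(0)}\times\mathbb{T})$; $i(r(\sigma),z)\,\sigma=\sigma\, i(s(\sigma),z)$ for all $\sigma\in\Sigma$, $z\in\mathbb{T}$ (this element is denoted $z\cdot\sigma=\sigma\cdot z$); and for every $\alpha\in G$ there are an open bisection $U_\alpha\ni\alpha$ and a continuous map $S_\alpha\colon U_\alpha\to\Sigma$ with $q\circ S_\alpha=\mathrm{id}_{U_\alpha}$ such that $(\beta,z)\mapsto i(r(\beta),z)\,S_\alpha(\beta)$ is a homeomorphism $U_\alpha\times\mathbb{T}\to q^{-1}(U_\alpha)$. **Twisted C*-algebra.** For a locally compact Hausdorff space $X$, $C_c(X)$ and $C_0(X)$ are the continuous complex functions with compact support, respectively vanishing at infinity. A function $f$ on $\Sigma$ is $\mathbb{T}$-contravariant if $f(\sigma\cdot z)=\overline{z}f(\sigma)$ for all $\sigma\in\Sigma$, $z\in\mathbb{T}$. $C_c(G;\Sigma)$ and $C_0(G;\Sigma)$ are the $\mathbb{T}$-contravariant functions in $C_c(\Sigma)$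 and $C_0(\Sigma)$. $C_c(G;\Sigma)$ is a *-algebra under $(f*g)(\sigma)=\sum_{\eta\in G^{r(\sigma)}}f(\tau_\eta)g(\tau_\eta^{-1}\sigma)$, where $\tau_\eta\in q^{-1}(\eta)$ is arbitrary (the summand does not depend on the choice), and $f^*(\sigma)=\overline{f(\sigma^{-1})}$. For $x\in G^{(0)}$, $L^2(G_x;\Sigma_x)$ is the Hilbert space of $\mathbb{T}$-contravariant square-integrable functions on $\Sigma_x$ (with $\|g\|^2=\sum_{\gamma\in G_x}|g(\tau_\gamma)|^2$, $\tau_\gamma\in q^{-1}(\gamma)$), and $\pi_x(f)g=f*g$ for $f\in C_c(G;\Sigma)$. $C_r^*(G;\Sigma)$ is the completion of $C_c(G;\Sigma)$ in the reduced norm $\|f\|_r=\sup_x\|\pi_x(f)\|$. There is a norm-decreasing injective linear map $j\colon C_r^*(G;\Sigma)\to C_0(G;\Sigma)$ that preserves convolution and involution and satisfies $j(f)=f$ for $f\in C_c(G;\Sigma)$; elements of $C_r^*(G;\Sigma)$ are viewed as functions on $\Sigma$ via $j$, and products such as $\iota(f)j(n)$ are products in $C_r^*(G;\Sigma)$ (convolution) under this identification. The groupoid $q^{-1}(G^{(0)})$ is a twist over $G^{(0)}$, and $C_r^*(G^{(0)};q^{-1}(G^{(0)}))$ is the completion of $C_c(G^{(0)};q^{-1}(G^{(0)}))\subseteq C_c(G;\Sigma)$ inside $C_r^*(G;\Sigma)$. The map $\iota\colon C_0(G^{(0)})\to C_r^*(G^{(0)};q^{-1}(G^{(0)}))$ is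 the isomorphism sending $f\in C_c(G^{(0)})$ to the function $z\cdot x\mapsto\overline{z}f(x)$ ($x\in G^{(0)}$, $z\in\mathbb{T}$); through it $C_0(G^{(0)})$ is regarded as a subalgebra of $C_r^*(G;\Sigma)$. $E\colon C_r^*(G;\Sigma)\to C_0(G^{(0)})$ is the conditional expectation extending restriction of functions in $C_c(G;\Sigma)$ from $\Sigma$ to $q^{-1}(G^{(0)})$ (followed by $\iota^{-1}$). The limit is in the norm of $C_r^*(G;\Sigma)$. **Normalisers.** For a C*-algebra $A$ and an abelian (C*-)subalgebra $B$, an element $n\in A$ is a normaliser of $B$ if $nBn^*\cup n^*Bn\subseteq B$. *)

theory Defs
  imports "HOL-Analysis.Analysis"
begin

section \<open>Topological groupoids\<close>

text \<open>
  A groupoid is presented by its set of arrows, which is the \<^const>\<open>topspace\<close> of the topology;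
  objects are identified with their identity arrows, so that \<open>rng\<close> and \<open>src\<close> take values in arrows.
  The product \<open>mul x y\<close> is meaningful only for composable pairs, that is, when \<open>src x = rng y\<close>.
  The values of all operations outside their domains are irrelevant.
\<close>

record 'a tgroupoid =
  gtop :: "'a topology"
  src :: "'a \<Rightarrow> 'a"
  rng :: "'a \<Rightarrow> 'a"
  mul :: "'a \<Rightarrow> 'a \<Rightarrow> 'a"
  ginv :: "'a \<Rightarrow> 'a"

definition arrows :: "'a tgroupoid \<Rightarrow> 'a set" where
  "arrows G = topspace (gtop G)"

definition units :: "'a tgroupoid \<Rightarrow> 'a set" where
  "units G = src G ` arrows G"

definition unit_top :: "'a tgroupoid \<Rightarrow> 'a topology" where
  "unit_top G = subtopology (gtop G) (units G)"

definition composable :: "'a tgroupoid \<Rightarrow> ('a \<times> 'a) set" where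
  "composable G = {(x, y). x \<in> arrows G \<and> y \<in> arrows G \<and> src G x = rng G y}"

definition is_groupoid :: "'a tgroupoid \<Rightarrow> bool" where
  "is_groupoid G \<longleftrightarrow>
     (\<forall>x\<in>arrows G. src G x \<in> arrows G \<and> rng G x \<in> arrows G
        \<and> src G (src G x) = src G x \<and> rng G (src G x) = src G x
        \<and> src G (rng G x) = rng G x \<and> rng G (rng G x) = rng G x
        \<and> mul G (rng G x) x = x \<and> mul G x (src G x) = x)
   \<and> (\<forall>(x, y)\<in>composable G. mul G x y \<in> arrows G
        \<and> rng G (mul G x y) = rng G x \<and> src G (mul G x y) = src G y)
   \<and> (\<forall>x y z. (x, y) \<in> composable G \<and> (y, z) \<in> composable G
        \<longrightarrow> mul G (mul G x y) z = mul G x (mul G y z))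
   \<and> (\<forall>x\<in>arrows G. ginv G x \<in> arrows G
        \<and> src G (ginv G x) = rng G x \<and> rng G (ginv G x) = src G x
        \<and> mul G x (ginv G x) = rng G x \<and> mul G (ginv G x) x = src G x)"

definition topological_groupoid :: "'a tgroupoid \<Rightarrow> bool" where
  "topological_groupoid G \<longleftrightarrow>
     is_groupoid G
   \<and> continuous_map (subtopology (prod_topology (gtop G) (gtop G)) (composable G)) (gtop G)
       (\<lambda>(x, y). mul G x y)
   \<and> continuous_map (gtop G) (gtop G) (ginv G)
   \<and> Hausdorff_space (unit_top G)"

definition homeo_onto_open :: "'a tgroupoid \<Rightarrow> 'a set \<Rightarrow> ('a \<Rightarrow> 'a) \<Rightarrow> bool" where
  "homeo_onto_open G U f \<longleftrightarrow>
     openin (unit_top G) (f ` U)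
   \<and> homeomorphic_map (subtopology (gtop G) U) (subtopology (unit_top G) (f ` U)) f"

definition bisection :: "'a tgroupoid \<Rightarrow> 'a set \<Rightarrow> bool" where
  "bisection G B \<longleftrightarrow>
     (\<exists>U. openin (gtop G) U \<and> B \<subseteq> U \<and> homeo_onto_open G U (rng G) \<and> homeo_onto_open G U (src G))"

definition ample :: "'a tgroupoid \<Rightarrow> bool" where
  "ample G \<longleftrightarrow>
     topological_groupoid G
   \<and> (\<forall>W x. openin (gtop G) W \<and> x \<in> W \<longrightarrow>
        (\<exists>B. compactin (gtop G) B \<and> openin (gtop G) B \<and> bisection G B \<and> x \<in> B \<and> B \<subseteq> W))"

definition isotropy :: "'a tgroupoid \<Rightarrow> 'a set" where
  "isotropy G = {x \<in> arrows G. rng G x = src G x}"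

definition effective :: "'a tgroupoid \<Rightarrow> bool" where
  "effective G \<longleftrightarrow> gtop G interior_of isotropy G = units G"

definition groupoid_hom :: "'a tgroupoid \<Rightarrow> 'b tgroupoid \<Rightarrow> ('a \<Rightarrow> 'b) \<Rightarrow> bool" where
  "groupoid_hom G H f \<longleftrightarrow>
     f ` arrows G \<subseteq> arrows H
   \<and> (\<forall>(x, y)\<in>composable G. (f x, f y) \<in> composable H \<and> f (mul G x y) = mul H (f x) (f y))"


section \<open>Twists\<close>

abbreviation circle :: "complex set" where
  "circle \<equiv> sphere 0 1"

definition circle_bundle :: "'a tgroupoid \<Rightarrow> ('a \<times> complex) tgroupoid" where
  "circle_bundle G =
     \<lparr> gtop = prod_topology (unit_top G) (top_of_set circle),
       src = (\<lambda>(x, z). (x, 1)),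
       rng = (\<lambda>(x, z). (x, 1)),
       mul = (\<lambda>(x, z) (y, w). (x, z * w)),
       ginv = (\<lambda>(x, z). (x, inverse z)) \<rparr>"

record ('a, 'b) twist =
  total :: "'b tgroupoid"
  tincl :: "'a \<times> complex \<Rightarrow> 'b"
  tproj :: "'b \<Rightarrow> 'a"

text \<open>
  The action of the circle. For an arrow \<open>\<sigma>\<close> of the total groupoid, the unit \<open>r(\<sigma>)\<close>, read
  as a unit of \<open>G\<close> through the identification of the two unit spaces, is \<open>rng G (tproj T \<sigma>)\<close>.
\<close>

definition cact :: "'a tgroupoid \<Rightarrow> ('a, 'b) twist \<Rightarrow> complex \<Rightarrow> 'b \<Rightarrow> 'b" where
  "cact G T z \<sigma> = mul (total T) (tincl T (rng G (tproj T \<sigma>), z)) \<sigma>"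

definition over :: "('a, 'b) twist \<Rightarrow> 'a set \<Rightarrow> 'b set" where
  "over T U = {\<sigma> \<in> arrows (total T). tproj T \<sigma> \<in> U}"

text \<open>
  The clause \<open>tproj T (tincl T (x, 1)) = x\<close> says that the two identifications of the unit space
  of the total groupoid with that of \<open>G\<close>, through \<open>tincl\<close> and through \<open>tproj\<close>, are the same one.
  The standing hypotheses on the base groupoid \<open>G\<close> are not part of this predicate.
\<close>

definition is_twist :: "'a tgroupoid \<Rightarrow> ('a, 'b) twist \<Rightarrow> bool" where
  "is_twist G T \<longleftrightarrow>
     topological_groupoid (total T) \<and> Hausdorff_space (gtop (total T))
   \<and> units (total T) = tincl T ` (units G \<times> {1})
   \<and> groupoid_hom (circle_bundle G) (total T) (tincl T)
   \<and> continuous_map (gtop (circle_bundle G)) (gtop (total T)) (tincl T)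
   \<and> homeomorphic_map (unit_top (circle_bundle G)) (unit_top (total T)) (tincl T)
   \<and> groupoid_hom (total T) G (tproj T)
   \<and> continuous_map (gtop (total T)) (gtop G) (tproj T)
   \<and> homeomorphic_map (unit_top (total T)) (unit_top G) (tproj T)
   \<and> (\<forall>x\<in>units G. tproj T (tincl T (x, 1)) = x)
   \<and> inj_on (tincl T) (units G \<times> circle)
   \<and> tproj T ` arrows (total T) = arrows G
   \<and> over T (units G) = tincl T ` (units G \<times> circle)
   \<and> (\<forall>\<sigma>\<in>arrows (total T). \<forall>z\<in>circle.
        cact G T z \<sigma> = mul (total T) \<sigma> (tincl T (src G (tproj T \<sigma>), z)))
   \<and> (\<forall>\<alpha>\<in>arrows G. \<exists>U S.
        openin (gtop G) U \<and> bisection G U \<and> \<alpha> \<in> U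
      \<and> continuous_map (subtopology (gtop G) U) (gtop (total T)) S
      \<and> (\<forall>\<beta>\<in>U. tproj T (S \<beta>) = \<beta>)
      \<and> homeomorphic_map (prod_topology (subtopology (gtop G) U) (top_of_set circle))
          (subtopology (gtop (total T)) (over T U))
          (\<lambda>(\<beta>, z). mul (total T) (tincl T (rng G \<beta>, z)) (S \<beta>)))"


section \<open>The convolution algebra and the reduced norm\<close>

text \<open>
  A function on a space \<open>X\<close> is represented by a function on the ambient type that is \<open>0\<close> off
  \<open>topspace X\<close>. In particular, functions on an open and closed subspace are extended by zero.
\<close>

definition Cc :: "'a topology \<Rightarrow> ('a \<Rightarrow> complex) set" where
  "Cc X = {f. continuous_map X euclidean f
            \<and> compactin X (X closure_of {x \<in> topspace X. f x \<noteq> 0})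
            \<and> (\<forall>x. x \<notin> topspace X \<longrightarrow> f x = 0)}"

definition C0 :: "'a topology \<Rightarrow> ('a \<Rightarrow> complex) set" where
  "C0 X = {f. continuous_map X euclidean f
            \<and> (\<forall>e>0. compactin X {x \<in> topspace X. e \<le> norm (f x)})
            \<and> (\<forall>x. x \<notin> topspace X \<longrightarrow> f x = 0)}"

definition contravariant :: "'a tgroupoid \<Rightarrow> ('a, 'b) twist \<Rightarrow> ('b \<Rightarrow> complex) \<Rightarrow> bool" where
  "contravariant G T f \<longleftrightarrow>
     (\<forall>\<sigma>\<in>arrows (total T). \<forall>z\<in>circle. f (cact G T z \<sigma>) = cnj z * f \<sigma>)"

definition CcT :: "'a tgroupoid \<Rightarrow> ('a, 'b) twist \<Rightarrow> ('b \<Rightarrow> complex) set" where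
  "CcT G T = {f \<in> Cc (gtop (total T)). contravariant G T f}"

definition CcT_unit :: "'a tgroupoid \<Rightarrow> ('a, 'b) twist \<Rightarrow> ('b \<Rightarrow> complex) set" where
  "CcT_unit G T =
     {f \<in> Cc (subtopology (gtop (total T)) (over T (units G))). contravariant G T f}"

definition lift :: "('a, 'b) twist \<Rightarrow> 'a \<Rightarrow> 'b" where
  "lift T \<gamma> = (SOME \<sigma>. \<sigma> \<in> arrows (total T) \<and> tproj T \<sigma> = \<gamma>)"

text \<open>
  For a compactly supported left factor only finitely many summands are nonzero.
\<close>

definition conv ::
    "'a tgroupoid \<Rightarrow> ('a, 'b) twist \<Rightarrow> ('b \<Rightarrow> complex) \<Rightarrow> ('b \<Rightarrow> complex) \<Rightarrow> 'b \<Rightarrow> complex" where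
  "conv G T f g \<sigma> =
     (if \<sigma> \<in> arrows (total T)
      then \<Sum>\<^sub>\<infinity>\<eta>\<in>{\<eta> \<in> arrows G. rng G \<eta> = rng G (tproj T \<sigma>)}.
             f (lift T \<eta>) * g (mul (total T) (ginv (total T) (lift T \<eta>)) \<sigma>)
      else 0)"

definition adj :: "('a, 'b) twist \<Rightarrow> ('b \<Rightarrow> complex) \<Rightarrow> 'b \<Rightarrow> complex" where
  "adj T f \<sigma> = (if \<sigma> \<in> arrows (total T) then cnj (f (ginv (total T) \<sigma>)) else 0)"

definition src_fibre :: "'a tgroupoid \<Rightarrow> 'a \<Rightarrow> 'a set" where
  "src_fibre G x = {\<gamma> \<in> arrows G. src G \<gamma> = x}"

definition L2 :: "'a tgroupoid \<Rightarrow> ('a, 'b) twist \<Rightarrow> 'a \<Rightarrow> ('b \<Rightarrow> complex) set" where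
  "L2 G T x =
     {g. contravariant G T g \<and> (\<forall>\<sigma>. \<sigma> \<notin> over T (src_fibre G x) \<longrightarrow> g \<sigma> = 0)
       \<and> (\<lambda>\<gamma>. (norm (g (lift T \<gamma>)))\<^sup>2) summable_on src_fibre G x}"

definition L2_norm :: "'a tgroupoid \<Rightarrow> ('a, 'b) twist \<Rightarrow> 'a \<Rightarrow> ('b \<Rightarrow> complex) \<Rightarrow> real" where
  "L2_norm G T x g = sqrt (\<Sum>\<^sub>\<infinity>\<gamma>\<in>src_fibre G x. (norm (g (lift T \<gamma>)))\<^sup>2)"

text \<open>
  The suprema are taken in \<^typ>\<open>ennreal\<close> so that they are \<open>0\<close> for the empty groupoid; on
  \<^const>\<open>CcT\<close> they are finite.
\<close>

definition rep_norm :: "'a tgroupoid \<Rightarrow> ('a, 'b) twist \<Rightarrow> 'a \<Rightarrow> ('b \<Rightarrow> complex) \<Rightarrow> ennreal" where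
  "rep_norm G T x f =
     (SUP g \<in> {g \<in> L2 G T x. L2_norm G T x g \<le> 1}. ennreal (L2_norm G T x (conv G T f g)))"

definition red_norm :: "'a tgroupoid \<Rightarrow> ('a, 'b) twist \<Rightarrow> ('b \<Rightarrow> complex) \<Rightarrow> real" where
  "red_norm G T f = enn2real (SUP x \<in> units G. rep_norm G T x f)"

definition red_dist ::
    "'a tgroupoid \<Rightarrow> ('a, 'b) twist \<Rightarrow> ('b \<Rightarrow> complex) \<Rightarrow> ('b \<Rightarrow> complex) \<Rightarrow> real" where
  "red_dist G T f g = red_norm G T (\<lambda>\<sigma>. f \<sigma> - g \<sigma>)"


section \<open>The reduced twisted C*-algebra\<close>

text \<open>
  The completion of the convolution algebra is realised by equivalence classes of Cauchy sequences.
\<close>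

type_synonym 'b cseq = "nat \<Rightarrow> 'b \<Rightarrow> complex"

definition red_Cauchy :: "'a tgroupoid \<Rightarrow> ('a, 'b) twist \<Rightarrow> 'b cseq \<Rightarrow> bool" where
  "red_Cauchy G T f \<longleftrightarrow> Metric_space.MCauchy (CcT G T) (red_dist G T) f"

definition cls :: "'a tgroupoid \<Rightarrow> ('a, 'b) twist \<Rightarrow> 'b cseq \<Rightarrow> 'b cseq set" where
  "cls G T f = {h. red_Cauchy G T h \<and> (\<lambda>k. red_dist G T (h k) (f k)) \<longlonglongrightarrow> 0}"

definition Cred :: "'a tgroupoid \<Rightarrow> ('a, 'b) twist \<Rightarrow> 'b cseq set set" where
  "Cred G T = {cls G T f | f. red_Cauchy G T f}"

definition rep :: "'b cseq set \<Rightarrow> 'b cseq" where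
  "rep a = (SOME f. f \<in> a)"

definition cmul ::
    "'a tgroupoid \<Rightarrow> ('a, 'b) twist \<Rightarrow> 'b cseq set \<Rightarrow> 'b cseq set \<Rightarrow> 'b cseq set" where
  "cmul G T a b = cls G T (\<lambda>k. conv G T (rep a k) (rep b k))"

definition cadj :: "'a tgroupoid \<Rightarrow> ('a, 'b) twist \<Rightarrow> 'b cseq set \<Rightarrow> 'b cseq set" where
  "cadj G T a = cls G T (\<lambda>k. adj T (rep a k))"

definition cdist ::
    "'a tgroupoid \<Rightarrow> ('a, 'b) twist \<Rightarrow> 'b cseq set \<Rightarrow> 'b cseq set \<Rightarrow> real" where
  "cdist G T a b = lim (\<lambda>k. red_dist G T (rep a k) (rep b k))"

definition Cred_unit :: "'a tgroupoid \<Rightarrow> ('a, 'b) twist \<Rightarrow> 'b cseq set set" where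
  "Cred_unit G T = {a \<in> Cred G T. \<exists>f\<in>a. \<forall>k. f k \<in> CcT_unit G T}"

definition iota0 :: "'a tgroupoid \<Rightarrow> ('a, 'b) twist \<Rightarrow> ('a \<Rightarrow> complex) \<Rightarrow> 'b \<Rightarrow> complex" where
  "iota0 G T f \<sigma> =
     (if \<sigma> \<in> tincl T ` (units G \<times> circle)
      then case inv_into (units G \<times> circle) (tincl T) \<sigma> of (x, z) \<Rightarrow> cnj z * f x
      else 0)"

text \<open>
  The extension of \<^const>\<open>iota0\<close> by continuity: \<open>iota f\<close> is the class of any sequence
  \<open>iota0 (\<phi> k)\<close> with \<open>\<phi> k\<close> in \<open>C\<^sub>c\<close> of the unit space converging uniformly to \<open>f\<close>.
\<close>

definition iota :: "'a tgroupoid \<Rightarrow> ('a, 'b) twist \<Rightarrow> ('a \<Rightarrow> complex) \<Rightarrow> 'b cseq set" where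
  "iota G T f =
     {h. \<exists>\<phi>. (\<forall>k. \<phi> k \<in> Cc (unit_top G)) \<and> uniform_limit (units G) \<phi> f sequentially
           \<and> h \<in> cls G T (\<lambda>k. iota0 G T (\<phi> k))}"

text \<open>
  \<open>expect0\<close> is restriction to the part over the unit space followed by the inverse of
  \<^const>\<open>iota0\<close>. It decreases norms from \<^const>\<open>red_norm\<close> to the supremum norm, so that along a
  Cauchy sequence it converges uniformly; \<open>expect\<close> is its extension by continuity.
\<close>

definition expect0 :: "'a tgroupoid \<Rightarrow> ('a, 'b) twist \<Rightarrow> ('b \<Rightarrow> complex) \<Rightarrow> 'a \<Rightarrow> complex" where
  "expect0 G T f x = (if x \<in> units G then f (tincl T (x, 1)) else 0)"

definition expect :: "'a tgroupoid \<Rightarrow> ('a, 'b) twist \<Rightarrow> 'b cseq set \<Rightarrow> 'a \<Rightarrow> complex" where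
  "expect G T a x = lim (\<lambda>k. expect0 G T (rep a k) x)"

definition normaliser :: "'a tgroupoid \<Rightarrow> ('a, 'b) twist \<Rightarrow> 'b cseq set \<Rightarrow> bool" where
  "normaliser G T n \<longleftrightarrow>
     n \<in> Cred G T
   \<and> (\<forall>b \<in> iota G T ` C0 (unit_top G).
        cmul G T (cmul G T n b) (cadj G T n) \<in> iota G T ` C0 (unit_top G)
      \<and> cmul G T (cmul G T (cadj G T n) b) n \<in> iota G T ` C0 (unit_top G))"

definition projection :: "'a tgroupoid \<Rightarrow> ('a \<Rightarrow> complex) \<Rightarrow> bool" where
  "projection G p \<longleftrightarrow>
     p \<in> C0 (unit_top G) \<and> (\<forall>x. p x * p x = p x) \<and> (\<forall>x. cnj (p x) = p x)"

text \<open>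
  The injection \<open>j\<close> of the reduced algebra into \<open>C\<^sub>0(G;\<Sigma>)\<close> serves only to view elements as
  functions; products and limits are taken in the reduced algebra, so it does not appear.
\<close>

definition projections_cut_to_expectation ::
    "'a tgroupoid \<Rightarrow> ('a, 'b) twist \<Rightarrow> 'b cseq set \<Rightarrow> bool" where
  "projections_cut_to_expectation G T n \<longleftrightarrow>
     (\<exists>p :: nat \<Rightarrow> 'a \<Rightarrow> complex.
        (\<forall>k\<ge>1. projection G (p k))
      \<and> (\<forall>k\<ge>1. cmul G T (iota G T (p k)) n = iota G T (\<lambda>x. p k x * expect G T n x)
             \<and> iota G T (\<lambda>x. p k x * expect G T n x) = iota G T (\<lambda>x. expect G T n x * p k x)
             \<and> iota G T (\<lambda>x. expect G T n x * p k x) = cmul G T n (iota G T (p k))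
             \<and> cmul G T n (iota G T (p k)) \<in> Cred_unit G T)
      \<and> (\<lambda>k. cdist G T (cmul G T (iota G T (p k)) n) (iota G T (expect G T n))) \<longlonglongrightarrow> 0)"

end

theory Submission
  imports Defs
begin

text \<open>
  A set-theoretic lift of \<open>q\<close> turns the regular representations of a twist into matrices indexed by the arrows
  of \<open>G\<close>: a function \<open>f\<close> acts by the entries \<open>f(\<sigma>\<^sub>s \<sigma>\<^sub>t\<inverse>)\<close> for \<open>s\<close>, \<open>t\<close> with the same source. For
  compactly supported \<open>f\<close> these matrices are bounded with finite rows and columns, they multiply like the
  functions do, and the reduced norm is the operator norm, so elements of the reduced algebra
  are Cauchy sequences in a normed algebra of matrices; they are determined by their entries.

  Let \<open>G\<close> be effective and \<open>n\<close> a normaliser. If \<open>b\<close> and \<open>c\<close> have disjoint supports, then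
  \<open>(n* b n) d (n* c n) = n* b (n d n*) c n = 0\<close>, and evaluating this at a unit shows that arrows
  in the support of \<open>n\<close> with the same source have the same range. Hence, for \<open>\<gamma>\<close> and \<open>\<delta>\<close> in the open support with the
  same source, \<open>\<gamma> \<delta>\<inverse>\<close> is interior to the isotropy and thus a unit: the support is a bisection. Then
  cutting \<open>n\<close> by the indicator of a compact open set between \<open>{|E(n)| \<ge> 1/k}\<close> and \<open>{E(n) \<noteq> 0}\<close> leaves only
  its diagonal.

  If \<open>G\<close> is not effective, take a compact open bisection \<open>B\<close> in the isotropy that misses the units, and the
  trivial twist. With \<open>v = i 1\<^sub>B\<close>, the element \<open>X = (v - v*)/10\<close> is skew-adjoint and commutes with
  functions on the unit space, so its Cayley transform is a normaliser; its values at an arrow of \<open>B\<close> and at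
  the source of this arrow are both nonzero, which no sequence of projections can reconcile.
\<close>

section \<open>Bounded matrices with finite rows and columns\<close>

text \<open>Operator norms are tested on finite blocks, so neither a Hilbert space nor the
  completion is entered. The matrices form a normed algebra that is in general not complete; an
  identity in the reduced algebra is an exact identity of finite sums, carried along a Cauchy
  sequence and corrected by null sequences. Ampleness enters through compact open sets: their
  indicators are continuous and replace partitions of unity, Urysohn functions and local units.

  A normaliser is only a limit of compactly supported functions, so its support is read off from
  limits of entries; it is open because the values converge uniformly.

  In the converse the element must normalise exactly, which \<open>1 + 2X\<close> need not do; hence
  the Cayley transform, whose first two terms these are. The factor 1/10 brings the norm of
  \<open>X\<close> down to 1/5, and the remaining terms, at most 3/20, can then cancel neither the
  value 1 at the unit nor the value of modulus at least 2/10 at the arrow. The factor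
  \<open>\<i>\<close> makes \<open>v\<close> and minus its adjoint add up where \<open>B\<close>
  meets its inverse, instead of cancelling.\<close>

definition mat_bound :: "('a \<Rightarrow> 'a \<Rightarrow> complex) \<Rightarrow> real \<Rightarrow> bool" where
  "mat_bound K C \<longleftrightarrow> 0 \<le> C \<and>
     (\<forall>F F' g. finite F \<longrightarrow> finite F' \<longrightarrow>
        L2_set (\<lambda>s. norm (\<Sum>t\<in>F'. K s t * g t)) F \<le> C * L2_set (\<lambda>t. norm (g t)) F')"

definition finite_lines :: "('a \<Rightarrow> 'a \<Rightarrow> complex) \<Rightarrow> bool" where
  "finite_lines K \<longleftrightarrow> (\<forall>s. finite {t. K s t \<noteq> 0}) \<and> (\<forall>t. finite {s. K s t \<noteq> 0})"

text \<open>Summing over the support of a column of the right factor gives a finite sum whenever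
  \<open>finite_lines L\<close> holds; over an infinite support \<open>sum\<close> would be 0 and
  the value meaningless.\<close>

definition mat_mult :: "('a \<Rightarrow> 'a \<Rightarrow> complex) \<Rightarrow> ('a \<Rightarrow> 'a \<Rightarrow> complex) \<Rightarrow> 'a \<Rightarrow> 'a \<Rightarrow> complex" where
  "mat_mult K L s t = (\<Sum>u\<in>{u. L u t \<noteq> 0}. K s u * L u t)"

lemma mat_boundD:
  "mat_bound K C \<Longrightarrow> finite F \<Longrightarrow> finite F' \<Longrightarrow>
     L2_set (\<lambda>s. norm (\<Sum>t\<in>F'. K s t * g t)) F \<le> C * L2_set (\<lambda>t. norm (g t)) F'"
  by (auto simp: mat_bound_def)

lemma mat_bound_nonneg: "mat_bound K C \<Longrightarrow> 0 \<le> C"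
  by (auto simp: mat_bound_def)

lemma mat_boundI:
  assumes "0 \<le> C"
    and "\<And>F F' g. finite F \<Longrightarrow> finite F' \<Longrightarrow>
      L2_set (\<lambda>s. norm (\<Sum>t\<in>F'. K s t * g t)) F \<le> C * L2_set (\<lambda>t. norm (g t)) F'"
  shows "mat_bound K C"
  using assms by (auto simp: mat_bound_def)

lemma mat_bound_entry:
  assumes "mat_bound K C"
  shows "norm (K s t) \<le> C"
  using mat_boundD[OF assms, of "{s}" "{t}" "\<lambda>_. 1"] by simp

lemma mat_bound_add:
  assumes "mat_bound K C" "mat_bound L D"
  shows "mat_bound (\<lambda>s t. K s t + L s t) (C + D)"
proof (rule mat_boundI)
  show "0 \<le> C + D" using assms by (auto simp: mat_bound_def)
  fix F F' :: "'a set" and g :: "'a \<Rightarrow> complex" assume f: "finite F" "finite F'"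
  have "L2_set (\<lambda>s. norm (\<Sum>t\<in>F'. (K s t + L s t) * g t)) F
      \<le> L2_set (\<lambda>s. norm (\<Sum>t\<in>F'. K s t * g t) + norm (\<Sum>t\<in>F'. L s t * g t)) F"
    by (intro L2_set_mono) (auto simp: distrib_right sum.distrib norm_triangle_ineq)
  also have "\<dots> \<le> L2_set (\<lambda>s. norm (\<Sum>t\<in>F'. K s t * g t)) F + L2_set (\<lambda>s. norm (\<Sum>t\<in>F'. L s t * g t)) F"
    by (rule L2_set_triangle_ineq)
  also have "\<dots> \<le> C * L2_set (\<lambda>t. norm (g t)) F' + D * L2_set (\<lambda>t. norm (g t)) F'"
    using mat_boundD[OF assms(1) f] mat_boundD[OF assms(2) f] by (intro add_mono)
  finally show "L2_set (\<lambda>s. norm (\<Sum>t\<in>F'. (K s t + L s t) * g t)) F \<le> (C + D) * L2_set (\<lambda>t. norm (g t)) F'"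
    by (simp add: distrib_right)
qed

lemma mat_bound_scale:
  assumes "mat_bound K C"
  shows "mat_bound (\<lambda>s t. c * K s t) (norm c * C)"
proof (rule mat_boundI)
  show "0 \<le> norm c * C" using assms by (auto simp: mat_bound_def)
  fix F F' :: "'a set" and g :: "'a \<Rightarrow> complex" assume f: "finite F" "finite F'"
  have "L2_set (\<lambda>s. norm (\<Sum>t\<in>F'. c * K s t * g t)) F = norm c * L2_set (\<lambda>s. norm (\<Sum>t\<in>F'. K s t * g t)) F"
    by (simp add: L2_set_right_distrib norm_mult mult.assoc flip: sum_distrib_left)
  also have "\<dots> \<le> norm c * (C * L2_set (\<lambda>t. norm (g t)) F')"
    by (intro mult_left_mono mat_boundD[OF assms f]) simp
  finally show "L2_set (\<lambda>s. norm (\<Sum>t\<in>F'. c * K s t * g t)) F \<le> norm c * C * L2_set (\<lambda>t. norm (g t)) F'"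
    by (simp add: mult.assoc)
qed

lemma mat_bound_uminus: "mat_bound K C \<Longrightarrow> mat_bound (\<lambda>s t. - K s t) C"
  using mat_bound_scale[of K C "-1"] by simp

text \<open>Lets all products in one identity be summed over a common finite set, which reduces the
  algebra laws to rearranging finite sums.\<close>

lemma mat_mult_superset:
  assumes "finite S" "{u. L u t \<noteq> 0} \<subseteq> S"
  shows "mat_mult K L s t = (\<Sum>u\<in>S. K s u * L u t)"
  unfolding mat_mult_def using assms by (intro sum.mono_neutral_left) auto

text \<open>\<open>finite_lines L\<close> makes the intermediate vector finitely supported, on
  \<open>S\<close>, so that the bound on \<open>K\<close> applies to it as to a finite
  block.\<close>

lemma mat_bound_mult:
  assumes "mat_bound K C" "mat_bound L D" "finite_lines L"
  shows "mat_bound (mat_mult K L) (C * D)"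
proof (rule mat_boundI)
  have CD: "0 \<le> C" "0 \<le> D" using assms by (auto simp: mat_bound_def)
  then show "0 \<le> C * D" by simp
  fix F F' :: "'a set" and g :: "'a \<Rightarrow> complex" assume f: "finite F" "finite F'"
  define S where "S = (\<Union>t\<in>F'. {u. L u t \<noteq> 0})"
  have S: "finite S" using f assms(3) by (auto simp: S_def finite_lines_def)
  have "(\<Sum>t\<in>F'. mat_mult K L s t * g t) = (\<Sum>u\<in>S. K s u * (\<Sum>t\<in>F'. L u t * g t))" for s
  proof -
    have "(\<Sum>t\<in>F'. mat_mult K L s t * g t) = (\<Sum>t\<in>F'. (\<Sum>u\<in>S. K s u * L u t) * g t)"
      using S by (intro sum.cong refl arg_cong2[where f = "(*)"] mat_mult_superset) (auto simp: S_def)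
    also have "\<dots> = (\<Sum>u\<in>S. K s u * (\<Sum>t\<in>F'. L u t * g t))"
      by (simp add: sum_distrib_left sum_distrib_right mult.assoc) (rule sum.swap)
    finally show ?thesis .
  qed
  then have "L2_set (\<lambda>s. norm (\<Sum>t\<in>F'. mat_mult K L s t * g t)) F
      \<le> C * L2_set (\<lambda>u. norm (\<Sum>t\<in>F'. L u t * g t)) S"
    using mat_boundD[OF assms(1) f(1) S] by simp
  also have "\<dots> \<le> C * (D * L2_set (\<lambda>t. norm (g t)) F')"
    by (intro mult_left_mono mat_boundD[OF assms(2) S f(2)] CD)
  finally show "L2_set (\<lambda>s. norm (\<Sum>t\<in>F'. mat_mult K L s t * g t)) F \<le> C * D * L2_set (\<lambda>t. norm (g t)) F'"
    by (simp add: mult.assoc)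
qed

lemma finite_lines_mult:
  assumes "finite_lines K" "finite_lines L"
  shows "finite_lines (mat_mult K L)"
proof -
  have nz: "\<exists>u. K s u \<noteq> 0 \<and> L u t \<noteq> 0" if "mat_mult K L s t \<noteq> 0" for s t
    using that unfolding mat_mult_def by (auto elim!: sum.not_neutral_contains_not_neutral)
  have "finite {t. mat_mult K L s t \<noteq> 0}" for s
    by (rule finite_subset[of _ "\<Union>u\<in>{u. K s u \<noteq> 0}. {t. L u t \<noteq> 0}"])
       (use nz assms in \<open>auto simp: finite_lines_def\<close>)
  moreover have "finite {s. mat_mult K L s t \<noteq> 0}" for t
    by (rule finite_subset[of _ "\<Union>u\<in>{u. L u t \<noteq> 0}. {s. K s u \<noteq> 0}"])
       (use nz[of _ t] assms in \<open>force simp: finite_lines_def\<close>)+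
  ultimately show ?thesis by (simp add: finite_lines_def)
qed

lemma finite_lines_add:
  assumes "finite_lines K" "finite_lines L"
  shows "finite_lines (\<lambda>s t. K s t + L s t)"
proof -
  have "finite {t. K s t + L s t \<noteq> 0}" for s
    by (rule finite_subset[of _ "{t. K s t \<noteq> 0} \<union> {t. L s t \<noteq> 0}"])
       (use assms in \<open>auto simp: finite_lines_def\<close>)
  moreover have "finite {s. K s t + L s t \<noteq> 0}" for t
    by (rule finite_subset[of _ "{s. K s t \<noteq> 0} \<union> {s. L s t \<noteq> 0}"])
       (use assms in \<open>auto simp: finite_lines_def\<close>)
  ultimately show ?thesis by (simp add: finite_lines_def)
qed

lemma finite_lines_scale:
  assumes "finite_lines K"
  shows "finite_lines (\<lambda>s t. c * K s t)"
  using assms by (cases "c = 0") (auto simp: finite_lines_def)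

lemma mat_mult_assoc:
  assumes "finite_lines K" "finite_lines L" "finite_lines M"
  shows "mat_mult (mat_mult K L) M s t = mat_mult K (mat_mult L M) s t"
proof -
  define S where "S = {u. M u t \<noteq> 0}"
  define R where "R = (\<Union>u\<in>S. {v. L v u \<noteq> 0})"
  have S: "finite S" and R: "finite R" using assms by (auto simp: S_def R_def finite_lines_def)
  have R': "{v. mat_mult L M v t \<noteq> 0} \<subseteq> R"
  proof
    fix v assume "v \<in> {v. mat_mult L M v t \<noteq> 0}"
    then obtain u where "u \<in> S" "L v u * M u t \<noteq> 0"
      unfolding mat_mult_def S_def by (auto elim: sum.not_neutral_contains_not_neutral)
    then show "v \<in> R" by (auto simp: R_def)
  qed
  have "mat_mult (mat_mult K L) M s t = (\<Sum>u\<in>S. mat_mult K L s u * M u t)"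
    by (simp add: mat_mult_def S_def)
  also have "\<dots> = (\<Sum>u\<in>S. (\<Sum>v\<in>R. K s v * L v u) * M u t)"
    using R by (intro sum.cong refl arg_cong2[where f = "(*)"] mat_mult_superset) (auto simp: R_def)
  also have "\<dots> = (\<Sum>v\<in>R. K s v * (\<Sum>u\<in>S. L v u * M u t))"
    by (simp add: sum_distrib_left sum_distrib_right mult.assoc) (rule sum.swap)
  also have "\<dots> = (\<Sum>v\<in>R. K s v * mat_mult L M v t)"
    by (simp add: mat_mult_def S_def)
  also have "\<dots> = mat_mult K (mat_mult L M) s t"
    using mat_mult_superset[of R "mat_mult L M" t K s] R R' by simp
  finally show ?thesis .
qed

text \<open>Cauchy-Schwarz turns the bound into one on the bilinear form, in which rows and columns
  play symmetric roles; this is what passing to the adjoint needs.\<close>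

lemma mat_bound_form:
  assumes "mat_bound K C" "finite F" "finite F'"
  shows "norm (\<Sum>s\<in>F. \<Sum>t\<in>F'. h s * K s t * g t) \<le> C * L2_set (\<lambda>s. norm (h s)) F * L2_set (\<lambda>t. norm (g t)) F'"
proof -
  have "norm (\<Sum>s\<in>F. \<Sum>t\<in>F'. h s * K s t * g t) \<le> (\<Sum>s\<in>F. norm (h s * (\<Sum>t\<in>F'. K s t * g t)))"
    by (rule order_trans[OF norm_sum]) (simp add: sum_distrib_left mult.assoc)
  also have "\<dots> = (\<Sum>s\<in>F. \<bar>norm (h s)\<bar> * \<bar>norm (\<Sum>t\<in>F'. K s t * g t)\<bar>)"
    by (simp add: norm_mult)
  also have "\<dots> \<le> L2_set (\<lambda>s. norm (h s)) F * L2_set (\<lambda>s. norm (\<Sum>t\<in>F'. K s t * g t)) F"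
    by (rule L2_set_mult_ineq)
  also have "\<dots> \<le> L2_set (\<lambda>s. norm (h s)) F * (C * L2_set (\<lambda>t. norm (g t)) F')"
    by (intro mult_left_mono mat_boundD[OF assms]) simp
  finally show ?thesis by (simp add: mult_ac)
qed

lemma mat_bound_adjoint:
  assumes "mat_bound K C"
  shows "mat_bound (\<lambda>s t. cnj (K t s)) C"
proof (rule mat_boundI)
  show C: "0 \<le> C" using assms by (rule mat_bound_nonneg)
  fix F F' :: "'a set" and g :: "'a \<Rightarrow> complex" assume f: "finite F" "finite F'"
  \<comment> \<open>Pairing the image \<open>w\<close> with itself gives \<open>N^2\<close>, which
    the bound on the form estimates by \<open>C\<close> times the length of \<open>g\<close> times
    \<open>N\<close>; one factor \<open>N\<close> cancels.\<close>
  define w where "w s = (\<Sum>t\<in>F'. cnj (K t s) * g t)" for s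
  define N where "N = L2_set (\<lambda>s. norm (w s)) F"
  have "complex_of_real (N\<^sup>2) = (\<Sum>s\<in>F. w s * cnj (w s))"
    by (simp add: N_def L2_set_def sum_nonneg complex_norm_square[symmetric])
  also have "\<dots> = (\<Sum>s\<in>F. \<Sum>t\<in>F'. cnj (g t) * K t s * w s)"
    by (simp add: w_def[of] sum_distrib_left mult_ac)
  also have "\<dots> = (\<Sum>t\<in>F'. \<Sum>s\<in>F. cnj (g t) * K t s * w s)"
    by (rule sum.swap)
  finally have "norm (complex_of_real (N\<^sup>2)) \<le> C * L2_set (\<lambda>t. norm (cnj (g t))) F' * N"
    unfolding N_def by (simp only: mat_bound_form[OF assms f(2,1)])
  then have "N * N \<le> (C * L2_set (\<lambda>t. norm (g t)) F') * N"
    by (simp add: norm_mult power2_eq_square)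
  moreover have "0 \<le> N" by (simp add: N_def)
  moreover have "0 \<le> C * L2_set (\<lambda>t. norm (g t)) F'" using C by simp
  ultimately have "N \<le> C * L2_set (\<lambda>t. norm (g t)) F'"
    by (cases "N = 0") (auto simp: mult_le_cancel_right)
  then show "L2_set (\<lambda>s. norm (\<Sum>t\<in>F'. cnj (K t s) * g t)) F \<le> C * L2_set (\<lambda>t. norm (g t)) F'"
    by (simp add: N_def w_def)
qed

lemma mat_bound_zero: "mat_bound (\<lambda>s t. 0) 0"
  by (auto simp: mat_bound_def L2_set_def)

text \<open>With at most one nonzero entry in each row and column the matrix is a weighted partial
  permutation, so a bound on the entries bounds the norm. Functions supported on a bisection and
  functions on the unit space both give such matrices.\<close>

lemma mat_bound_partial_injection:
  assumes C: "0 \<le> C" and K: "\<And>s t. norm (K s t) \<le> C"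
    and row: "\<And>s t t'. K s t \<noteq> 0 \<Longrightarrow> K s t' \<noteq> 0 \<Longrightarrow> t = t'"
    and col: "\<And>s s' t. K s t \<noteq> 0 \<Longrightarrow> K s' t \<noteq> 0 \<Longrightarrow> s = s'"
  shows "mat_bound K C"
proof (rule mat_boundI[OF C])
  fix F F' :: "'a set" and g :: "'a \<Rightarrow> complex" assume f: "finite F" "finite F'"
  have *: "(norm (\<Sum>t\<in>F'. K s t * g t))\<^sup>2 = (\<Sum>t\<in>F'. (norm (K s t * g t))\<^sup>2)" for s
  proof (cases "\<exists>t\<in>F'. K s t \<noteq> 0")
    case True
    then obtain t where t: "t \<in> F'" "K s t \<noteq> 0" by blast
    then have z: "K s t' = 0" if "t' \<noteq> t" for t' using row that by blast
    have "(\<Sum>t\<in>F'. K s t * g t) = K s t * g t"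
      using f t z by (subst sum.remove[of _ t]) (auto intro!: sum.neutral)
    moreover have "(\<Sum>t\<in>F'. (norm (K s t * g t))\<^sup>2) = (norm (K s t * g t))\<^sup>2"
      using f t z by (subst sum.remove[of _ t]) (auto intro!: sum.neutral)
    ultimately show ?thesis by simp
  qed (auto)
  have **: "(\<Sum>s\<in>F. (norm (K s t))\<^sup>2) \<le> C\<^sup>2" for t
  proof (cases "\<exists>s\<in>F. K s t \<noteq> 0")
    case True
    then obtain s where s: "s \<in> F" "K s t \<noteq> 0" by blast
    then have z: "K s' t = 0" if "s' \<noteq> s" for s' using col that by blast
    have "(\<Sum>s\<in>F. (norm (K s t))\<^sup>2) = (norm (K s t))\<^sup>2"
      using f s z by (subst sum.remove[of _ s]) (auto intro!: sum.neutral)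
    then show ?thesis using K[of s t] by (simp add: power_mono)
  qed auto
  \<comment> \<open>Each row sum has at most one nonzero term, so squaring passes inside; after the
    swap each column contributes at most \<open>C\<^sup>2\<close>.\<close>
  have "(L2_set (\<lambda>s. norm (\<Sum>t\<in>F'. K s t * g t)) F)\<^sup>2 = (\<Sum>s\<in>F. \<Sum>t\<in>F'. (norm (K s t))\<^sup>2 * (norm (g t))\<^sup>2)"
    by (simp add: L2_set_def sum_nonneg * norm_mult power_mult_distrib)
  also have "\<dots> = (\<Sum>t\<in>F'. (\<Sum>s\<in>F. (norm (K s t))\<^sup>2) * (norm (g t))\<^sup>2)"
    by (subst sum.swap) (simp add: sum_distrib_right)
  also have "\<dots> \<le> (\<Sum>t\<in>F'. C\<^sup>2 * (norm (g t))\<^sup>2)"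
    by (intro sum_mono mult_right_mono **) simp
  also have "\<dots> = (C * L2_set (\<lambda>t. norm (g t)) F')\<^sup>2"
    by (simp add: L2_set_def sum_nonneg power_mult_distrib sum_distrib_left)
  finally show "L2_set (\<lambda>s. norm (\<Sum>t\<in>F'. K s t * g t)) F \<le> C * L2_set (\<lambda>t. norm (g t)) F'"
    by (rule power2_le_imp_le) (use C in simp)
qed

section \<open>The normed algebra of bounded matrices with finite rows and columns\<close>

typedef 'a bmat = "{K :: 'a \<Rightarrow> 'a \<Rightarrow> complex. finite_lines K \<and> (\<exists>C. mat_bound K C)}"
  morphisms entry Bmat
  using mat_bound_zero by (intro exI[of _ "\<lambda>s t. 0"]) (auto simp: finite_lines_def)

setup_lifting type_definition_bmat

lemma entry_finite_lines [simp]: "finite_lines (entry A)"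
  and entry_bounded: "\<exists>C. mat_bound (entry A) C"
  using entry[of A] by auto

lemma bmat_eqI: "(\<And>s t. entry A s t = entry B s t) \<Longrightarrow> A = B"
  by (metis ext entry_inject)

text \<open>The scalars are real, so a complex factor such as \<open>\<i>\<close> is carried by the
  function and not by its matrix. Indices range over the whole type: the unit 1 also has entries at
  elements that are not arrows, so in general it is not the matrix of a function.\<close>

instantiation bmat :: (type) real_algebra_1
begin

lift_definition zero_bmat :: "'a bmat" is "\<lambda>s t. 0"
  using mat_bound_zero by (auto simp: finite_lines_def)

lift_definition one_bmat :: "'a bmat" is "\<lambda>s t. if s = t then 1 else 0"
proof -
  have "mat_bound (\<lambda>s t :: 'a. if s = t then 1 else 0) 1"
    by (rule mat_bound_partial_injection) (auto split: if_splits)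
  then show "finite_lines (\<lambda>s t :: 'a. if s = t then 1 else 0) \<and> (\<exists>C. mat_bound (\<lambda>s t :: 'a. if s = t then 1 else 0) C)"
    by (auto simp: finite_lines_def)
qed

lift_definition plus_bmat :: "'a bmat \<Rightarrow> 'a bmat \<Rightarrow> 'a bmat" is "\<lambda>K L s t. K s t + L s t"
  using mat_bound_add finite_lines_add by blast

lift_definition uminus_bmat :: "'a bmat \<Rightarrow> 'a bmat" is "\<lambda>K s t. - K s t"
  using mat_bound_uminus by (auto simp: finite_lines_def)

lift_definition minus_bmat :: "'a bmat \<Rightarrow> 'a bmat \<Rightarrow> 'a bmat" is "\<lambda>K L s t. K s t - L s t"
proof -
  fix K L :: "'a \<Rightarrow> 'a \<Rightarrow> complex"
  assume a: "finite_lines K \<and> (\<exists>C. mat_bound K C)" "finite_lines L \<and> (\<exists>C. mat_bound L C)"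
  then have "finite_lines (\<lambda>s t. - L s t)" by (auto simp: finite_lines_def)
  then show "finite_lines (\<lambda>s t. K s t - L s t) \<and> (\<exists>C. mat_bound (\<lambda>s t. K s t - L s t) C)"
    using a mat_bound_add[of K _ "\<lambda>s t. - L s t"] mat_bound_uminus[of L] finite_lines_add[of K "\<lambda>s t. - L s t"]
    by auto
qed

lift_definition times_bmat :: "'a bmat \<Rightarrow> 'a bmat \<Rightarrow> 'a bmat" is mat_mult
  using mat_bound_mult finite_lines_mult by blast

lift_definition scaleR_bmat :: "real \<Rightarrow> 'a bmat \<Rightarrow> 'a bmat" is "\<lambda>c K s t. complex_of_real c * K s t"
  using mat_bound_scale finite_lines_scale by blast

instance
proof
  fix A B C :: "'a bmat" and a b :: real
  show "A + B + C = A + (B + C)" by transfer (simp add: add.assoc)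
  show "A + B = B + A" by transfer (simp add: add.commute)
  show "0 + A = A" by transfer simp
  show "- A + A = 0" by transfer simp
  show "A - B = A + - B" by transfer simp
  show "a *\<^sub>R (A + B) = a *\<^sub>R A + a *\<^sub>R B" by transfer (simp add: distrib_left)
  show "(a + b) *\<^sub>R A = a *\<^sub>R A + b *\<^sub>R A" by transfer (simp add: distrib_right)
  show "a *\<^sub>R b *\<^sub>R A = (a * b) *\<^sub>R A" by transfer (simp add: mult.assoc)
  show "1 *\<^sub>R A = A" by transfer simp
  show "A * B * C = A * (B * C)" by transfer (auto simp: fun_eq_iff mat_mult_assoc)
  show "1 * A = A"
  proof transfer
    fix K :: "'a \<Rightarrow> 'a \<Rightarrow> complex" assume "finite_lines K \<and> (\<exists>C. mat_bound K C)"
    then have "mat_mult (\<lambda>s t. if s = t then 1 else 0) K s t = K s t" for s t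
      by (subst mat_mult_superset[of "insert s {u. K u t \<noteq> 0}"])
         (auto simp: finite_lines_def if_distrib[of "\<lambda>x. x * _"] sum.delta' cong: if_cong)
    then show "mat_mult (\<lambda>s t. if s = t then 1 else 0) K = K" by blast
  qed
  show "A * 1 = A"
    by transfer (auto simp: fun_eq_iff mat_mult_superset[of "{_}"])
  show "(A + B) * C = A * C + B * C"
    by transfer (auto simp: fun_eq_iff mat_mult_def distrib_right sum.distrib)
  show "A * (B + C) = A * B + A * C"
  proof (transfer, intro ext)
    fix K L M :: "'a \<Rightarrow> 'a \<Rightarrow> complex" and s t
    assume a: "finite_lines L \<and> (\<exists>C. mat_bound L C)" "finite_lines M \<and> (\<exists>C. mat_bound M C)"
    let ?S = "{u. L u t \<noteq> 0} \<union> {u. M u t \<noteq> 0}"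
    have S: "finite ?S" using a by (auto simp: finite_lines_def)
    show "mat_mult K (\<lambda>s t. L s t + M s t) s t = mat_mult K L s t + mat_mult K M s t"
      by (subst (1 2 3) mat_mult_superset[OF S]) (auto simp: distrib_left sum.distrib)
  qed
  show "a *\<^sub>R A * B = a *\<^sub>R (A * B)"
    by transfer (auto simp: fun_eq_iff mat_mult_def sum_distrib_left mult.assoc)
  show "A * a *\<^sub>R B = a *\<^sub>R (A * B)"
  proof (transfer, intro ext)
    fix K L :: "'a \<Rightarrow> 'a \<Rightarrow> complex" and a s t
    assume "finite_lines L \<and> (\<exists>C. mat_bound L C)"
    then have S: "finite {u. L u t \<noteq> 0}" by (auto simp: finite_lines_def)
    show "mat_mult K (\<lambda>s t. complex_of_real a * L s t) s t = complex_of_real a * mat_mult K L s t"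
      by (subst (1 2) mat_mult_superset[OF S]) (auto simp: sum_distrib_left mult_ac)
  qed
  have "entry (0 :: 'a bmat) undefined undefined \<noteq> entry 1 undefined undefined" by transfer simp
  then show "(0 :: 'a bmat) \<noteq> 1" by metis
qed

end

instantiation bmat :: (type) real_normed_algebra_1
begin

definition norm_bmat :: "'a bmat \<Rightarrow> real" where
  "norm_bmat A = Inf {C. mat_bound (entry A) C}"

definition sgn_bmat :: "'a bmat \<Rightarrow> 'a bmat" where "sgn_bmat A = A /\<^sub>R norm A"
definition dist_bmat :: "'a bmat \<Rightarrow> 'a bmat \<Rightarrow> real" where "dist_bmat A B = norm (A - B)"
definition uniformity_bmat :: "('a bmat \<times> 'a bmat) filter" where
  "uniformity_bmat = (INF e\<in>{0<..}. principal {(A, B). dist A B < e})"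
definition open_bmat :: "'a bmat set \<Rightarrow> bool" where
  "open_bmat U = (\<forall>A\<in>U. eventually (\<lambda>(A', B). A' = A \<longrightarrow> B \<in> U) uniformity)"

text \<open>The infimum is attained: after division by the length of \<open>g\<close>, each block
  gives a lower bound for all admissible \<open>C\<close>, hence for their infimum, which is
  therefore admissible itself.\<close>

lemma norm_bmat_bound: "mat_bound (entry A) (norm A)"
proof (rule mat_boundI)
  let ?S = "{C. mat_bound (entry A) C}"
  have ne: "?S \<noteq> {}" using entry_bounded by auto
  have bb: "bdd_below ?S" using mat_bound_nonneg by (intro bdd_belowI) auto
  show "0 \<le> norm A" unfolding norm_bmat_def using ne mat_bound_nonneg by (intro cInf_greatest) auto
  fix F F' :: "'a set" and g :: "'a \<Rightarrow> complex" assume f: "finite F" "finite F'"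
  show "L2_set (\<lambda>s. norm (\<Sum>t\<in>F'. entry A s t * g t)) F \<le> norm A * L2_set (\<lambda>t. norm (g t)) F'"
  proof (cases "L2_set (\<lambda>t. norm (g t)) F' = 0")
    case True
    obtain C where "mat_bound (entry A) C" using ne by blast
    from mat_boundD[OF this f, of g] True show ?thesis by simp
  next
    case False
    then have p: "0 < L2_set (\<lambda>t. norm (g t)) F'" by (metis L2_set_nonneg less_eq_real_def)
    have "L2_set (\<lambda>s. norm (\<Sum>t\<in>F'. entry A s t * g t)) F / L2_set (\<lambda>t. norm (g t)) F' \<le> norm A"
      unfolding norm_bmat_def using ne mat_boundD[OF _ f, of "entry A"] p
      by (intro cInf_greatest) (auto simp: divide_le_eq)
    then show ?thesis using p by (simp add: divide_le_eq)
  qed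
qed

lemma norm_bmat_le: "mat_bound (entry A) C \<Longrightarrow> norm A \<le> C"
  unfolding norm_bmat_def using mat_bound_nonneg by (intro cInf_lower bdd_belowI) auto

instance
proof
  fix A B :: "'a bmat" and a :: real
  show "dist A B = norm (A - B)" by (rule dist_bmat_def)
  show "sgn A = A /\<^sub>R norm A" by (rule sgn_bmat_def)
  show "uniformity = (INF e\<in>{0<..}. principal {(A :: 'a bmat, B). dist A B < e})"
    by (rule uniformity_bmat_def)
  show "open U \<longleftrightarrow> (\<forall>A\<in>U. \<forall>\<^sub>F (A', B) in uniformity. A' = A \<longrightarrow> B \<in> U)" for U :: "'a bmat set"
    by (rule open_bmat_def)
  show "norm (A + B) \<le> norm A + norm B"
    using mat_bound_add[OF norm_bmat_bound[of A] norm_bmat_bound[of B]]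
    by (intro norm_bmat_le) (simp add: plus_bmat.rep_eq)
  have le: "norm (a *\<^sub>R A) \<le> \<bar>a\<bar> * norm A" for a and A :: "'a bmat"
    using mat_bound_scale[OF norm_bmat_bound[of A], of "complex_of_real a"]
    by (intro norm_bmat_le) (simp add: scaleR_bmat.rep_eq)
  show "norm (a *\<^sub>R A) = \<bar>a\<bar> * norm A"
  proof (cases "a = 0")
    case True
    then show ?thesis using le[of a A] mat_bound_nonneg[OF norm_bmat_bound] by (simp add: antisym)
  next
    case False
    have "norm A \<le> \<bar>1/a\<bar> * norm (a *\<^sub>R A)" using le[of "1/a" "a *\<^sub>R A"] False by simp
    then have "\<bar>a\<bar> * norm A \<le> norm (a *\<^sub>R A)" using False by (simp add: field_simps)
    then show ?thesis using le[of a A] by simp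
  qed
  have "A = 0" if "norm A = 0"
    using mat_bound_entry[OF norm_bmat_bound[of A]] that by (intro bmat_eqI) (simp add: zero_bmat.rep_eq)
  moreover have "norm (0 :: 'a bmat) = 0"
    using norm_bmat_le[of "0 :: 'a bmat" 0] mat_bound_nonneg[OF norm_bmat_bound, of "0 :: 'a bmat"] mat_bound_zero
    by (simp add: zero_bmat.rep_eq antisym)
  ultimately show "norm A = 0 \<longleftrightarrow> A = 0" by blast
  show "norm (A * B) \<le> norm A * norm B"
    using mat_bound_mult[OF norm_bmat_bound[of A] norm_bmat_bound[of B]]
    by (intro norm_bmat_le) (simp add: times_bmat.rep_eq)
  have "mat_bound (entry (1 :: 'a bmat)) 1"
    unfolding one_bmat.rep_eq by (rule mat_bound_partial_injection) (auto split: if_splits)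
  then have "norm (1 :: 'a bmat) \<le> 1" by (rule norm_bmat_le)
  moreover have "1 \<le> norm (1 :: 'a bmat)"
    using mat_bound_entry[OF norm_bmat_bound[of "1 :: 'a bmat"], of undefined undefined]
    by (simp add: one_bmat.rep_eq)
  ultimately show "norm (1 :: 'a bmat) = 1" by simp
qed

end

section \<open>The adjoint as an isometric involution on matrices\<close>

lift_definition star :: "'a bmat \<Rightarrow> 'a bmat" is "\<lambda>K s t. cnj (K t s)"
  using mat_bound_adjoint by (auto simp: finite_lines_def)

lemmas entry_simps =
  zero_bmat.rep_eq one_bmat.rep_eq plus_bmat.rep_eq minus_bmat.rep_eq uminus_bmat.rep_eq
  times_bmat.rep_eq scaleR_bmat.rep_eq star.rep_eq

lemma norm_entry_le: "norm (entry A s t) \<le> norm A"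
  by (rule mat_bound_entry[OF norm_bmat_bound])

lemma star_star [simp]: "star (star A) = A"
  by transfer simp

lemma star_add: "star (A + B) = star A + star B"
  by transfer simp

lemma star_diff: "star (A - B) = star A - star B"
  by transfer simp


lemma star_scaleR: "star (c *\<^sub>R A) = c *\<^sub>R star A"
  by transfer simp

lemma star_one [simp]: "star 1 = 1"
  by transfer (auto simp: fun_eq_iff)

lemma star_zero [simp]: "star 0 = 0"
  by transfer auto

lemma star_mult: "star (A * B) = star B * star A"
proof (rule bmat_eqI)
  fix s t
  let ?S = "{u. entry B u s \<noteq> 0} \<union> {u. entry A t u \<noteq> 0}"
  have S: "finite ?S" using entry_finite_lines[of A] entry_finite_lines[of B]
    unfolding finite_lines_def by simp
  have "entry (star (A * B)) s t = (\<Sum>u\<in>?S. cnj (entry A t u) * cnj (entry B u s))"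
    by (simp add: entry_simps mat_mult_superset[OF S])
  also have "\<dots> = entry (star B * star A) s t"
    by (subst times_bmat.rep_eq, subst mat_mult_superset[OF S]) (auto simp: entry_simps mult.commute)
  finally show "entry (star (A * B)) s t = entry (star B * star A) s t" .
qed

lemma star_power: "star (A ^ n) = star A ^ n"
  by (induction n) (simp_all add: star_mult power_commutes)

lemma norm_star [simp]: "norm (star A) = norm A"
proof -
  have "norm (star A) \<le> norm A" for A :: "'a bmat"
    using mat_bound_adjoint[OF norm_bmat_bound[of A]] by (intro norm_bmat_le) (simp add: star.rep_eq)
  from this[of A] this[of "star A"] show ?thesis by simp
qed

lemma tendsto_star:
  assumes "(f \<longlongrightarrow> A) F"
  shows "((\<lambda>x. star (f x)) \<longlongrightarrow> star A) F"
  using assms unfolding tendsto_iff dist_norm by (simp flip: star_diff)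

text \<open>The bounds on finite blocks pass to the entrywise limit.\<close>

lemma Cauchy_entries_tendsto_0:
  assumes C: "Cauchy A" and 0: "\<And>s t. (\<lambda>k. entry (A k) s t) \<longlonglongrightarrow> 0"
  shows "A \<longlonglongrightarrow> (0 :: 'a bmat)"
proof (rule LIMSEQ_I)
  fix e :: real assume e: "0 < e"
  from C obtain N where N: "\<And>m n. N \<le> m \<Longrightarrow> N \<le> n \<Longrightarrow> norm (A m - A n) < e/2"
    using e by (meson CauchyD half_gt_zero)
  have "norm (A m - 0) < e" if m: "N \<le> m" for m
  proof -
    have "mat_bound (entry (A m)) (e/2)"
    proof (rule mat_boundI)
      fix F F' :: "'a set" and g :: "'a \<Rightarrow> complex" assume f: "finite F" "finite F'"
      have "(\<lambda>n. L2_set (\<lambda>s. norm (\<Sum>t\<in>F'. entry (A m - A n) s t * g t)) F)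
          \<longlonglongrightarrow> L2_set (\<lambda>s. norm (\<Sum>t\<in>F'. (entry (A m) s t - 0) * g t)) F"
        unfolding L2_set_def minus_bmat.rep_eq by (intro tendsto_intros 0)
      moreover have "\<forall>\<^sub>F n in sequentially. L2_set (\<lambda>s. norm (\<Sum>t\<in>F'. entry (A m - A n) s t * g t)) F
          \<le> e/2 * L2_set (\<lambda>t. norm (g t)) F'"
      proof (rule eventually_sequentiallyI[of N])
        fix n assume "N \<le> n"
        then have "norm (A m - A n) \<le> e/2" using N m by (simp add: less_imp_le)
        then show "L2_set (\<lambda>s. norm (\<Sum>t\<in>F'. entry (A m - A n) s t * g t)) F
          \<le> e/2 * L2_set (\<lambda>t. norm (g t)) F'"
          by (intro order_trans[OF mat_boundD[OF norm_bmat_bound f]] mult_right_mono) auto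
      qed
      ultimately have "L2_set (\<lambda>s. norm (\<Sum>t\<in>F'. (entry (A m) s t - 0) * g t)) F \<le> e/2 * L2_set (\<lambda>t. norm (g t)) F'"
        by (rule tendsto_upperbound) simp
      then show "L2_set (\<lambda>s. norm (\<Sum>t\<in>F'. entry (A m) s t * g t)) F \<le> e/2 * L2_set (\<lambda>t. norm (g t)) F'"
        by simp
    qed (use e in simp)
    then have "norm (A m) \<le> e/2" by (rule norm_bmat_le)
    then show ?thesis using e by simp
  qed
  then show "\<exists>N. \<forall>m\<ge>N. norm (A m - 0) < e" by blast
qed

section \<open>Groupoids and twists\<close>

locale groupoid =
  fixes G :: "'a tgroupoid"
  assumes is_groupoid: "is_groupoid G"
begin

lemma src_closed [simp]: "x \<in> arrows G \<Longrightarrow> src G x \<in> arrows G"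
  and rng_closed [simp]: "x \<in> arrows G \<Longrightarrow> rng G x \<in> arrows G"
  and ginv_closed [simp]: "x \<in> arrows G \<Longrightarrow> ginv G x \<in> arrows G"
  and src_src [simp]: "x \<in> arrows G \<Longrightarrow> src G (src G x) = src G x"
  and rng_src [simp]: "x \<in> arrows G \<Longrightarrow> rng G (src G x) = src G x"
  and src_rng [simp]: "x \<in> arrows G \<Longrightarrow> src G (rng G x) = rng G x"
  and rng_rng [simp]: "x \<in> arrows G \<Longrightarrow> rng G (rng G x) = rng G x"
  and mul_rng_left [simp]: "x \<in> arrows G \<Longrightarrow> mul G (rng G x) x = x"
  and mul_src_right [simp]: "x \<in> arrows G \<Longrightarrow> mul G x (src G x) = x"
  and src_ginv [simp]: "x \<in> arrows G \<Longrightarrow> src G (ginv G x) = rng G x"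
  and rng_ginv [simp]: "x \<in> arrows G \<Longrightarrow> rng G (ginv G x) = src G x"
  and mul_ginv_right [simp]: "x \<in> arrows G \<Longrightarrow> mul G x (ginv G x) = rng G x"
  and mul_ginv_left [simp]: "x \<in> arrows G \<Longrightarrow> mul G (ginv G x) x = src G x"
  using is_groupoid by (auto simp: is_groupoid_def)

lemma mul_closed [simp]:
    "x \<in> arrows G \<Longrightarrow> y \<in> arrows G \<Longrightarrow> src G x = rng G y \<Longrightarrow> mul G x y \<in> arrows G"
  and rng_mul [simp]:
    "x \<in> arrows G \<Longrightarrow> y \<in> arrows G \<Longrightarrow> src G x = rng G y \<Longrightarrow> rng G (mul G x y) = rng G x"
  and src_mul [simp]:
    "x \<in> arrows G \<Longrightarrow> y \<in> arrows G \<Longrightarrow> src G x = rng G y \<Longrightarrow> src G (mul G x y) = src G y"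
  using is_groupoid by (auto simp: is_groupoid_def composable_def)

lemma mul_assoc:
  "x \<in> arrows G \<Longrightarrow> y \<in> arrows G \<Longrightarrow> z \<in> arrows G \<Longrightarrow> src G x = rng G y \<Longrightarrow> src G y = rng G z \<Longrightarrow>
    mul G (mul G x y) z = mul G x (mul G y z)"
  using is_groupoid by (auto simp: is_groupoid_def composable_def)

lemma ginv_mul_cancel [simp]:
  "x \<in> arrows G \<Longrightarrow> y \<in> arrows G \<Longrightarrow> src G x = rng G y \<Longrightarrow> mul G (ginv G x) (mul G x y) = y"
  by (simp flip: mul_assoc)

lemma mul_ginv_cancel [simp]:
  "x \<in> arrows G \<Longrightarrow> y \<in> arrows G \<Longrightarrow> rng G x = rng G y \<Longrightarrow> mul G x (mul G (ginv G x) y) = y"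
  by (simp flip: mul_assoc)

lemma mul_mul_ginv_cancel [simp]:
  "x \<in> arrows G \<Longrightarrow> y \<in> arrows G \<Longrightarrow> src G x = rng G y \<Longrightarrow> mul G (mul G x y) (ginv G y) = x"
  by (simp add: mul_assoc) (metis mul_src_right)

lemma mul_ginv_mul_cancel [simp]:
  "x \<in> arrows G \<Longrightarrow> y \<in> arrows G \<Longrightarrow> src G x = src G y \<Longrightarrow> mul G (mul G x (ginv G y)) y = x"
  by (simp add: mul_assoc) (metis mul_src_right)

lemma mul_left_cancel:
  assumes "x \<in> arrows G" "y \<in> arrows G" "z \<in> arrows G" "src G x = rng G y" "src G x = rng G z"
    and "mul G x y = mul G x z"
  shows "y = z"
  using assms by (metis ginv_mul_cancel)

lemma mul_right_cancel:
  assumes "x \<in> arrows G" "y \<in> arrows G" "z \<in> arrows G" "src G x = rng G z" "src G y = rng G z"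
    and "mul G x z = mul G y z"
  shows "x = y"
  using assms by (metis mul_mul_ginv_cancel)

lemma ginv_unique:
  assumes "x \<in> arrows G" "y \<in> arrows G" "src G x = rng G y" "mul G x y = rng G x"
  shows "y = ginv G x"
  using assms by - (rule mul_left_cancel[of x], auto)

lemma ginv_ginv [simp]: "x \<in> arrows G \<Longrightarrow> ginv G (ginv G x) = x"
  by (rule ginv_unique[symmetric]) auto

lemma ginv_mul [simp]:
  assumes "x \<in> arrows G" "y \<in> arrows G" "src G x = rng G y"
  shows "ginv G (mul G x y) = mul G (ginv G y) (ginv G x)"
  using assms by - (rule ginv_unique[symmetric], auto simp: mul_assoc)


lemma mul_unit_right: "x \<in> arrows G \<Longrightarrow> src G x = u \<Longrightarrow> mul G x u = x"
  and mul_unit_left: "x \<in> arrows G \<Longrightarrow> rng G x = u \<Longrightarrow> mul G u x = x"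
  by auto

lemma units_iff: "u \<in> units G \<longleftrightarrow> u \<in> arrows G \<and> src G u = u"
  by (auto simp: units_def intro: rev_image_eqI)

lemma units_arrows: "u \<in> units G \<Longrightarrow> u \<in> arrows G"
  and units_src [simp]: "u \<in> units G \<Longrightarrow> src G u = u"
  and units_rng [simp]: "u \<in> units G \<Longrightarrow> rng G u = u"
  using rng_src[of u] by (simp_all add: units_iff)

lemma src_units [simp]: "x \<in> arrows G \<Longrightarrow> src G x \<in> units G"
  and rng_units [simp]: "x \<in> arrows G \<Longrightarrow> rng G x \<in> units G"
  by (auto simp: units_iff)

lemma ginv_unit [simp]: "u \<in> units G \<Longrightarrow> ginv G u = u"
  using ginv_unique[of u u] mul_rng_left[of u] units_arrows[of u] by simp


end

text \<open>\<open>groupoid_hom\<close> speaks of products only. Source and range follow by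
  cancelling in the images of \<open>x s(x) = x\<close> and \<open>r(x) x = x\<close>, and the
  inverse by its uniqueness.\<close>

lemma groupoid_hom_props:
  assumes G: "is_groupoid G" and H: "is_groupoid H" and f: "groupoid_hom G H f" and x: "x \<in> arrows G"
  shows "f x \<in> arrows H" "f (src G x) = src H (f x)" "f (rng G x) = rng H (f x)" "f (ginv G x) = ginv H (f x)"
proof -
  interpret G: groupoid G by (unfold_locales) (rule G)
  interpret H: groupoid H by (unfold_locales) (rule H)
  have arr: "\<And>y. y \<in> arrows G \<Longrightarrow> f y \<in> arrows H" using f by (auto simp: groupoid_hom_def)
  have cmp: "src H (f a) = rng H (f b)" "f (mul G a b) = mul H (f a) (f b)"
    if "a \<in> arrows G" "b \<in> arrows G" "src G a = rng G b" for a b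
    using f that by (auto simp: groupoid_hom_def composable_def)
  show fx: "f x \<in> arrows H" using arr x .
  have "mul H (f x) (f (src G x)) = f x" "src H (f x) = rng H (f (src G x))" using cmp[of x "src G x"] x by simp_all
  then show s: "f (src G x) = src H (f x)"
    using x arr[of x] arr[OF G.src_closed[OF x]] cmp(1)[of x "src G x"]
    by (metis H.mul_left_cancel H.mul_src_right H.rng_src H.src_closed)
  have "mul H (f (rng G x)) (f x) = f x" "src H (f (rng G x)) = rng H (f x)" using cmp[of "rng G x" x] x by simp_all
  then show r: "f (rng G x) = rng H (f x)"
    using x arr[of x] arr[OF G.rng_closed[OF x]] cmp(1)[of "rng G x" x]
    by (metis H.mul_right_cancel H.mul_rng_left H.src_rng H.rng_closed)
  show "f (ginv G x) = ginv H (f x)"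
    using x arr r cmp[of x "ginv G x"] by - (rule H.ginv_unique, auto)
qed

lemma circle_mult [simp]: "z \<in> circle \<Longrightarrow> w \<in> circle \<Longrightarrow> z * w \<in> circle"
  and circle_cnj [simp]: "cnj z \<in> circle \<longleftrightarrow> z \<in> circle"
  and circle_1 [simp]: "1 \<in> circle"
  and circle_mult_cnj [simp]: "z \<in> circle \<Longrightarrow> z * cnj z = 1" "z \<in> circle \<Longrightarrow> cnj z * z = 1"
  by (simp_all add: norm_mult) (metis complex_norm_square mult.commute of_real_1 one_power2)+

lemma circle_mult_cnj_left [simp]: "z \<in> circle \<Longrightarrow> z * (cnj z * x) = x"
  by (metis circle_mult_cnj mult.assoc mult_1)

lemma is_groupoid_circle_bundle:
  assumes "is_groupoid G"
  shows "is_groupoid (circle_bundle G)" "arrows (circle_bundle G) = units G \<times> circle"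
proof -
  interpret groupoid G by unfold_locales (rule assms)
  show arr: "arrows (circle_bundle G) = units G \<times> circle"
    using units_arrows by (auto simp: arrows_def circle_bundle_def unit_top_def topspace_subtopology)
  have "inverse z = cnj z" if "z \<in> circle" for z :: complex
    using circle_mult_cnj(1)[OF that] by (metis inverse_unique)
  then show "is_groupoid (circle_bundle G)"
    unfolding is_groupoid_def composable_def arr
    by (auto simp: circle_bundle_def norm_mult norm_inverse)
qed

section \<open>The algebra of a twist: fibres, circle action, contravariant functions and
  convolution\<close>

locale twisted_groupoid = groupoid G for G :: "'a tgroupoid" +
  fixes T :: "('a, 'b) twist"
  assumes twist: "is_twist G T"
begin

sublocale Tot: groupoid "total T"
  using twist by unfold_locales (simp add: is_twist_def topological_groupoid_def)

abbreviation "\<Sigma> \<equiv> total T"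
abbreviation "q \<equiv> tproj T"

lemma q_hom: "groupoid_hom \<Sigma> G q"
  and i_hom: "groupoid_hom (circle_bundle G) \<Sigma> (tincl T)"
  using twist by (auto simp: is_twist_def)

lemmas q_props = groupoid_hom_props[OF Tot.is_groupoid is_groupoid q_hom]
lemmas i_props = groupoid_hom_props[OF is_groupoid_circle_bundle(1)[OF is_groupoid] Tot.is_groupoid i_hom,
    unfolded is_groupoid_circle_bundle(2)[OF is_groupoid]]

lemma q_closed [simp]: "\<sigma> \<in> arrows \<Sigma> \<Longrightarrow> q \<sigma> \<in> arrows G"
  and q_src: "\<sigma> \<in> arrows \<Sigma> \<Longrightarrow> q (src \<Sigma> \<sigma>) = src G (q \<sigma>)"
  and q_rng: "\<sigma> \<in> arrows \<Sigma> \<Longrightarrow> q (rng \<Sigma> \<sigma>) = rng G (q \<sigma>)"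
  and q_ginv [simp]: "\<sigma> \<in> arrows \<Sigma> \<Longrightarrow> q (ginv \<Sigma> \<sigma>) = ginv G (q \<sigma>)"
  by (fact q_props)+

lemma q_mul [simp]:
  "\<sigma> \<in> arrows \<Sigma> \<Longrightarrow> \<tau> \<in> arrows \<Sigma> \<Longrightarrow> src \<Sigma> \<sigma> = rng \<Sigma> \<tau> \<Longrightarrow> q (mul \<Sigma> \<sigma> \<tau>) = mul G (q \<sigma>) (q \<tau>)"
  using q_hom by (auto simp: groupoid_hom_def composable_def)

lemma i_closed [simp]: "x \<in> units G \<Longrightarrow> z \<in> circle \<Longrightarrow> tincl T (x, z) \<in> arrows \<Sigma>"
  using i_props(1)[of "(x, z)"] by simp

lemma i_src: "x \<in> units G \<Longrightarrow> z \<in> circle \<Longrightarrow> src \<Sigma> (tincl T (x, z)) = tincl T (x, 1)"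
  and i_rng: "x \<in> units G \<Longrightarrow> z \<in> circle \<Longrightarrow> rng \<Sigma> (tincl T (x, z)) = tincl T (x, 1)"
  using i_props(2,3)[of "(x, z)"] by (simp_all add: circle_bundle_def)

lemma q_i_1: "x \<in> units G \<Longrightarrow> q (tincl T (x, 1)) = x"
  using twist by (auto simp: is_twist_def)

lemma over_units: "over T (units G) = tincl T ` (units G \<times> circle)"
  and tincl_inj: "inj_on (tincl T) (units G \<times> circle)"
  and q_surj: "q ` arrows \<Sigma> = arrows G"
  and units_tot: "units \<Sigma> = tincl T ` (units G \<times> {1})"
  using twist by (auto simp: is_twist_def)

text \<open>\<open>over_units\<close> only says that the image is some unit; comparing sources
  identifies it.\<close>

lemma q_i [simp]: "x \<in> units G \<Longrightarrow> z \<in> circle \<Longrightarrow> q (tincl T (x, z)) = x"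
proof -
  assume a: "x \<in> units G" "z \<in> circle"
  then have "tincl T (x, z) \<in> over T (units G)" by (auto simp: over_units)
  then have "q (tincl T (x, z)) \<in> units G" by (simp add: over_def)
  then show ?thesis using q_src[of "tincl T (x, z)"] a by (simp add: q_i_1 i_src)
qed

lemma i_mul [simp]:
  "x \<in> units G \<Longrightarrow> z \<in> circle \<Longrightarrow> w \<in> circle \<Longrightarrow>
    mul \<Sigma> (tincl T (x, z)) (tincl T (x, w)) = tincl T (x, z * w)"
  using i_hom is_groupoid_circle_bundle(2)[OF is_groupoid]
  by (auto simp: groupoid_hom_def composable_def circle_bundle_def)

lemma src_tot: "\<sigma> \<in> arrows \<Sigma> \<Longrightarrow> src \<Sigma> \<sigma> = tincl T (src G (q \<sigma>), 1)"
  and rng_tot: "\<sigma> \<in> arrows \<Sigma> \<Longrightarrow> rng \<Sigma> \<sigma> = tincl T (rng G (q \<sigma>), 1)"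
proof -
  have *: "u = tincl T (q u, 1)" if "u \<in> units \<Sigma>" for u
    using that unfolding units_tot by (auto simp: q_i_1)
  assume s: "\<sigma> \<in> arrows \<Sigma>"
  show "src \<Sigma> \<sigma> = tincl T (src G (q \<sigma>), 1)" using *[of "src \<Sigma> \<sigma>"] s by (simp add: q_src)
  show "rng \<Sigma> \<sigma> = tincl T (rng G (q \<sigma>), 1)" using *[of "rng \<Sigma> \<sigma>"] s by (simp add: q_rng)
qed

lemma tot_composable:
  "\<sigma> \<in> arrows \<Sigma> \<Longrightarrow> \<tau> \<in> arrows \<Sigma> \<Longrightarrow> src \<Sigma> \<sigma> = rng \<Sigma> \<tau> \<longleftrightarrow> src G (q \<sigma>) = rng G (q \<tau>)"
  by (metis q_rng q_src src_tot rng_tot)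

lemma tot_src_eq:
  "\<sigma> \<in> arrows \<Sigma> \<Longrightarrow> \<tau> \<in> arrows \<Sigma> \<Longrightarrow> src \<Sigma> \<sigma> = src \<Sigma> \<tau> \<longleftrightarrow> src G (q \<sigma>) = src G (q \<tau>)"
  by (metis q_src src_tot)

lemma tot_rng_eq:
  "\<sigma> \<in> arrows \<Sigma> \<Longrightarrow> \<tau> \<in> arrows \<Sigma> \<Longrightarrow> rng \<Sigma> \<sigma> = rng \<Sigma> \<tau> \<longleftrightarrow> rng G (q \<sigma>) = rng G (q \<tau>)"
  by (metis q_rng rng_tot)

abbreviation act where "act \<equiv> cact G T"

lemma act_eq: "act z \<sigma> = mul \<Sigma> (tincl T (rng G (q \<sigma>), z)) \<sigma>"
  by (simp add: cact_def)

lemma act_closed [simp]: "\<sigma> \<in> arrows \<Sigma> \<Longrightarrow> z \<in> circle \<Longrightarrow> act z \<sigma> \<in> arrows \<Sigma>"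
  and act_q [simp]: "\<sigma> \<in> arrows \<Sigma> \<Longrightarrow> z \<in> circle \<Longrightarrow> q (act z \<sigma>) = q \<sigma>"
  and act_src [simp]: "\<sigma> \<in> arrows \<Sigma> \<Longrightarrow> z \<in> circle \<Longrightarrow> src \<Sigma> (act z \<sigma>) = src \<Sigma> \<sigma>"
  and act_rng [simp]: "\<sigma> \<in> arrows \<Sigma> \<Longrightarrow> z \<in> circle \<Longrightarrow> rng \<Sigma> (act z \<sigma>) = rng \<Sigma> \<sigma>"
  by (simp_all add: act_eq tot_composable tot_src_eq tot_rng_eq)

lemma act_1 [simp]: "\<sigma> \<in> arrows \<Sigma> \<Longrightarrow> act 1 \<sigma> = \<sigma>"
  by (metis act_eq rng_tot Tot.mul_rng_left)

lemma act_act [simp]: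
  "\<sigma> \<in> arrows \<Sigma> \<Longrightarrow> z \<in> circle \<Longrightarrow> w \<in> circle \<Longrightarrow> act z (act w \<sigma>) = act (z * w) \<sigma>"
  by (simp add: act_eq tot_composable flip: Tot.mul_assoc)

lemma act_mul_left:
  "\<sigma> \<in> arrows \<Sigma> \<Longrightarrow> \<tau> \<in> arrows \<Sigma> \<Longrightarrow> src \<Sigma> \<sigma> = rng \<Sigma> \<tau> \<Longrightarrow> z \<in> circle \<Longrightarrow>
    mul \<Sigma> (act z \<sigma>) \<tau> = act z (mul \<Sigma> \<sigma> \<tau>)"
  by (simp add: act_eq tot_composable Tot.mul_assoc)

lemma act_central: "\<sigma> \<in> arrows \<Sigma> \<Longrightarrow> z \<in> circle \<Longrightarrow> act z \<sigma> = mul \<Sigma> \<sigma> (tincl T (src G (q \<sigma>), z))"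
  using twist by (auto simp: is_twist_def)

lemma act_mul_right:
  assumes "\<sigma> \<in> arrows \<Sigma>" "\<tau> \<in> arrows \<Sigma>" "src \<Sigma> \<sigma> = rng \<Sigma> \<tau>" "z \<in> circle"
  shows "mul \<Sigma> \<sigma> (act z \<tau>) = act z (mul \<Sigma> \<sigma> \<tau>)"
  using assms by (simp add: act_central[of _ z] tot_composable Tot.mul_assoc)

lemma act_ginv: 
  assumes "\<sigma> \<in> arrows \<Sigma>" "z \<in> circle"
  shows "ginv \<Sigma> (act z \<sigma>) = act (cnj z) (ginv \<Sigma> \<sigma>)"
proof (rule Tot.ginv_unique[symmetric])
  show "mul \<Sigma> (act z \<sigma>) (act (cnj z) (ginv \<Sigma> \<sigma>)) = rng \<Sigma> (act z \<sigma>)"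
    using assms by (simp add: act_mul_left act_mul_right del: sphere_def mem_sphere)
qed (use assms in auto)

text \<open>The quotient of two lifts of one arrow lies over a unit, so it is some
  \<open>i(x, z)\<close>, and this \<open>z\<close> carries the first lift to the second.\<close>

lemma act_transitive:
  assumes "\<sigma> \<in> arrows \<Sigma>" "\<tau> \<in> arrows \<Sigma>" "q \<sigma> = q \<tau>"
  obtains z where "z \<in> circle" "\<tau> = act z \<sigma>"
proof -
  have c: "src \<Sigma> \<tau> = rng \<Sigma> (ginv \<Sigma> \<sigma>)" using assms by (simp add: tot_src_eq)
  then have "mul \<Sigma> \<tau> (ginv \<Sigma> \<sigma>) \<in> over T (units G)"
    using assms by (simp add: over_def)
  then obtain x z where xz: "x \<in> units G" "z \<in> circle" "mul \<Sigma> \<tau> (ginv \<Sigma> \<sigma>) = tincl T (x, z)"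
    unfolding over_units by auto
  have "x = rng G (q \<sigma>)" using arg_cong[OF xz(3), of q] xz(1,2) assms c by simp
  then have "act z \<sigma> = mul \<Sigma> (mul \<Sigma> \<tau> (ginv \<Sigma> \<sigma>)) \<sigma>" using xz by (simp add: act_eq)
  also have "\<dots> = \<tau>" using assms c by simp
  finally show ?thesis using that xz(2) by metis
qed

lemma lift_closed [simp]: "\<gamma> \<in> arrows G \<Longrightarrow> lift T \<gamma> \<in> arrows \<Sigma>"
  and q_lift [simp]: "\<gamma> \<in> arrows G \<Longrightarrow> q (lift T \<gamma>) = \<gamma>"
proof -
  assume "\<gamma> \<in> arrows G"
  then have "\<exists>\<sigma>. \<sigma> \<in> arrows \<Sigma> \<and> q \<sigma> = \<gamma>" using q_surj by (metis imageE)
  then have "lift T \<gamma> \<in> arrows \<Sigma> \<and> q (lift T \<gamma>) = \<gamma>"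
    unfolding lift_def by (rule someI_ex)
  then show "lift T \<gamma> \<in> arrows \<Sigma>" "q (lift T \<gamma>) = \<gamma>" by auto
qed

abbreviation contra where "contra \<equiv> contravariant G T"

lemma contraD: "contra f \<Longrightarrow> \<sigma> \<in> arrows \<Sigma> \<Longrightarrow> z \<in> circle \<Longrightarrow> f (act z \<sigma>) = cnj z * f \<sigma>"
  by (auto simp: contravariant_def)

text \<open>The modulus of a contravariant function descends to \<open>G\<close>; this is why zeros
  and sizes can be tested at any chosen lift.\<close>

lemma contra_norm:
  assumes "contra f" "\<sigma> \<in> arrows \<Sigma>" "\<tau> \<in> arrows \<Sigma>" "q \<sigma> = q \<tau>"
  shows "norm (f \<sigma>) = norm (f \<tau>)"
proof -
  obtain z where "z \<in> circle" "\<tau> = act z \<sigma>" using act_transitive[OF assms(2-4)] .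
  then show ?thesis using contraD[OF assms(1,2), of z] by (simp add: norm_mult)
qed


text \<open>Replacing the lift \<open>a\<close> by its multiple by \<open>z\<close> contributes
  \<open>cnj z\<close> in \<open>f\<close> and \<open>z\<close> in \<open>g\<close>, which
  cancel.\<close>

lemma conv_term:
  assumes "contra f" "contra g" "\<sigma> \<in> arrows \<Sigma>" "a \<in> arrows \<Sigma>" "b \<in> arrows \<Sigma>" "q a = q b"
    and "rng \<Sigma> a = rng \<Sigma> \<sigma>"
  shows "f a * g (mul \<Sigma> (ginv \<Sigma> a) \<sigma>) = f b * g (mul \<Sigma> (ginv \<Sigma> b) \<sigma>)"
proof -
  obtain z where z: "z \<in> circle" "b = act z a" using act_transitive[OF assms(4-6)] .
  have "mul \<Sigma> (ginv \<Sigma> b) \<sigma> = act (cnj z) (mul \<Sigma> (ginv \<Sigma> a) \<sigma>)"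
    unfolding z(2) using assms z(1) by (simp add: act_ginv act_mul_left del: mem_sphere mem_sphere_0)
  then have "f b * g (mul \<Sigma> (ginv \<Sigma> b) \<sigma>) = (cnj z * f a) * (z * g (mul \<Sigma> (ginv \<Sigma> a) \<sigma>))"
    using assms z by (simp add: contraD del: mem_sphere mem_sphere_0)
  also have "\<dots> = (cnj z * z) * (f a * g (mul \<Sigma> (ginv \<Sigma> a) \<sigma>))" by (simp only: mult_ac)
  also have "\<dots> = f a * g (mul \<Sigma> (ginv \<Sigma> a) \<sigma>)" using z(1) by (simp only: circle_mult_cnj mult_1)
  finally show ?thesis by simp
qed

text \<open>The substitution \<open>\<eta> = q(\<sigma>) u^-1\<close> moves the sum from a range
  fibre to a source fibre, where it has the shape of a matrix product with inner index
  \<open>u\<close>.\<close>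

lemma conv_fibre:
  assumes f: "contra f" and g: "contra g" and s: "\<sigma> \<in> arrows \<Sigma>" and t: "\<tau> \<in> arrows \<Sigma>"
    and st: "src \<Sigma> \<sigma> = src \<Sigma> \<tau>"
  shows "conv G T f g (mul \<Sigma> \<sigma> (ginv \<Sigma> \<tau>)) =
    (\<Sum>\<^sub>\<infinity>u\<in>src_fibre G (src G (q \<sigma>)). f (mul \<Sigma> \<sigma> (ginv \<Sigma> (lift T u))) * g (mul \<Sigma> (lift T u) (ginv \<Sigma> \<tau>)))"
proof -
  let ?x = "src G (q \<sigma>)" and ?\<rho> = "mul \<Sigma> \<sigma> (ginv \<Sigma> \<tau>)"
  let ?R = "{\<eta> \<in> arrows G. rng G \<eta> = rng G (q ?\<rho>)}"
  have st': "src G (q \<sigma>) = src G (q \<tau>)" using s t st by (simp add: tot_src_eq)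
  have \<rho>: "?\<rho> \<in> arrows \<Sigma>" using s t st by simp
  have q\<rho>: "q ?\<rho> = mul G (q \<sigma>) (ginv G (q \<tau>))" using s t st by simp
  have bij: "bij_betw (\<lambda>u. mul G (q \<sigma>) (ginv G u)) (src_fibre G ?x) ?R"
    by (rule bij_betw_byWitness[where f' = "\<lambda>\<eta>. mul G (ginv G \<eta>) (q \<sigma>)"])
       (use s t st' q\<rho> in \<open>auto simp: src_fibre_def mul_assoc mul_unit_right\<close>)
  have "conv G T f g ?\<rho> = (\<Sum>\<^sub>\<infinity>\<eta>\<in>?R. f (lift T \<eta>) * g (mul \<Sigma> (ginv \<Sigma> (lift T \<eta>)) ?\<rho>))"
    using \<rho> by (simp add: conv_def)
  also have "\<dots> = (\<Sum>\<^sub>\<infinity>u\<in>src_fibre G ?x. f (lift T (mul G (q \<sigma>) (ginv G u))) *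
      g (mul \<Sigma> (ginv \<Sigma> (lift T (mul G (q \<sigma>) (ginv G u)))) ?\<rho>))"
    by (rule infsum_reindex_bij_betw[OF bij, symmetric])
  also have "\<dots> = (\<Sum>\<^sub>\<infinity>u\<in>src_fibre G ?x. f (mul \<Sigma> \<sigma> (ginv \<Sigma> (lift T u))) * g (mul \<Sigma> (lift T u) (ginv \<Sigma> \<tau>)))"
  proof (rule infsum_cong)
    fix u assume "u \<in> src_fibre G ?x"
    then have u: "u \<in> arrows G" "src G u = ?x" by (auto simp: src_fibre_def)
    let ?a = "mul \<Sigma> \<sigma> (ginv \<Sigma> (lift T u))"
    have c: "src \<Sigma> \<sigma> = src \<Sigma> (lift T u)" using s u by (simp add: tot_src_eq)
    have "mul \<Sigma> (ginv \<Sigma> ?a) ?\<rho> = mul \<Sigma> (lift T u) (ginv \<Sigma> \<tau>)"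
      using s t st u c by (simp add: Tot.mul_assoc)
    moreover have "f (lift T (q ?a)) * g (mul \<Sigma> (ginv \<Sigma> (lift T (q ?a))) ?\<rho>) = f ?a * g (mul \<Sigma> (ginv \<Sigma> ?a) ?\<rho>)"
      using s u c t st by (intro conv_term f g \<rho>) (auto simp: tot_rng_eq)
    moreover have "q ?a = mul G (q \<sigma>) (ginv G u)" using s u c by simp
    ultimately show "f (lift T (mul G (q \<sigma>) (ginv G u))) * g (mul \<Sigma> (ginv \<Sigma> (lift T (mul G (q \<sigma>) (ginv G u)))) ?\<rho>) =
       f ?a * g (mul \<Sigma> (lift T u) (ginv \<Sigma> \<tau>))" by simp
  qed
  finally show ?thesis .
qed

lemma conv_contra:
  assumes f: "contra f" and g: "contra g"
  shows "contra (conv G T f g)"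
  unfolding contravariant_def
proof (intro ballI)
  fix \<sigma> z assume s: "\<sigma> \<in> arrows \<Sigma>" and z: "z \<in> circle"
  have "conv G T f g (act z \<sigma>) = (\<Sum>\<^sub>\<infinity>\<eta>\<in>{\<eta> \<in> arrows G. rng G \<eta> = rng G (q \<sigma>)}.
      f (lift T \<eta>) * g (mul \<Sigma> (ginv \<Sigma> (lift T \<eta>)) (act z \<sigma>)))"
    unfolding conv_def using act_closed[OF s z] act_q[OF s z] by simp
  also have "\<dots> = (\<Sum>\<^sub>\<infinity>\<eta>\<in>{\<eta> \<in> arrows G. rng G \<eta> = rng G (q \<sigma>)}.
      cnj z * (f (lift T \<eta>) * g (mul \<Sigma> (ginv \<Sigma> (lift T \<eta>)) \<sigma>)))"
  proof (rule infsum_cong)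
    fix \<eta> assume "\<eta> \<in> {\<eta> \<in> arrows G. rng G \<eta> = rng G (q \<sigma>)}"
    then have h: "\<eta> \<in> arrows G" "rng G \<eta> = rng G (q \<sigma>)" by auto
    then have c: "src \<Sigma> (ginv \<Sigma> (lift T \<eta>)) = rng \<Sigma> \<sigma>" using s by (simp add: tot_rng_eq)
    have "mul \<Sigma> (ginv \<Sigma> (lift T \<eta>)) (act z \<sigma>) = act z (mul \<Sigma> (ginv \<Sigma> (lift T \<eta>)) \<sigma>)"
      using h s z c by (intro act_mul_right) auto
    moreover have "g (act z (mul \<Sigma> (ginv \<Sigma> (lift T \<eta>)) \<sigma>)) = cnj z * g (mul \<Sigma> (ginv \<Sigma> (lift T \<eta>)) \<sigma>)"
      using h s z c by (intro contraD g) auto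
    ultimately show "f (lift T \<eta>) * g (mul \<Sigma> (ginv \<Sigma> (lift T \<eta>)) (act z \<sigma>)) =
      cnj z * (f (lift T \<eta>) * g (mul \<Sigma> (ginv \<Sigma> (lift T \<eta>)) \<sigma>))" by (simp add: mult_ac)
  qed
  also have "\<dots> = cnj z * conv G T f g \<sigma>"
    using s by (simp add: conv_def infsum_cmult_right')
  finally show "conv G T f g (act z \<sigma>) = cnj z * conv G T f g \<sigma>" .
qed

lemma adj_contra:
  assumes f: "contra f"
  shows "contra (adj T f)"
  unfolding contravariant_def
proof (intro ballI)
  fix \<sigma> z assume s: "\<sigma> \<in> arrows \<Sigma>" and z: "z \<in> circle"
  have "f (ginv \<Sigma> (act z \<sigma>)) = z * f (ginv \<Sigma> \<sigma>)"
    unfolding act_ginv[OF s z] using contraD[OF f, of "ginv \<Sigma> \<sigma>" "cnj z"] s z by simp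
  then show "adj T f (act z \<sigma>) = cnj z * adj T f \<sigma>"
    using act_closed[OF s z] s by (simp add: adj_def)
qed

lemma iota0_tincl: "x \<in> units G \<Longrightarrow> z \<in> circle \<Longrightarrow> iota0 G T \<phi> (tincl T (x, z)) = cnj z * \<phi> x"
  unfolding iota0_def using inv_into_f_f[OF tincl_inj, of "(x, z)"] by auto

lemma iota0_off: "\<sigma> \<notin> over T (units G) \<Longrightarrow> iota0 G T \<phi> \<sigma> = 0"
  by (simp add: iota0_def over_units)

lemma iota0_contra: "contra (iota0 G T \<phi>)"
  unfolding contravariant_def
proof (intro ballI)
  fix \<sigma> z assume s: "\<sigma> \<in> arrows \<Sigma>" and z: "z \<in> circle"
  show "iota0 G T \<phi> (act z \<sigma>) = cnj z * iota0 G T \<phi> \<sigma>"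
  proof (cases "\<sigma> \<in> over T (units G)")
    case True
    then obtain x w where xw: "x \<in> units G" "w \<in> circle" "\<sigma> = tincl T (x, w)" by (auto simp: over_units)
    then have "act z \<sigma> = tincl T (x, z * w)" using z by (simp add: act_eq)
    then show ?thesis using xw z iota0_tincl[OF xw(1) circle_mult[OF z xw(2)]] iota0_tincl[OF xw(1,2)]
      by simp
  next
    case False
    then have "act z \<sigma> \<notin> over T (units G)" using act_q[OF s z] s by (simp add: over_def)
    then show ?thesis using False by (simp add: iota0_off)
  qed
qed

end

section \<open>Topology of ample groupoids and twists\<close>

lemma continuous_map_mul:
  assumes "topological_groupoid G" "continuous_map X (gtop G) f" "continuous_map X (gtop G) g"
    and "\<And>x. x \<in> topspace X \<Longrightarrow> src G (f x) = rng G (g x)"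
  shows "continuous_map X (gtop G) (\<lambda>x. mul G (f x) (g x))"
proof -
  have "continuous_map X (subtopology (prod_topology (gtop G) (gtop G)) (composable G)) (\<lambda>x. (f x, g x))"
    unfolding continuous_map_in_subtopology
  proof
    show "continuous_map X (prod_topology (gtop G) (gtop G)) (\<lambda>x. (f x, g x))"
      by (rule continuous_map_pairedI[OF assms(2,3)])
    show "(\<lambda>x. (f x, g x)) \<in> topspace X \<rightarrow> composable G"
      using assms(4) continuous_map_image_subset_topspace[OF assms(2)] continuous_map_image_subset_topspace[OF assms(3)]
      by (auto simp: composable_def arrows_def)
  qed
  moreover have "continuous_map (subtopology (prod_topology (gtop G) (gtop G)) (composable G)) (gtop G)
       (\<lambda>(x, y). mul G x y)"
    using assms(1) by (simp add: topological_groupoid_def)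
  ultimately have "continuous_map X (gtop G) ((\<lambda>(x, y). mul G x y) \<circ> (\<lambda>x. (f x, g x)))"
    by (rule continuous_map_compose)
  then show ?thesis by (simp add: o_def)
qed

lemma continuous_map_ginv:
  assumes "topological_groupoid G" "continuous_map X (gtop G) f"
  shows "continuous_map X (gtop G) (\<lambda>x. ginv G (f x))"
  using assms continuous_map_compose[OF assms(2), of "gtop G" "ginv G"]
  by (simp add: topological_groupoid_def o_def)

text \<open>Source and range are the products of an arrow with its inverse, in the two orders, so
  their continuity comes from that of the operations.\<close>

lemma continuous_map_src:
  assumes "topological_groupoid G"
  shows "continuous_map (gtop G) (gtop G) (src G)" "continuous_map (gtop G) (gtop G) (rng G)"
proof -
  interpret groupoid G using assms by unfold_locales (simp add: topological_groupoid_def)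
  have id: "continuous_map (gtop G) (gtop G) (\<lambda>x. x)" by simp
  note inv = continuous_map_ginv[OF assms id]
  show "continuous_map (gtop G) (gtop G) (src G)"
    by (rule continuous_map_eq[OF continuous_map_mul[OF assms inv id]]) (auto simp flip: arrows_def)
  show "continuous_map (gtop G) (gtop G) (rng G)"
    by (rule continuous_map_eq[OF continuous_map_mul[OF assms id inv]]) (auto simp flip: arrows_def)
qed

lemma continuous_map_complex_mult:
  fixes f g :: "'a \<Rightarrow> complex"
  assumes "continuous_map X euclidean f" "continuous_map X euclidean g"
  shows "continuous_map X euclidean (\<lambda>x. f x * g x)"
  using assms by (simp add: continuous_map_atin tendsto_mult)

lemma continuous_map_complex_add:
  fixes f g :: "'a \<Rightarrow> complex"
  assumes "continuous_map X euclidean f" "continuous_map X euclidean g"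
  shows "continuous_map X euclidean (\<lambda>x. f x + g x)"
  using assms by (simp add: continuous_map_atin tendsto_add)

lemma continuous_map_complex_cnj:
  fixes f :: "'a \<Rightarrow> complex"
  assumes "continuous_map X euclidean f"
  shows "continuous_map X euclidean (\<lambda>x. cnj (f x))"
  using assms by (simp add: continuous_map_atin tendsto_cnj)

text \<open>Functions are built piecewise on open and closed sets throughout; this glues a
  continuous piece to a constant on the complement.\<close>

lemma continuous_map_clopen_extend:
  assumes A: "openin X A" "closedin X A" and f: "continuous_map (subtopology X A) Y f"
    and c: "\<And>x. x \<in> topspace X \<Longrightarrow> x \<notin> A \<Longrightarrow> f x = c" "c \<in> topspace Y"
  shows "continuous_map X Y f"
  unfolding continuous_map_def
proof (intro conjI allI impI)
  have AX: "A \<subseteq> topspace X" using A openin_subset by blast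
  show "f \<in> topspace X \<rightarrow> topspace Y"
    using continuous_map_funspace[OF f] c AX by (auto simp: Pi_iff) 
  fix U assume U: "openin Y U"
  have "openin (subtopology X A) {x \<in> topspace (subtopology X A). f x \<in> U}"
    by (rule openin_continuous_map_preimage[OF f U])
  moreover have "{x \<in> topspace (subtopology X A). f x \<in> U} = {x \<in> A. f x \<in> U}" using AX by auto
  ultimately have 1: "openin X {x \<in> A. f x \<in> U}"
    using A openin_trans_full by metis
  have 2: "openin X (if c \<in> U then topspace X - A else {})" using A by auto
  have "{x \<in> topspace X. f x \<in> U} = {x \<in> A. f x \<in> U} \<union> (if c \<in> U then topspace X - A else {})"
    using c AX by auto
  then show "openin X {x \<in> topspace X. f x \<in> U}" using openin_Un[OF 1 2] by simp
qed

text \<open>In a Hausdorff space a compact set containing the nonzero set is closed and so contains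
  the closed support; supports then never have to be computed.\<close>

lemma Cc_iff:
  assumes "Hausdorff_space X"
  shows "f \<in> Cc X \<longleftrightarrow> continuous_map X euclidean f \<and>
    (\<exists>K. compactin X K \<and> (\<forall>x\<in>topspace X. f x \<noteq> 0 \<longrightarrow> x \<in> K)) \<and> (\<forall>x. x \<notin> topspace X \<longrightarrow> f x = 0)"
proof -
  let ?N = "{x \<in> topspace X. f x \<noteq> 0}"
  have "compactin X (X closure_of ?N) \<longleftrightarrow> (\<exists>K. compactin X K \<and> (\<forall>x\<in>topspace X. f x \<noteq> 0 \<longrightarrow> x \<in> K))"
  proof
    assume "compactin X (X closure_of ?N)"
    then show "\<exists>K. compactin X K \<and> (\<forall>x\<in>topspace X. f x \<noteq> 0 \<longrightarrow> x \<in> K)"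
      using closure_of_subset[of ?N X] by (intro exI[of _ "X closure_of ?N"]) auto
  next
    assume "\<exists>K. compactin X K \<and> (\<forall>x\<in>topspace X. f x \<noteq> 0 \<longrightarrow> x \<in> K)"
    then obtain K where K: "compactin X K" "?N \<subseteq> K" by auto
    then have "X closure_of ?N \<subseteq> K"
      using compactin_imp_closedin[OF assms K(1)] by (simp add: closure_of_minimal)
    then show "compactin X (X closure_of ?N)" by (rule closed_compactin[OF K(1) _ closedin_closure_of])
  qed
  then show ?thesis by (auto simp: Cc_def)
qed

lemma Cc_bounded:
  assumes "f \<in> Cc X"
  obtains C where "\<And>x. norm (f x) \<le> C" "0 \<le> C"
proof -
  let ?N = "{x \<in> topspace X. f x \<noteq> 0}"
  have "compactin euclidean (f ` (X closure_of ?N))"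
    using assms unfolding Cc_def by (blast intro: image_compactin)
  then have "bounded (f ` (X closure_of ?N))" by (simp add: compact_imp_bounded)
  then obtain C where C: "\<And>y. y \<in> f ` (X closure_of ?N) \<Longrightarrow> norm y \<le> C" by (auto simp: bounded_iff)
  have "norm (f x) \<le> max C 0" for x
  proof (cases "x \<in> ?N")
    case True
    then have "x \<in> X closure_of ?N" using closure_of_subset[of ?N X] by auto
    then show ?thesis using C by fastforce
  next
    case False
    then show ?thesis using assms by (auto simp: Cc_def)
  qed
  then show ?thesis using that[of "max C 0"] by simp
qed

section \<open>Compact open sets and bisections in an ample groupoid\<close>

locale ample_groupoid =
  fixes G :: "'a tgroupoid"
  assumes ample: "ample G" and Hausdorff: "Hausdorff_space (gtop G)"

sublocale ample_groupoid \<subseteq> groupoid G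
  using ample by unfold_locales (simp add: ample_def topological_groupoid_def)

context ample_groupoid
begin

lemma topological: "topological_groupoid G"
  using ample by (simp add: ample_def)

lemmas continuous_src = continuous_map_src(1)[OF topological]
  and continuous_rng = continuous_map_src(2)[OF topological]

lemma compact_open_bisection:
  assumes "openin (gtop G) W" "x \<in> W"
  obtains B where "compactin (gtop G) B" "openin (gtop G) B" "bisection G B" "x \<in> B" "B \<subseteq> W"
  using assms ample unfolding ample_def by blast

lemma bisection_inj:
  assumes "bisection G B"
  shows "inj_on (rng G) B" "inj_on (src G) B"
proof -
  obtain U where U: "B \<subseteq> U" "openin (gtop G) U" "homeo_onto_open G U (rng G)" "homeo_onto_open G U (src G)"
    using assms by (auto simp: bisection_def)
  then have "inj_on (rng G) U" "inj_on (src G) U"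
    using openin_subset[OF U(2)]
    by (auto simp: homeo_onto_open_def homeomorphic_eq_everything_map topspace_subtopology Int_absorb1)
  then show "inj_on (rng G) B" "inj_on (src G) B" using U(1) inj_on_subset by blast+
qed

lemma units_subset: "units G \<subseteq> topspace (gtop G)"
  using units_arrows by (auto simp: arrows_def)

lemma topspace_unit_top [simp]: "topspace (unit_top G) = units G"
  using units_subset by (auto simp: unit_top_def)

lemma units_open: "openin (gtop G) (units G)"
proof (subst openin_subopen, intro ballI)
  fix x assume x: "x \<in> units G"
  then obtain B where B: "openin (gtop G) B" "bisection G B" "x \<in> B"
    using compact_open_bisection[OF openin_topspace, of x] units_subset by blast
  \<comment> \<open>For \<open>y\<close> in this set, \<open>y\<close> and its source both lie in
    the bisection \<open>B\<close> and have the same source, so they coincide.\<close>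
  let ?W = "{y \<in> topspace (gtop G). src G y \<in> B} \<inter> B"
  have "openin (gtop G) ?W"
    using openin_continuous_map_preimage[OF continuous_src B(1)] B(1) by blast
  moreover have "x \<in> ?W" using x B units_subset by auto
  moreover have "?W \<subseteq> units G"
  proof
    fix y assume y: "y \<in> ?W"
    then have ya: "y \<in> arrows G" by (simp add: arrows_def)
    then have "src G y = y" using y inj_onD[OF bisection_inj(2)[OF B(2)], of "src G y" y] by auto
    then show "y \<in> units G" using ya by (simp add: units_iff)
  qed
  ultimately show "\<exists>W. openin (gtop G) W \<and> x \<in> W \<and> W \<subseteq> units G" by blast
qed

lemma units_closed: "closedin (gtop G) (units G)"
proof -
  have "closedin (gtop G) {x \<in> topspace (gtop G). src G x = x}"
    by (rule closedin_continuous_maps_eq[OF Hausdorff continuous_src]) simp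
  moreover have "{x \<in> topspace (gtop G). src G x = x} = units G"
    using units_iff unfolding arrows_def by blast
  ultimately show ?thesis by metis
qed

lemma openin_unit_top: "openin (unit_top G) U \<longleftrightarrow> openin (gtop G) U \<and> U \<subseteq> units G"
  unfolding unit_top_def by (rule openin_open_subtopology[OF units_open])

lemma compactin_unit_top: "compactin (unit_top G) K \<longleftrightarrow> compactin (gtop G) K \<and> K \<subseteq> units G"
  unfolding unit_top_def by (rule compactin_subtopology)

lemma Hausdorff_unit_top: "Hausdorff_space (unit_top G)"
  unfolding unit_top_def by (rule Hausdorff_space_subtopology[OF Hausdorff])

lemma compact_closed: "compactin (gtop G) K \<Longrightarrow> closedin (gtop G) K"
  by (rule compactin_imp_closedin[OF Hausdorff])

lemma homeo_onto_open_image: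
  assumes "homeo_onto_open G U f" "openin (gtop G) V" "V \<subseteq> U"
  shows "openin (gtop G) (f ` V)"
proof -
  have "openin (subtopology (gtop G) U) V" using assms(2,3) by (auto simp: openin_subtopology)
  moreover have "open_map (subtopology (gtop G) U) (subtopology (unit_top G) (f ` U)) f"
    using assms(1) by (simp add: homeo_onto_open_def homeomorphic_imp_open_map)
  ultimately have "openin (subtopology (unit_top G) (f ` U)) (f ` V)"
    by (simp add: open_map_def)
  then have "openin (unit_top G) (f ` V)"
    by (rule openin_trans_full) (use assms(1) in \<open>simp add: homeo_onto_open_def\<close>)
  then show ?thesis by (simp add: openin_unit_top)
qed

lemma bisection_image_open:
  assumes "bisection G B" "openin (gtop G) V" "V \<subseteq> B"
  shows "openin (gtop G) (rng G ` V)" "openin (gtop G) (src G ` V)"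
  using assms homeo_onto_open_image unfolding bisection_def by (meson subset_trans)+

lemma homeo_onto_open_section:
  assumes U: "homeo_onto_open G U f" "openin (gtop G) U" and B: "B \<subseteq> U"
  obtains \<beta> where "continuous_map (subtopology (gtop G) (f ` B)) (gtop G) \<beta>"
    "\<And>x. x \<in> B \<Longrightarrow> \<beta> (f x) = x"
proof -
  obtain g where g: "homeomorphic_maps (subtopology (gtop G) U) (subtopology (unit_top G) (f ` U)) f g"
    using U by (auto simp: homeo_onto_open_def homeomorphic_map_maps)
  have fU: "f ` U \<subseteq> units G" using U openin_unit_top by (auto simp: homeo_onto_open_def)
  then have eq: "subtopology (unit_top G) (f ` U) = subtopology (gtop G) (f ` U)"
    by (simp add: unit_top_def subtopology_subtopology Int_absorb1)
  have "continuous_map (subtopology (gtop G) (f ` U)) (gtop G) g"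
    using g unfolding homeomorphic_maps_def eq by (simp add: continuous_map_in_subtopology)
  then have "continuous_map (subtopology (gtop G) (f ` B)) (gtop G) g"
    using B by (meson continuous_map_from_subtopology_mono image_mono)
  moreover have "g (f x) = x" if "x \<in> B" for x
    using g that B openin_subset[OF U(2)] unfolding homeomorphic_maps_def by auto
  ultimately show ?thesis using that by blast
qed

lemma bisection_section:
  assumes "bisection G B"
  obtains \<beta> where "continuous_map (subtopology (gtop G) (rng G ` B)) (gtop G) \<beta>"
    "\<And>x. x \<in> B \<Longrightarrow> \<beta> (rng G x) = x"
  using assms homeo_onto_open_section unfolding bisection_def by metis

text \<open>Finitely many compact open bisections inside \<open>W\<close> cover \<open>K\<close>.
  The resulting indicators do the work of Urysohn functions.\<close>

lemma compact_open_between: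
  assumes K: "compactin (gtop G) K" and W: "openin (gtop G) W" and KW: "K \<subseteq> W"
  obtains V where "compactin (gtop G) V" "openin (gtop G) V" "K \<subseteq> V" "V \<subseteq> W"
proof -
  let ?U = "{B. compactin (gtop G) B \<and> openin (gtop G) B \<and> B \<subseteq> W}"
  have "K \<subseteq> \<Union>?U" using compact_open_bisection[OF W] KW by blast
  then obtain F where F: "finite F" "F \<subseteq> ?U" "K \<subseteq> \<Union>F" using compactinD[OF K, of ?U] by blast
  show ?thesis
  proof (rule that[of "\<Union>F"])
    show "compactin (gtop G) (\<Union>F)" using F by (intro compactin_Union) auto
  qed (use F in auto)
qed

end

locale ample_twist = ample_groupoid G for G :: "'a tgroupoid" +
  fixes T :: "('a, 'b) twist"
  assumes twist': "is_twist G T"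

sublocale ample_twist \<subseteq> twisted_groupoid G T
  by unfold_locales (rule twist')

context ample_twist
begin

lemma top_tot: "topological_groupoid \<Sigma>" and Hausdorff_tot: "Hausdorff_space (gtop \<Sigma>)"
  and continuous_i: "continuous_map (prod_topology (unit_top G) (top_of_set circle)) (gtop \<Sigma>) (tincl T)"
  and continuous_q: "continuous_map (gtop \<Sigma>) (gtop G) q"
  using twist by (auto simp: is_twist_def circle_bundle_def)

lemma over_open: "openin (gtop G) U \<Longrightarrow> openin (gtop \<Sigma>) (over T U)"
  using openin_continuous_map_preimage[OF continuous_q, of U] by (simp add: over_def arrows_def)

lemma over_closed: "closedin (gtop G) U \<Longrightarrow> closedin (gtop \<Sigma>) (over T U)"
  using closedin_continuous_map_preimage[OF continuous_q, of U] by (simp add: over_def arrows_def)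

text \<open>A set over which a contravariant function can be written in coordinates: the bisection
  isolates one arrow in each fibre, and \<open>S\<close> chooses its lift continuously.\<close>

definition trivial_piece :: "'a set \<Rightarrow> ('a \<Rightarrow> 'b) \<Rightarrow> bool" where
  "trivial_piece B S \<longleftrightarrow> compactin (gtop G) B \<and> openin (gtop G) B \<and> bisection G B
    \<and> continuous_map (subtopology (gtop G) B) (gtop \<Sigma>) S \<and> (\<forall>\<beta>\<in>B. q (S \<beta>) = \<beta>)"

lemma trivial_piece_subset: "trivial_piece B S \<Longrightarrow> B \<subseteq> arrows G"
  by (auto simp: trivial_piece_def arrows_def dest: openin_subset)

lemma trivial_piece_section:
  assumes "trivial_piece B S" "\<beta> \<in> B"
  shows "S \<beta> \<in> arrows \<Sigma>" "q (S \<beta>) = \<beta>"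
proof -
  have "\<beta> \<in> topspace (gtop G)" using trivial_piece_subset[OF assms(1)] assms(2) by (auto simp: arrows_def)
  moreover have "continuous_map (subtopology (gtop G) B) (gtop \<Sigma>) S" using assms by (simp add: trivial_piece_def)
  ultimately show "S \<beta> \<in> arrows \<Sigma>" 
    using assms(2) continuous_map_funspace by (fastforce simp: arrows_def)
  show "q (S \<beta>) = \<beta>" using assms by (simp add: trivial_piece_def)
qed


lemma trivial_piece_exists:
  assumes W: "openin (gtop G) W" "\<alpha> \<in> W"
  obtains B S where "trivial_piece B S" "\<alpha> \<in> B" "B \<subseteq> W"
proof -
  have "\<alpha> \<in> arrows G" using W openin_subset by (auto simp: arrows_def)
  then obtain U S where U: "openin (gtop G) U" "\<alpha> \<in> U"
    "continuous_map (subtopology (gtop G) U) (gtop \<Sigma>) S" "\<forall>\<beta>\<in>U. q (S \<beta>) = \<beta>"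
    using twist unfolding is_twist_def by blast
  obtain B where B: "compactin (gtop G) B" "openin (gtop G) B" "bisection G B" "\<alpha> \<in> B" "B \<subseteq> U \<inter> W"
    using compact_open_bisection[of "U \<inter> W" \<alpha>] U W by blast
  have "trivial_piece B S" unfolding trivial_piece_def using B U continuous_map_from_subtopology_mono by blast
  then show ?thesis using that B by blast
qed

section \<open>Compactly supported contravariant functions and their convolution\<close>

lemma CcT_iff:
  "f \<in> CcT G T \<longleftrightarrow> continuous_map (gtop \<Sigma>) euclidean f \<and> contra f \<and>
    (\<exists>K. compactin (gtop \<Sigma>) K \<and> (\<forall>\<sigma>\<in>arrows \<Sigma>. f \<sigma> \<noteq> 0 \<longrightarrow> \<sigma> \<in> K)) \<and> (\<forall>\<sigma>. \<sigma> \<notin> arrows \<Sigma> \<longrightarrow> f \<sigma> = 0)"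
  by (auto simp: CcT_def Cc_iff[OF Hausdorff_tot] arrows_def)

lemma CcT_contra: "f \<in> CcT G T \<Longrightarrow> contra f"
  by (simp add: CcT_iff)

lemma CcT_off: "f \<in> CcT G T \<Longrightarrow> \<sigma> \<notin> arrows \<Sigma> \<Longrightarrow> f \<sigma> = 0"
  by (simp add: CcT_iff)

lemma CcT_zero: "(\<lambda>_. 0) \<in> CcT G T"
  by (auto simp: CcT_iff contravariant_def intro!: exI[of _ "{}"])

lemma CcT_add:
  assumes "f \<in> CcT G T" "g \<in> CcT G T"
  shows "(\<lambda>\<sigma>. f \<sigma> + g \<sigma>) \<in> CcT G T"
proof -
  obtain K L where "compactin (gtop \<Sigma>) K" "\<forall>\<sigma>\<in>arrows \<Sigma>. f \<sigma> \<noteq> 0 \<longrightarrow> \<sigma> \<in> K"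
      "compactin (gtop \<Sigma>) L" "\<forall>\<sigma>\<in>arrows \<Sigma>. g \<sigma> \<noteq> 0 \<longrightarrow> \<sigma> \<in> L"
    using assms by (auto simp: CcT_iff)
  then have "compactin (gtop \<Sigma>) (K \<union> L) \<and> (\<forall>\<sigma>\<in>arrows \<Sigma>. f \<sigma> + g \<sigma> \<noteq> 0 \<longrightarrow> \<sigma> \<in> K \<union> L)"
    by (auto intro: compactin_Un)
  then have "\<exists>K. compactin (gtop \<Sigma>) K \<and> (\<forall>\<sigma>\<in>arrows \<Sigma>. f \<sigma> + g \<sigma> \<noteq> 0 \<longrightarrow> \<sigma> \<in> K)" by blast
  then show ?thesis using assms unfolding CcT_iff
    by (auto simp: contravariant_def distrib_left intro!: continuous_map_complex_add)
qed

lemma CcT_scale: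
  assumes "f \<in> CcT G T"
  shows "(\<lambda>\<sigma>. c * f \<sigma>) \<in> CcT G T"
  using assms unfolding CcT_iff
  by (auto simp: contravariant_def intro!: continuous_map_complex_mult)

lemma CcT_diff:
  assumes "f \<in> CcT G T" "g \<in> CcT G T"
  shows "(\<lambda>\<sigma>. f \<sigma> - g \<sigma>) \<in> CcT G T"
  using CcT_add[OF assms(1) CcT_scale[OF assms(2), of "-1"]] by simp

lemma CcT_restrict:
  assumes f: "f \<in> CcT G T" and B: "openin (gtop G) B" "closedin (gtop G) B"
  shows "(\<lambda>\<sigma>. if \<sigma> \<in> over T B then f \<sigma> else 0) \<in> CcT G T"
proof -
  have "continuous_map (gtop \<Sigma>) euclidean (\<lambda>\<sigma>. if \<sigma> \<in> over T B then f \<sigma> else 0)"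
  proof (rule continuous_map_clopen_extend[OF over_open[OF B(1)] over_closed[OF B(2)]])
    have "continuous_map (subtopology (gtop \<Sigma>) (over T B)) euclidean f"
      using f by (simp add: CcT_iff continuous_map_from_subtopology)
    then show "continuous_map (subtopology (gtop \<Sigma>) (over T B)) euclidean (\<lambda>\<sigma>. if \<sigma> \<in> over T B then f \<sigma> else 0)"
      by (rule continuous_map_eq) auto
  qed auto
  moreover have "contra (\<lambda>\<sigma>. if \<sigma> \<in> over T B then f \<sigma> else 0)"
    unfolding contravariant_def
  proof (intro ballI)
    fix \<sigma> z assume s: "\<sigma> \<in> arrows \<Sigma>" and z: "z \<in> circle"
    have "act z \<sigma> \<in> over T B \<longleftrightarrow> \<sigma> \<in> over T B"
      using act_closed[OF s z] act_q[OF s z] s by (simp add: over_def)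
    then show "(if act z \<sigma> \<in> over T B then f (act z \<sigma>) else 0) = cnj z * (if \<sigma> \<in> over T B then f \<sigma> else 0)"
      using contraD[OF CcT_contra[OF f] s z] by simp
  qed
  ultimately show ?thesis using f unfolding CcT_iff by auto
qed

text \<open>Cutting a function off to a compact open piece preserves continuity, so it decomposes
  into finitely many functions over trivial pieces without a partition of unity. Statements about
  \<open>CcT\<close> thereby reduce to a single bisection.\<close>

lemma CcT_induct [consumes 1, case_names zero add trivial_piece]:
  assumes f: "f \<in> CcT G T"
    and zero: "P (\<lambda>_. 0)"
    and add: "\<And>f g. f \<in> CcT G T \<Longrightarrow> g \<in> CcT G T \<Longrightarrow> P f \<Longrightarrow> P g \<Longrightarrow> P (\<lambda>\<sigma>. f \<sigma> + g \<sigma>)"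
    and trivial_piece: "\<And>f B S. f \<in> CcT G T \<Longrightarrow> trivial_piece B S \<Longrightarrow> (\<And>\<sigma>. \<sigma> \<notin> over T B \<Longrightarrow> f \<sigma> = 0) \<Longrightarrow> P f"
  shows "P f"
proof -
  have fin: "finite F \<Longrightarrow> F \<subseteq> {B. \<exists>S. trivial_piece B S} \<Longrightarrow> f \<in> CcT G T \<Longrightarrow>
      (\<And>\<sigma>. \<sigma> \<notin> over T (\<Union>F) \<Longrightarrow> f \<sigma> = 0) \<Longrightarrow> P f" for F f
  proof (induction F arbitrary: f rule: finite_induct)
    case empty
    then have "f = (\<lambda>_. 0)" by (auto simp: over_def)
    then show ?case using zero by simp
  next
    case (insert B F)
    then obtain S where S: "trivial_piece B S" by auto
    then have B: "openin (gtop G) B" "closedin (gtop G) B" by (auto simp: trivial_piece_def compact_closed)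
    \<comment> \<open>The part over \<open>B\<close> is split off; the rest vanishes over
      \<open>B\<close>, so it is supported over the union of the remaining pieces.\<close>
    let ?g = "\<lambda>\<sigma>. if \<sigma> \<in> over T B then f \<sigma> else 0" and ?h = "\<lambda>\<sigma>. f \<sigma> - (if \<sigma> \<in> over T B then f \<sigma> else 0)"
    have g: "?g \<in> CcT G T" by (rule CcT_restrict[OF insert.prems(2) B])
    have h: "?h \<in> CcT G T" by (rule CcT_diff[OF insert.prems(2) g])
    have "P ?g" by (rule trivial_piece[OF g S]) simp
    moreover have "P ?h"
    proof (rule insert.IH[OF _ h])
      fix \<sigma> assume "\<sigma> \<notin> over T (\<Union>F)"
      then show "?h \<sigma> = 0" using insert.prems(3)[of \<sigma>] by (auto simp: over_def)
    qed (use insert.prems in auto)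
    ultimately have "P (\<lambda>\<sigma>. ?g \<sigma> + ?h \<sigma>)" using add g h by blast
    then show ?case by simp
  qed
  obtain K where K: "compactin (gtop \<Sigma>) K" "\<forall>\<sigma>\<in>arrows \<Sigma>. f \<sigma> \<noteq> 0 \<longrightarrow> \<sigma> \<in> K"
    using f by (auto simp: CcT_iff)
  have qK: "compactin (gtop G) (q ` K)" by (rule image_compactin[OF K(1) continuous_q])
  let ?U = "{B. \<exists>S. trivial_piece B S}"
  have "q ` K \<subseteq> \<Union>?U"
  proof
    fix x assume "x \<in> q ` K"
    then have "x \<in> topspace (gtop G)" using compactin_subset_topspace[OF qK] by auto
    then obtain B S where "trivial_piece B S" "x \<in> B" by (rule trivial_piece_exists[OF openin_topspace])
    then show "x \<in> \<Union>?U" by blast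
  qed
  then obtain F where F: "finite F" "F \<subseteq> ?U" "q ` K \<subseteq> \<Union>F"
    using compactinD[OF qK, of ?U] by (auto simp: trivial_piece_def)
  show ?thesis
  proof (rule fin[OF F(1,2) f])
    fix \<sigma> assume "\<sigma> \<notin> over T (\<Union>F)"
    then show "f \<sigma> = 0" using F(3) K(2) CcT_off[OF f] by (auto simp: over_def)
  qed
qed

lemma CcT_bounded:
  assumes "f \<in> CcT G T"
  obtains C where "\<And>x. norm (f x) \<le> C" "0 \<le> C"
  using assms Cc_bounded by (auto simp: CcT_def)

lemma CcT_finite_fibre:
  assumes "f \<in> CcT G T"
  shows "finite {\<eta> \<in> arrows G. rng G \<eta> = x \<and> f (lift T \<eta>) \<noteq> 0}" (is "finite (?R f)")
    and "finite {\<eta> \<in> arrows G. src G \<eta> = x \<and> f (lift T \<eta>) \<noteq> 0}" (is "finite (?L f)")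
proof -
  have "finite (?R f) \<and> finite (?L f)" using assms
  proof (induction rule: CcT_induct)
    case (add f g)
    have "?R (\<lambda>\<sigma>. f \<sigma> + g \<sigma>) \<subseteq> ?R f \<union> ?R g" "?L (\<lambda>\<sigma>. f \<sigma> + g \<sigma>) \<subseteq> ?L f \<union> ?L g" by auto
    then show ?case using add by (meson finite_Un finite_subset)
  next
    case (trivial_piece f B S)
    then have B: "inj_on (rng G) B" "inj_on (src G) B" using bisection_inj by (auto simp: trivial_piece_def)
    have "?R f \<subseteq> {\<eta> \<in> B. rng G \<eta> = x}" "?L f \<subseteq> {\<eta> \<in> B. src G \<eta> = x}"
      using trivial_piece(3) by (force simp: over_def)+
    moreover have "finite {\<eta> \<in> B. rng G \<eta> = x}" "finite {\<eta> \<in> B. src G \<eta> = x}"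
      using finite_vimage_IntI[OF _ B(1), of "{x}"] finite_vimage_IntI[OF _ B(2), of "{x}"]
      by (simp_all add: vimage_def Int_def conj_commute)
    ultimately show ?case using finite_subset by blast
  qed auto
  then show "finite (?R f)" "finite (?L f)" by auto
qed

lemma conv_summable:
  assumes "f \<in> CcT G T"
  shows "(\<lambda>\<eta>. f (lift T \<eta>) * g \<eta>) summable_on {\<eta> \<in> arrows G. rng G \<eta> = x}"
proof (rule finite_nonzero_values_imp_summable_on, rule finite_subset[OF _ CcT_finite_fibre(1)[OF assms]])
  show "{\<eta> \<in> {\<eta> \<in> arrows G. rng G \<eta> = x}. f (lift T \<eta>) * g \<eta> \<noteq> 0} \<subseteq> {\<eta> \<in> arrows G. rng G \<eta> = x \<and> f (lift T \<eta>) \<noteq> 0}"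
    by auto
qed

lemma conv_add_left:
  assumes "f \<in> CcT G T" "f' \<in> CcT G T"
  shows "conv G T (\<lambda>\<sigma>. f \<sigma> + f' \<sigma>) g = (\<lambda>\<sigma>. conv G T f g \<sigma> + conv G T f' g \<sigma>)"
  by (auto simp: fun_eq_iff conv_def distrib_right intro!: infsum_add conv_summable assms)

text \<open>A bisection meets the range fibre of \<open>q \<sigma>\<close> at most once, so the
  convolution sum collapses to one term, whose lift may be taken from the continuous section
  \<open>S\<close>.\<close>

lemma conv_trivial_piece:
  assumes f: "f \<in> CcT G T" and g: "contra g" and B: "trivial_piece B S"
    and off: "\<And>\<sigma>. \<sigma> \<notin> over T B \<Longrightarrow> f \<sigma> = 0" and s: "\<sigma> \<in> arrows \<Sigma>"
  shows "\<beta> \<in> B \<Longrightarrow> rng G \<beta> = rng G (q \<sigma>) \<Longrightarrow> conv G T f g \<sigma> = f (S \<beta>) * g (mul \<Sigma> (ginv \<Sigma> (S \<beta>)) \<sigma>)"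
    and "rng G (q \<sigma>) \<notin> rng G ` B \<Longrightarrow> conv G T f g \<sigma> = 0"
proof -
  let ?t = "\<lambda>\<eta>. f (lift T \<eta>) * g (mul \<Sigma> (ginv \<Sigma> (lift T \<eta>)) \<sigma>)"
  have inj: "inj_on (rng G) B" using B bisection_inj by (auto simp: trivial_piece_def)
  have z: "?t \<eta> = 0" if "\<eta> \<in> arrows G" "\<eta> \<notin> B" for \<eta> 
    using off[of "lift T \<eta>"] that by (simp add: over_def)
  have c: "conv G T f g \<sigma> = infsum ?t {\<eta> \<in> arrows G. rng G \<eta> = rng G (q \<sigma>)}"
    using s by (simp add: conv_def)
  {
    assume "rng G (q \<sigma>) \<notin> rng G ` B"
    then have "?t \<eta> = 0" if "\<eta> \<in> {\<eta> \<in> arrows G. rng G \<eta> = rng G (q \<sigma>)}" for \<eta> 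
      using z[of \<eta>] that by (metis (mono_tags, lifting) image_eqI mem_Collect_eq)
    then show "conv G T f g \<sigma> = 0" unfolding c by (rule infsum_0)
  }
  assume b: "\<beta> \<in> B" "rng G \<beta> = rng G (q \<sigma>)"
  have ba: "\<beta> \<in> arrows G" using b trivial_piece_subset[OF B] by auto
  have "infsum ?t {\<eta> \<in> arrows G. rng G \<eta> = rng G (q \<sigma>)} = infsum ?t {\<beta>}"
  proof (rule infsum_cong_neutral)
    fix \<eta> assume "\<eta> \<in> {\<eta> \<in> arrows G. rng G \<eta> = rng G (q \<sigma>)} - {\<beta>}"
    then show "?t \<eta> = 0" using z[of \<eta>] b inj_onD[OF inj, of \<eta> \<beta>] by (metis (mono_tags, lifting) DiffE insertCI mem_Collect_eq)
  qed (use b ba in auto)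
  then have "conv G T f g \<sigma> = ?t \<beta>" unfolding c by simp
  also have "\<dots> = f (S \<beta>) * g (mul \<Sigma> (ginv \<Sigma> (S \<beta>)) \<sigma>)"
    using trivial_piece_section[OF B b(1)] ba b s by (intro conv_term CcT_contra[OF f] g) (auto simp: tot_rng_eq)
  finally show "conv G T f g \<sigma> = f (S \<beta>) * g (mul \<Sigma> (ginv \<Sigma> (S \<beta>)) \<sigma>)" .
qed

lemma conv_continuous:
  assumes "f \<in> CcT G T" and g: "g \<in> CcT G T"
  shows "continuous_map (gtop \<Sigma>) euclidean (conv G T f g)"
  using assms(1)
proof (induction rule: CcT_induct)
  case zero
  have "conv G T (\<lambda>_. 0) g = (\<lambda>_. 0)" by (auto simp: conv_def fun_eq_iff)
  then show ?case by simp
next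
  case (add f f')
  then show ?case by (simp add: conv_add_left continuous_map_complex_add)
next
  case (trivial_piece f B S)
  have bis: "bisection G B" and Bo: "openin (gtop G) B" and Bc: "compactin (gtop G) B"
    and Sc: "continuous_map (subtopology (gtop G) B) (gtop \<Sigma>) S"
    using trivial_piece(2) by (auto simp: trivial_piece_def)
  \<comment> \<open>Here \<open>\<beta>\<close> inverts the range map on \<open>B\<close>, so the
    one surviving term becomes an explicit continuous expression in \<open>\<sigma>\<close>.\<close>
  obtain \<beta> where \<beta>: "continuous_map (subtopology (gtop G) (rng G ` B)) (gtop G) \<beta>"
    "\<And>x. x \<in> B \<Longrightarrow> \<beta> (rng G x) = x"
    using bisection_section[OF bis] by metis
  have ro: "openin (gtop G) (rng G ` B)" by (rule bisection_image_open(1)[OF bis Bo]) simp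
  have rc: "closedin (gtop G) (rng G ` B)"
    by (rule compact_closed[OF image_compactin[OF Bc continuous_rng]])
  have crq: "continuous_map (gtop \<Sigma>) (gtop G) (\<lambda>\<sigma>. rng G (q \<sigma>))"
    using continuous_map_compose[OF continuous_q continuous_rng] by (simp add: o_def)
  \<comment> \<open>This set is open and closed because the range image of \<open>B\<close> is both
    open and compact; off it the convolution vanishes.\<close>
  let ?A = "{\<sigma> \<in> topspace (gtop \<Sigma>). rng G (q \<sigma>) \<in> rng G ` B}"
  have Ao: "openin (gtop \<Sigma>) ?A" by (rule openin_continuous_map_preimage[OF crq ro])
  have Ac: "closedin (gtop \<Sigma>) ?A" by (rule closedin_continuous_map_preimage[OF crq rc])
  let ?X = "subtopology (gtop \<Sigma>) ?A"
  have "continuous_map ?X (subtopology (gtop G) (rng G ` B)) (\<lambda>\<sigma>. rng G (q \<sigma>))"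
    using crq by (auto simp: continuous_map_in_subtopology continuous_map_from_subtopology)
  from continuous_map_compose[OF this \<beta>(1)]
  have "continuous_map ?X (gtop G) (\<lambda>\<sigma>. \<beta> (rng G (q \<sigma>)))" by (simp add: o_def)
  then have "continuous_map ?X (subtopology (gtop G) B) (\<lambda>\<sigma>. \<beta> (rng G (q \<sigma>)))"
    using \<beta>(2) by (auto simp: continuous_map_in_subtopology)
  from continuous_map_compose[OF this Sc]
  have cS: "continuous_map ?X (gtop \<Sigma>) (\<lambda>\<sigma>. S (\<beta> (rng G (q \<sigma>))))" by (simp add: o_def)
  have id: "continuous_map ?X (gtop \<Sigma>) (\<lambda>\<sigma>. \<sigma>)" by (simp add: continuous_map_from_subtopology)
  have Srng: "rng \<Sigma> (S (\<beta> (rng G (q \<sigma>)))) = rng \<Sigma> \<sigma>" if "\<sigma> \<in> ?A" for \<sigma>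
    using that \<beta>(2) trivial_piece_section[OF trivial_piece(2)] by (auto simp: tot_rng_eq arrows_def[symmetric])
  have Sarr: "S (\<beta> (rng G (q \<sigma>))) \<in> arrows \<Sigma>" if "\<sigma> \<in> ?A" for \<sigma>
    using that \<beta>(2) trivial_piece_section[OF trivial_piece(2)] by auto
  have cm: "continuous_map ?X (gtop \<Sigma>) (\<lambda>\<sigma>. mul \<Sigma> (ginv \<Sigma> (S (\<beta> (rng G (q \<sigma>))))) \<sigma>)"
    by (rule continuous_map_mul[OF top_tot continuous_map_ginv[OF top_tot cS] id])
       (use Srng Sarr in auto)
  have fc: "continuous_map (gtop \<Sigma>) euclidean f" and gc: "continuous_map (gtop \<Sigma>) euclidean g"
    using trivial_piece(1) g by (auto simp: CcT_iff)
  show ?case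
  proof (rule continuous_map_clopen_extend[OF Ao Ac, where c = 0])
    have "continuous_map ?X euclidean (\<lambda>\<sigma>. f (S (\<beta> (rng G (q \<sigma>)))) * g (mul \<Sigma> (ginv \<Sigma> (S (\<beta> (rng G (q \<sigma>))))) \<sigma>))"
      using continuous_map_compose[OF cS fc] continuous_map_compose[OF cm gc]
      by (intro continuous_map_complex_mult) (simp_all add: o_def)
    then show "continuous_map ?X euclidean (conv G T f g)"
    proof (rule continuous_map_eq)
      fix \<sigma> assume "\<sigma> \<in> topspace ?X"
      then obtain b where b: "\<sigma> \<in> arrows \<Sigma>" "b \<in> B" "rng G (q \<sigma>) = rng G b" by (auto simp: arrows_def)
      then show "f (S (\<beta> (rng G (q \<sigma>)))) * g (mul \<Sigma> (ginv \<Sigma> (S (\<beta> (rng G (q \<sigma>))))) \<sigma>) = conv G T f g \<sigma>"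
        using conv_trivial_piece(1)[OF trivial_piece(1) CcT_contra[OF g] trivial_piece(2,3) b(1), of b] \<beta>(2)[OF b(2)] by simp
    qed
    fix \<sigma> assume "\<sigma> \<in> topspace (gtop \<Sigma>)" "\<sigma> \<notin> ?A"
    then show "conv G T f g \<sigma> = 0"
      using conv_trivial_piece(2)[OF trivial_piece(1) CcT_contra[OF g] trivial_piece(2,3)] by (simp add: arrows_def)
  qed simp
qed

text \<open>The composable pairs in \<open>K \<times> L\<close> form a closed part of a compact set,
  since source and range are continuous into a Hausdorff space. This set will contain the support of
  a convolution.\<close>

lemma compact_mul:
  assumes K: "compactin (gtop \<Sigma>) K" and L: "compactin (gtop \<Sigma>) L"
  shows "compactin (gtop \<Sigma>) {mul \<Sigma> a b | a b. a \<in> K \<and> b \<in> L \<and> src \<Sigma> a = rng \<Sigma> b}"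
proof -
  let ?P = "prod_topology (gtop \<Sigma>) (gtop \<Sigma>)"
  have "compactin ?P (K \<times> L)" using K L by (simp add: compactin_Times)
  moreover have "closedin ?P {p \<in> topspace ?P. (src \<Sigma> \<circ> fst) p = (rng \<Sigma> \<circ> snd) p}"
    by (intro closedin_continuous_maps_eq[OF Hausdorff_tot]
        continuous_map_compose[OF continuous_map_fst] continuous_map_compose[OF continuous_map_snd]
        continuous_map_src[OF top_tot])
  ultimately have "compactin ?P ({p \<in> topspace ?P. (src \<Sigma> \<circ> fst) p = (rng \<Sigma> \<circ> snd) p} \<inter> K \<times> L)"
    by (intro closed_Int_compactin)
  then have "compactin (subtopology ?P (composable \<Sigma>)) ({p \<in> topspace ?P. (src \<Sigma> \<circ> fst) p = (rng \<Sigma> \<circ> snd) p} \<inter> K \<times> L)"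
    by (auto simp: compactin_subtopology composable_def arrows_def)
  from image_compactin[OF this, of "gtop \<Sigma>" "\<lambda>(x, y). mul \<Sigma> x y"]
  have "compactin (gtop \<Sigma>) ((\<lambda>(x, y). mul \<Sigma> x y) ` ({p \<in> topspace ?P. (src \<Sigma> \<circ> fst) p = (rng \<Sigma> \<circ> snd) p} \<inter> K \<times> L))"
    using top_tot by (simp add: topological_groupoid_def)
  moreover have "(\<lambda>(x, y). mul \<Sigma> x y) ` ({p \<in> topspace ?P. (src \<Sigma> \<circ> fst) p = (rng \<Sigma> \<circ> snd) p} \<inter> K \<times> L) =
     {mul \<Sigma> a b | a b. a \<in> K \<and> b \<in> L \<and> src \<Sigma> a = rng \<Sigma> b}"
    using compactin_subset_topspace[OF K] compactin_subset_topspace[OF L] by (auto simp: image_iff) blast+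
  ultimately show ?thesis by simp
qed

lemma CcT_conv:
  assumes f: "f \<in> CcT G T" and g: "g \<in> CcT G T"
  shows "conv G T f g \<in> CcT G T"
proof -
  obtain K L where K: "compactin (gtop \<Sigma>) K" "\<forall>\<sigma>\<in>arrows \<Sigma>. f \<sigma> \<noteq> 0 \<longrightarrow> \<sigma> \<in> K"
      and L: "compactin (gtop \<Sigma>) L" "\<forall>\<sigma>\<in>arrows \<Sigma>. g \<sigma> \<noteq> 0 \<longrightarrow> \<sigma> \<in> L"
    using assms by (auto simp: CcT_iff)
  have "\<sigma> \<in> {mul \<Sigma> a b | a b. a \<in> K \<and> b \<in> L \<and> src \<Sigma> a = rng \<Sigma> b}"
    if s: "\<sigma> \<in> arrows \<Sigma>" and nz: "conv G T f g \<sigma> \<noteq> 0" for \<sigma>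
  proof -
    obtain \<eta> where h: "\<eta> \<in> arrows G" "rng G \<eta> = rng G (q \<sigma>)"
      "f (lift T \<eta>) * g (mul \<Sigma> (ginv \<Sigma> (lift T \<eta>)) \<sigma>) \<noteq> 0"
      using nz infsum_0[of "{\<eta> \<in> arrows G. rng G \<eta> = rng G (q \<sigma>)}"
          "\<lambda>\<eta>. f (lift T \<eta>) * g (mul \<Sigma> (ginv \<Sigma> (lift T \<eta>)) \<sigma>)"] s
      by (force simp: conv_def)
    let ?a = "lift T \<eta>" and ?b = "mul \<Sigma> (ginv \<Sigma> (lift T \<eta>)) \<sigma>"
    have c: "rng \<Sigma> ?a = rng \<Sigma> \<sigma>" using h s by (simp add: tot_rng_eq)
    have "?a \<in> K" "?b \<in> L" using h K(2) L(2) s c by auto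
    moreover have "mul \<Sigma> ?a ?b = \<sigma>" "src \<Sigma> ?a = rng \<Sigma> ?b" using h s c by auto
    ultimately show ?thesis by (metis (mono_tags, lifting) mem_Collect_eq)
  qed
  then show ?thesis
    unfolding CcT_iff using conv_continuous[OF f g] conv_contra[OF CcT_contra[OF f] CcT_contra[OF g]]
      compact_mul[OF K(1) L(1)] by (auto simp: conv_def)
qed

lemma CcT_adj:
  assumes f: "f \<in> CcT G T"
  shows "adj T f \<in> CcT G T"
proof -
  obtain K where K: "compactin (gtop \<Sigma>) K" "\<forall>\<sigma>\<in>arrows \<Sigma>. f \<sigma> \<noteq> 0 \<longrightarrow> \<sigma> \<in> K"
    using f by (auto simp: CcT_iff)
  have inv: "continuous_map (gtop \<Sigma>) (gtop \<Sigma>) (ginv \<Sigma>)" using top_tot by (simp add: topological_groupoid_def)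
  have "\<sigma> \<in> ginv \<Sigma> ` K" if "\<sigma> \<in> arrows \<Sigma>" "adj T f \<sigma> \<noteq> 0" for \<sigma>
    using that K(2) by (auto simp: adj_def intro!: rev_image_eqI[of "ginv \<Sigma> \<sigma>"])
  moreover have "compactin (gtop \<Sigma>) (ginv \<Sigma> ` K)" by (rule image_compactin[OF K(1) inv])
  moreover have "continuous_map (gtop \<Sigma>) euclidean (adj T f)"
  proof (rule continuous_map_eq)
    have "continuous_map (gtop \<Sigma>) euclidean (f \<circ> ginv \<Sigma>)"
      using f by (intro continuous_map_compose[OF inv]) (simp add: CcT_iff)
    then show "continuous_map (gtop \<Sigma>) euclidean (\<lambda>\<sigma>. cnj ((f \<circ> ginv \<Sigma>) \<sigma>))"
      by (rule continuous_map_complex_cnj)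
  qed (simp add: adj_def arrows_def)
  ultimately show ?thesis
    unfolding CcT_iff using adj_contra[OF CcT_contra[OF f]] by (auto simp: adj_def)
qed

text \<open>Over a unit the local trivialisation has the form \<open>(x, z) \<mapsto> i(x, z) S(x)\<close> with \<open>S(x) = i(x, w(x))\<close>,
  so the circle coordinate of \<open>i(x, z)\<close> is recovered by comparing the chart at \<open>i(x, z)\<close> and at \<open>i(x, 1)\<close>.\<close>

lemma iota0_continuous:
  assumes \<phi>: "continuous_map (unit_top G) euclidean \<phi>"
  shows "continuous_map (gtop \<Sigma>) euclidean (iota0 G T \<phi>)"
proof (rule continuous_map_clopen_extend[OF over_open[OF units_open] over_closed[OF units_closed], where c = 0])
  have "\<exists>V. openin (gtop \<Sigma>) V \<and> \<sigma> \<in> V \<and> V \<subseteq> over T (units G) \<and> continuous_map (subtopology (gtop \<Sigma>) V) euclidean (iota0 G T \<phi>)"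
    if s: "\<sigma> \<in> over T (units G)" for \<sigma>
  proof -
    have x: "q \<sigma> \<in> units G" "q \<sigma> \<in> arrows G" using s units_arrows by (auto simp: over_def)
    obtain U S where U: "openin (gtop G) U" "q \<sigma> \<in> U"
      "continuous_map (subtopology (gtop G) U) (gtop \<Sigma>) S" "\<forall>\<beta>\<in>U. q (S \<beta>) = \<beta>"
      "homeomorphic_map (prod_topology (subtopology (gtop G) U) (top_of_set circle))
          (subtopology (gtop \<Sigma>) (over T U))
          (\<lambda>(\<beta>, z). mul \<Sigma> (tincl T (rng G \<beta>, z)) (S \<beta>))"
      using twist x(2) unfolding is_twist_def by blast
    have UG: "U \<subseteq> arrows G" using openin_subset[OF U(1)] by (simp add: arrows_def)
    have SU: "S \<beta> \<in> arrows \<Sigma>" if "\<beta> \<in> U" for \<beta>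
      using continuous_map_funspace[OF U(3)] that UG by (auto simp: arrows_def)
    obtain h where h: "homeomorphic_maps (prod_topology (subtopology (gtop G) U) (top_of_set circle))
          (subtopology (gtop \<Sigma>) (over T U)) (\<lambda>(\<beta>, z). mul \<Sigma> (tincl T (rng G \<beta>, z)) (S \<beta>)) h"
      using U(5) by (auto simp: homeomorphic_map_maps)
    define V where "V = over T (U \<inter> units G)"
    define \<zeta> where "\<zeta> = snd \<circ> h"
    have hinv: "h (act z (S \<beta>)) = (\<beta>, z)" if "\<beta> \<in> U" "z \<in> circle" for \<beta> z
      using h that UG SU U(4) by (auto simp: homeomorphic_maps_def act_eq arrows_def)
    have \<zeta>_act: "\<zeta> \<tau> \<in> circle \<and> \<zeta> (act z \<tau>) = z * \<zeta> \<tau>"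
      if t: "\<tau> \<in> over T U" and z: "z \<in> circle" for \<tau> z
    proof -
      have ta: "\<tau> \<in> arrows \<Sigma>" "q \<tau> \<in> U" using t by (auto simp: over_def)
      obtain w where w: "w \<in> circle" "\<tau> = act w (S (q \<tau>))"
        using act_transitive[of "S (q \<tau>)" \<tau>] ta SU U(4) by metis
      have "act z \<tau> = act (z * w) (S (q \<tau>))"
        using w z act_act[OF SU[OF ta(2)] z w(1)] by simp
      then show ?thesis
        using hinv[OF ta(2) w(1)] hinv[OF ta(2) circle_mult[OF z w(1)]] w by (simp add: \<zeta>_def)
    qed
    have Vo: "openin (gtop \<Sigma>) V" unfolding V_def using U(1) units_open by (intro over_open) blast
    have VU: "V \<subseteq> over T U" by (auto simp: V_def over_def)
    have eq: "iota0 G T \<phi> \<tau> = cnj (\<zeta> \<tau> * cnj (\<zeta> (tincl T (q \<tau>, 1)))) * \<phi> (q \<tau>)" if t: "\<tau> \<in> V" for \<tau>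
    proof -
      have tx: "q \<tau> \<in> units G" "q \<tau> \<in> U" "\<tau> \<in> over T (units G)" using t by (auto simp: V_def over_def)
      obtain z where z: "z \<in> circle" "\<tau> = tincl T (q \<tau>, z)"
        using tx(3) unfolding over_units by auto
      let ?u = "tincl T (q \<tau>, 1)"
      have u: "?u \<in> over T U" using tx by (simp add: over_def)
      have "act z ?u = tincl T (q \<tau>, z)" using tx(1) z(1) by (simp add: act_eq)
      then have "act z ?u = \<tau>" using z(2) by simp
      then have "\<zeta> \<tau> = z * \<zeta> ?u" using \<zeta>_act[OF u z(1)] by simp
      then have "\<zeta> \<tau> * cnj (\<zeta> ?u) = z * (\<zeta> ?u * cnj (\<zeta> ?u))" by simp
      also have "\<dots> = z" using \<zeta>_act[OF u z(1)] circle_mult_cnj(1) by (metis mult_1_right)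
      finally show ?thesis using iota0_tincl[OF tx(1) z(1), of \<phi>] z(2) by simp
    qed
    let ?V = "subtopology (gtop \<Sigma>) V"
    have \<zeta>c: "continuous_map (subtopology (gtop \<Sigma>) (over T U)) euclidean \<zeta>"
    proof -
      have "continuous_map (subtopology (gtop \<Sigma>) (over T U)) (top_of_set circle) \<zeta>"
        unfolding \<zeta>_def using h unfolding homeomorphic_maps_def
        by (intro continuous_map_compose[OF _ continuous_map_snd]) auto
      then show ?thesis by (simp add: continuous_map_in_subtopology)
    qed
    then have \<zeta>V: "continuous_map ?V euclidean \<zeta>"
      using VU continuous_map_from_subtopology_mono by blast
    have qV: "continuous_map ?V (unit_top G) q"
      unfolding unit_top_def continuous_map_in_subtopology
      using continuous_map_from_subtopology[OF continuous_q, of V] by (auto simp: V_def over_def)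
    have "continuous_map ?V (prod_topology (unit_top G) (top_of_set circle)) (\<lambda>\<tau>. (q \<tau>, 1))"
      by (intro continuous_map_pairedI qV) auto
    from continuous_map_compose[OF this continuous_i]
    have "continuous_map ?V (gtop \<Sigma>) (\<lambda>\<tau>. tincl T (q \<tau>, 1))" by (simp add: o_def)
    then have "continuous_map ?V (subtopology (gtop \<Sigma>) (over T U)) (\<lambda>\<tau>. tincl T (q \<tau>, 1))"
      by (auto simp: continuous_map_in_subtopology V_def over_def q_i_1)
    from continuous_map_compose[OF this \<zeta>c]
    have \<zeta>V': "continuous_map ?V euclidean (\<lambda>\<tau>. \<zeta> (tincl T (q \<tau>, 1)))" by (simp add: o_def)
    have \<phi>V: "continuous_map ?V euclidean (\<lambda>\<tau>. \<phi> (q \<tau>))"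
      using continuous_map_compose[OF qV \<phi>] by (simp add: o_def)
    have "continuous_map ?V euclidean (\<lambda>\<tau>. cnj (\<zeta> \<tau> * cnj (\<zeta> (tincl T (q \<tau>, 1)))) * \<phi> (q \<tau>))"
      by (intro continuous_map_complex_mult continuous_map_complex_cnj \<zeta>V \<zeta>V' \<phi>V)
    then have "continuous_map ?V euclidean (iota0 G T \<phi>)"
      by (rule continuous_map_eq) (simp add: eq)
    moreover have "\<sigma> \<in> V" "V \<subseteq> over T (units G)" using s U(2) by (auto simp: V_def over_def)
    ultimately show ?thesis using Vo by blast
  qed
  then obtain V where V: "\<And>\<sigma>. \<sigma> \<in> over T (units G) \<Longrightarrow> openin (gtop \<Sigma>) (V \<sigma>) \<and> \<sigma> \<in> V \<sigma> \<and> V \<sigma> \<subseteq> over T (units G)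
      \<and> continuous_map (subtopology (gtop \<Sigma>) (V \<sigma>)) euclidean (iota0 G T \<phi>)" by metis
  show "continuous_map (subtopology (gtop \<Sigma>) (over T (units G))) euclidean (iota0 G T \<phi>)"
    unfolding continuous_map_def
  proof (intro conjI allI impI)
    fix W :: "complex set" assume W: "openin euclidean W"
    let ?Z = "{\<tau> \<in> over T (units G). iota0 G T \<phi> \<tau> \<in> W}"
    have "openin (gtop \<Sigma>) ?Z"
    proof (subst openin_subopen, intro ballI)
      fix \<sigma> assume s: "\<sigma> \<in> ?Z"
      then have v: "openin (gtop \<Sigma>) (V \<sigma>)" "\<sigma> \<in> V \<sigma>" "V \<sigma> \<subseteq> over T (units G)"
        "continuous_map (subtopology (gtop \<Sigma>) (V \<sigma>)) euclidean (iota0 G T \<phi>)" using V by auto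
      have "openin (subtopology (gtop \<Sigma>) (V \<sigma>)) {\<tau> \<in> topspace (subtopology (gtop \<Sigma>) (V \<sigma>)). iota0 G T \<phi> \<tau> \<in> W}"
        by (rule openin_continuous_map_preimage[OF v(4) W])
      then have "openin (gtop \<Sigma>) {\<tau> \<in> topspace (subtopology (gtop \<Sigma>) (V \<sigma>)). iota0 G T \<phi> \<tau> \<in> W}"
        using v(1) openin_trans_full by blast
      moreover have "{\<tau> \<in> topspace (subtopology (gtop \<Sigma>) (V \<sigma>)). iota0 G T \<phi> \<tau> \<in> W} \<subseteq> ?Z"
        using v(3) by auto
      moreover have "\<sigma> \<in> {\<tau> \<in> topspace (subtopology (gtop \<Sigma>) (V \<sigma>)). iota0 G T \<phi> \<tau> \<in> W}"
        using s v(2) openin_subset[OF v(1)] by auto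
      ultimately show "\<exists>Y. openin (gtop \<Sigma>) Y \<and> \<sigma> \<in> Y \<and> Y \<subseteq> ?Z" by blast
    qed
    moreover have "{\<tau> \<in> topspace (subtopology (gtop \<Sigma>) (over T (units G))). iota0 G T \<phi> \<tau> \<in> W} = ?Z"
      by (auto simp: over_def arrows_def)
    ultimately show "openin (subtopology (gtop \<Sigma>) (over T (units G)))
        {\<tau> \<in> topspace (subtopology (gtop \<Sigma>) (over T (units G))). iota0 G T \<phi> \<tau> \<in> W}"
      by (auto simp: openin_open_subtopology[OF over_open[OF units_open]])
  qed auto
qed (auto simp: iota0_off)

lemma iota0_CcT:
  assumes \<phi>: "\<phi> \<in> Cc (unit_top G)"
  shows "iota0 G T \<phi> \<in> CcT G T"
proof -
  obtain K where K: "compactin (unit_top G) K" "\<forall>x\<in>units G. \<phi> x \<noteq> 0 \<longrightarrow> x \<in> K"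
    and c: "continuous_map (unit_top G) euclidean \<phi>"
    using \<phi> by (auto simp: Cc_iff[OF Hausdorff_unit_top])
  have "compactin (top_of_set circle) circle" by (simp add: compactin_subtopology compactin_euclidean_iff)
  then have "compactin (prod_topology (unit_top G) (top_of_set circle)) (K \<times> circle)"
    using K(1) by (simp add: compactin_Times)
  then have "compactin (gtop \<Sigma>) (tincl T ` (K \<times> circle))"
    by (rule image_compactin[OF _ continuous_i])
  moreover have "\<sigma> \<in> tincl T ` (K \<times> circle)" if "\<sigma> \<in> arrows \<Sigma>" "iota0 G T \<phi> \<sigma> \<noteq> 0" for \<sigma>
  proof -
    have "\<sigma> \<in> over T (units G)" using that iota0_off by blast
    then obtain x z where xz: "x \<in> units G" "z \<in> circle" "\<sigma> = tincl T (x, z)" by (auto simp: over_units)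
    then have "x \<in> K" using that K(2) iota0_tincl[OF xz(1,2), of \<phi>] by auto
    then show ?thesis using xz by auto
  qed
  moreover have "iota0 G T \<phi> \<sigma> = 0" if "\<sigma> \<notin> arrows \<Sigma>" for \<sigma>
    using that by (intro iota0_off) (auto simp: over_def)
  ultimately show ?thesis unfolding CcT_iff using iota0_continuous[OF c] iota0_contra by blast
qed

lemma iota0_CcT_unit:
  assumes \<phi>: "\<phi> \<in> Cc (unit_top G)"
  shows "iota0 G T \<phi> \<in> CcT_unit G T"
proof -
  let ?X = "subtopology (gtop \<Sigma>) (over T (units G))"
  have f: "iota0 G T \<phi> \<in> CcT G T" by (rule iota0_CcT[OF \<phi>])
  obtain K where K: "compactin (gtop \<Sigma>) K" "\<forall>\<sigma>\<in>arrows \<Sigma>. iota0 G T \<phi> \<sigma> \<noteq> 0 \<longrightarrow> \<sigma> \<in> K"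
    using f by (auto simp: CcT_iff)
  have "compactin (gtop \<Sigma>) (over T (units G) \<inter> K)"
    by (rule closed_Int_compactin[OF over_closed[OF units_closed] K(1)])
  then have "compactin ?X (over T (units G) \<inter> K)" by (simp add: compactin_subtopology)
  moreover have "\<forall>\<sigma>\<in>topspace ?X. iota0 G T \<phi> \<sigma> \<noteq> 0 \<longrightarrow> \<sigma> \<in> over T (units G) \<inter> K"
    using K(2) by (auto simp: arrows_def)
  moreover have "\<forall>\<sigma>. \<sigma> \<notin> topspace ?X \<longrightarrow> iota0 G T \<phi> \<sigma> = 0"
    using CcT_off[OF f] iota0_off by (auto simp: arrows_def)
  moreover have "continuous_map ?X euclidean (iota0 G T \<phi>)"
    using f by (simp add: CcT_iff continuous_map_from_subtopology)
  ultimately have "iota0 G T \<phi> \<in> Cc ?X"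
    using Cc_iff[OF Hausdorff_space_subtopology[OF Hausdorff_tot]] by blast
  then show ?thesis by (simp add: CcT_unit_def iota0_contra)
qed

lemma expect0_Cc:
  assumes f: "f \<in> CcT G T"
  shows "expect0 G T f \<in> Cc (unit_top G)"
proof -
  obtain K where K: "compactin (gtop \<Sigma>) K" "\<forall>\<sigma>\<in>arrows \<Sigma>. f \<sigma> \<noteq> 0 \<longrightarrow> \<sigma> \<in> K"
    and c: "continuous_map (gtop \<Sigma>) euclidean f"
    using f by (auto simp: CcT_iff)
  have "compactin (gtop G) (units G \<inter> q ` K)"
    by (rule closed_Int_compactin[OF units_closed image_compactin[OF K(1) continuous_q]])
  then have "compactin (unit_top G) (units G \<inter> q ` K)" by (simp add: compactin_unit_top)
  moreover have "x \<in> units G \<inter> q ` K" if "x \<in> units G" "expect0 G T f x \<noteq> 0" for x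
    using that K(2) by (auto simp: expect0_def intro!: rev_image_eqI[of "tincl T (x, 1)"])
  moreover have "continuous_map (unit_top G) euclidean (expect0 G T f)"
  proof (rule continuous_map_eq)
    have "continuous_map (unit_top G) (prod_topology (unit_top G) (top_of_set circle)) (\<lambda>x. (x, 1))"
      by (intro continuous_map_pairedI) auto
    from continuous_map_compose[OF continuous_map_compose[OF this continuous_i] c]
    show "continuous_map (unit_top G) euclidean (f \<circ> (tincl T \<circ> (\<lambda>x. (x, 1))))" .
  qed (simp add: expect0_def)
  ultimately show ?thesis by (auto simp: Cc_iff[OF Hausdorff_unit_top] expect0_def)
qed

end

section \<open>The regular representation as matrices\<close>

lemma finite_subsingleton: "(\<And>x y. x \<in> A \<Longrightarrow> y \<in> A \<Longrightarrow> x = y) \<Longrightarrow> finite A"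
  by (metis finite.simps finite_subset insertI1 subsetI)

context ample_twist
begin

text \<open>Other lifts would multiply the entries by unimodular factors depending on the row and on
  the column, that is, conjugate the matrix by a diagonal unitary.\<close>

definition kernel :: "('b \<Rightarrow> complex) \<Rightarrow> 'a \<Rightarrow> 'a \<Rightarrow> complex" where
  "kernel f s t = (if s \<in> arrows G \<and> t \<in> arrows G \<and> src G s = src G t
     then f (mul \<Sigma> (lift T s) (ginv \<Sigma> (lift T t))) else 0)"

definition regmat :: "('b \<Rightarrow> complex) \<Rightarrow> 'a bmat" where
  "regmat f = Bmat (kernel f)"

lemma lift_diff:
  assumes "s \<in> arrows G" "t \<in> arrows G" "src G s = src G t"
  shows "src \<Sigma> (lift T s) = src \<Sigma> (lift T t)"
    and "mul \<Sigma> (lift T s) (ginv \<Sigma> (lift T t)) \<in> arrows \<Sigma>"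
    and "q (mul \<Sigma> (lift T s) (ginv \<Sigma> (lift T t))) = mul G s (ginv G t)"
proof -
  show c: "src \<Sigma> (lift T s) = src \<Sigma> (lift T t)" using assms by (simp add: tot_src_eq)
  show "mul \<Sigma> (lift T s) (ginv \<Sigma> (lift T t)) \<in> arrows \<Sigma>" using assms c by simp
  show "q (mul \<Sigma> (lift T s) (ginv \<Sigma> (lift T t))) = mul G s (ginv G t)" using assms c by simp
qed

text \<open>The entry at \<open>s\<close>, \<open>t\<close> lives over \<open>s t^-1\<close>, whose
  range is that of \<open>s\<close> and whose source is the range of \<open>t\<close>. Within
  \<open>B\<close> this arrow is determined by either of these, and together with one index it
  determines the other.\<close>

lemma kernel_bisection:
  assumes B: "bisection G B" and off: "\<And>\<sigma>. \<sigma> \<notin> over T B \<Longrightarrow> f \<sigma> = 0"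
  shows "kernel f s t \<noteq> 0 \<Longrightarrow> kernel f s t' \<noteq> 0 \<Longrightarrow> t = t'"
    and "kernel f s t \<noteq> 0 \<Longrightarrow> kernel f s' t \<noteq> 0 \<Longrightarrow> s = s'"
proof -
  note inj = bisection_inj[OF B]
  have nz: "s \<in> arrows G" "t \<in> arrows G" "src G s = src G t" "mul G s (ginv G t) \<in> B" if "kernel f s t \<noteq> 0" for s t
  proof -
    show st: "s \<in> arrows G" "t \<in> arrows G" "src G s = src G t"
      using that by (auto simp: kernel_def split: if_splits)
    have "mul \<Sigma> (lift T s) (ginv \<Sigma> (lift T t)) \<in> over T B"
      using that off by (auto simp: kernel_def split: if_splits)
    then show "mul G s (ginv G t) \<in> B" using lift_diff(3)[OF st] by (simp add: over_def)
  qed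
  have row: "t = t'" if "kernel f s t \<noteq> 0" "kernel f s t' \<noteq> 0" for s t t'
  proof -
    note n = nz[OF that(1)] nz[OF that(2)]
    have "mul G s (ginv G t) = mul G s (ginv G t')"
      by (rule inj_onD[OF inj(1)]) (use n in auto)
    then have "ginv G t = ginv G t'"
      using mul_left_cancel[of s "ginv G t" "ginv G t'"] n by simp
    then show ?thesis using n by (metis ginv_ginv)
  qed
  have col: "s = s'" if "kernel f s t \<noteq> 0" "kernel f s' t \<noteq> 0" for s s' t
  proof -
    note n = nz[OF that(1)] nz[OF that(2)]
    have "mul G s (ginv G t) = mul G s' (ginv G t)"
      by (rule inj_onD[OF inj(2)]) (use n in auto)
    then show ?thesis
      using mul_right_cancel[of s s' "ginv G t"] n by simp
  qed
  show "kernel f s t \<noteq> 0 \<Longrightarrow> kernel f s t' \<noteq> 0 \<Longrightarrow> t = t'" by (rule row)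
  show "kernel f s t \<noteq> 0 \<Longrightarrow> kernel f s' t \<noteq> 0 \<Longrightarrow> s = s'" by (rule col)
qed

text \<open>Over a trivial piece the matrix is a weighted partial permutation; the general case is a
  finite sum of such matrices.\<close>

lemma kernel_bmat:
  assumes "f \<in> CcT G T"
  shows "finite_lines (kernel f) \<and> (\<exists>C. mat_bound (kernel f) C)"
  using assms
proof (induction rule: CcT_induct)
  case zero
  have "kernel (\<lambda>_. 0) = (\<lambda>s t. 0)" by (auto simp: fun_eq_iff kernel_def)
  then show ?case using mat_bound_zero by (auto simp: finite_lines_def)
next
  case (add f g)
  have "kernel (\<lambda>\<sigma>. f \<sigma> + g \<sigma>) = (\<lambda>s t. kernel f s t + kernel g s t)" by (auto simp: fun_eq_iff kernel_def)
  then show ?case using add mat_bound_add finite_lines_add by metis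
next
  case (trivial_piece f B S)
  have bis: "bisection G B" using trivial_piece(2) by (simp add: trivial_piece_def)
  have row: "t = t'" if "kernel f s t \<noteq> 0" "kernel f s t' \<noteq> 0" for s t t'
    by (rule kernel_bisection(1)[OF bis _ that]) (rule trivial_piece(3))
  have col: "s = s'" if "kernel f s t \<noteq> 0" "kernel f s' t \<noteq> 0" for s s' t
    by (rule kernel_bisection(2)[OF bis _ that]) (rule trivial_piece(3))
  obtain C where C: "\<And>x. norm (f x) \<le> C" "0 \<le> C" using CcT_bounded[OF trivial_piece(1)] by metis
  have "mat_bound (kernel f) C"
    by (rule mat_bound_partial_injection[OF C(2) _ row col]) (use C in \<open>auto simp: kernel_def\<close>)
  moreover have "finite {t. kernel f s t \<noteq> 0}" for s by (rule finite_subsingleton) (use row in blast)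
  moreover have "finite {s. kernel f s t \<noteq> 0}" for t by (rule finite_subsingleton) (use col in blast)
  ultimately show ?case by (auto simp: finite_lines_def)
qed

lemma entry_regmat: "f \<in> CcT G T \<Longrightarrow> entry (regmat f) = kernel f"
  unfolding regmat_def using kernel_bmat by (intro Bmat_inverse) auto

lemma regmat_add: "f \<in> CcT G T \<Longrightarrow> g \<in> CcT G T \<Longrightarrow> regmat (\<lambda>\<sigma>. f \<sigma> + g \<sigma>) = regmat f + regmat g"
  by (rule bmat_eqI) (simp add: entry_simps entry_regmat CcT_add, simp add: kernel_def)

lemma regmat_diff: "f \<in> CcT G T \<Longrightarrow> g \<in> CcT G T \<Longrightarrow> regmat (\<lambda>\<sigma>. f \<sigma> - g \<sigma>) = regmat f - regmat g"
  by (rule bmat_eqI) (simp add: entry_simps entry_regmat CcT_diff, simp add: kernel_def)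

lemma regmat_zero: "regmat (\<lambda>_. 0) = 0"
  by (rule bmat_eqI) (simp add: entry_simps entry_regmat CcT_zero, simp add: kernel_def)

lemma regmat_scale: "f \<in> CcT G T \<Longrightarrow> regmat (\<lambda>\<sigma>. complex_of_real c * f \<sigma>) = c *\<^sub>R regmat f"
  by (rule bmat_eqI) (simp add: entry_simps entry_regmat CcT_scale, simp add: kernel_def)

lemma kernel_finite:
  assumes "f \<in> CcT G T"
  shows "finite {t. kernel f s t \<noteq> 0}" "finite {s. kernel f s t \<noteq> 0}"
  using kernel_bmat[OF assms] by (auto simp: finite_lines_def)

lemma kernel_fibre:
  assumes "kernel f s t \<noteq> 0"
  shows "s \<in> arrows G" "t \<in> arrows G" "src G s = src G t"
  using assms by (auto simp: kernel_def split: if_splits)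

lemma infsum_eq_sum:
  fixes h :: "'c \<Rightarrow> complex"
  assumes "finite S" "\<And>u. u \<in> A \<Longrightarrow> u \<notin> S \<Longrightarrow> h u = 0" "\<And>u. u \<in> S \<Longrightarrow> u \<notin> A \<Longrightarrow> h' u = 0"
    and "\<And>u. u \<in> S \<Longrightarrow> u \<in> A \<Longrightarrow> h u = h' u"
  shows "infsum h A = sum h' S"
proof -
  have "infsum h A = infsum h' S" by (rule infsum_cong_neutral) (use assms in auto)
  then show ?thesis using assms(1) by simp
qed

lemma regmat_conv:
  assumes f: "f \<in> CcT G T" and g: "g \<in> CcT G T"
  shows "regmat (conv G T f g) = regmat f * regmat g"
proof (rule bmat_eqI)
  fix s t
  let ?S = "{u. kernel g u t \<noteq> 0}"
  have e: "entry (regmat f * regmat g) s t = (\<Sum>u\<in>?S. kernel f s u * kernel g u t)"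
    by (simp add: times_bmat.rep_eq mat_mult_def entry_regmat f g)
  show "entry (regmat (conv G T f g)) s t = entry (regmat f * regmat g) s t"
  proof (cases "s \<in> arrows G \<and> t \<in> arrows G \<and> src G s = src G t")
    case True
    then have st: "s \<in> arrows G" "t \<in> arrows G" "src G s = src G t" by auto
    have "kernel (conv G T f g) s t = conv G T f g (mul \<Sigma> (lift T s) (ginv \<Sigma> (lift T t)))"
      using st by (simp add: kernel_def)
    also have "\<dots> = (\<Sum>\<^sub>\<infinity>u\<in>src_fibre G (src G (q (lift T s))).
        f (mul \<Sigma> (lift T s) (ginv \<Sigma> (lift T u))) * g (mul \<Sigma> (lift T u) (ginv \<Sigma> (lift T t))))"
      by (rule conv_fibre[OF CcT_contra[OF f] CcT_contra[OF g]]) (use st lift_diff(1)[OF st] in simp_all)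
    also have "\<dots> = (\<Sum>u\<in>?S. kernel f s u * kernel g u t)"
    proof (rule infsum_eq_sum)
      show "finite ?S" by (rule kernel_finite(2)[OF g])
      fix u
      {
        assume "u \<in> src_fibre G (src G (q (lift T s)))" "u \<notin> ?S"
        then show "f (mul \<Sigma> (lift T s) (ginv \<Sigma> (lift T u))) * g (mul \<Sigma> (lift T u) (ginv \<Sigma> (lift T t))) = 0"
          using st by (simp add: kernel_def src_fibre_def)
      }
      {
        assume "u \<in> ?S" "u \<notin> src_fibre G (src G (q (lift T s)))"
        then show "kernel f s u * kernel g u t = 0"
          using st kernel_fibre(1,3)[of g u t] by (simp add: src_fibre_def)
      }
      assume "u \<in> src_fibre G (src G (q (lift T s)))"
      then show "f (mul \<Sigma> (lift T s) (ginv \<Sigma> (lift T u))) * g (mul \<Sigma> (lift T u) (ginv \<Sigma> (lift T t)))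
          = kernel f s u * kernel g u t"
        using st by (simp add: kernel_def src_fibre_def)
    qed
    finally show ?thesis using e by (simp add: entry_regmat CcT_conv f g)
  next
    case False
    then have "kernel (conv G T f g) s t = 0" by (auto simp: kernel_def)
    moreover have "(\<Sum>u\<in>?S. kernel f s u * kernel g u t) = 0"
    proof (rule sum.neutral, intro ballI, rule ccontr)
      fix u
      assume "kernel f s u * kernel g u t \<noteq> 0"
      then have "kernel f s u \<noteq> 0" "kernel g u t \<noteq> 0" by auto
      from kernel_fibre[OF this(1)] kernel_fibre[OF this(2)] show False using False by simp
    qed
    ultimately show ?thesis using e by (simp add: entry_regmat CcT_conv f g)
  qed
qed

lemma regmat_adj:
  assumes f: "f \<in> CcT G T"
  shows "regmat (adj T f) = star (regmat f)"
proof (rule bmat_eqI)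
  fix s t
  have "kernel (adj T f) s t = cnj (kernel f t s)"
    using lift_diff(1,2)[of s t] by (auto simp: kernel_def adj_def)
  then show "entry (regmat (adj T f)) s t = entry (star (regmat f)) s t"
    by (simp add: entry_regmat f CcT_adj entry_simps)
qed

text \<open>Separates diagonal from off-diagonal entries: the latter sit at arrows outside the unit
  space.\<close>

lemma mul_ginv_unit_iff:
  assumes "s \<in> arrows G" "t \<in> arrows G" "src G s = src G t"
  shows "mul G s (ginv G t) \<in> units G \<longleftrightarrow> s = t"
proof
  assume u: "mul G s (ginv G t) \<in> units G"
  have "src G (mul G s (ginv G t)) = rng G t" using assms by simp
  then have "mul G s (ginv G t) = rng G t" using units_src[OF u] by metis
  then have "mul G (mul G s (ginv G t)) t = t" using assms by simp
  then show "s = t" using assms by simp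
qed (use assms in simp)

lemma entry_iota0:
  assumes \<phi>: "\<phi> \<in> Cc (unit_top G)"
  shows "entry (regmat (iota0 G T \<phi>)) s t = (if s = t \<and> s \<in> arrows G then \<phi> (rng G s) else 0)"
proof -
  have "kernel (iota0 G T \<phi>) s t = (if s = t \<and> s \<in> arrows G then \<phi> (rng G s) else 0)"
  proof (cases "s \<in> arrows G \<and> t \<in> arrows G \<and> src G s = src G t")
    case True
    then have st: "s \<in> arrows G" "t \<in> arrows G" "src G s = src G t" by auto
    show ?thesis
    proof (cases "s = t")
      case True
      then show ?thesis using st iota0_tincl[of "rng G s" 1 \<phi>] by (simp add: kernel_def rng_tot)
    next
      case False
      then have "mul \<Sigma> (lift T s) (ginv \<Sigma> (lift T t)) \<notin> over T (units G)"
        using lift_diff(3)[OF st] mul_ginv_unit_iff[OF st] by (simp add: over_def)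
      then show ?thesis using False by (simp add: kernel_def iota0_off)
    qed
  qed (auto simp: kernel_def)
  then show ?thesis by (simp add: entry_regmat iota0_CcT[OF \<phi>])
qed

text \<open>The lift of \<open>\<gamma>\<close> adapted to the matrix: the entry in row
  \<open>\<gamma>\<close> and column \<open>src G \<gamma>\<close> is the value at
  \<open>base \<gamma>\<close>, with no phase factor left over.\<close>

definition base :: "'a \<Rightarrow> 'b" where
  "base \<gamma> = mul \<Sigma> (lift T \<gamma>) (ginv \<Sigma> (lift T (src G \<gamma>)))"

lemma base_closed: "\<gamma> \<in> arrows G \<Longrightarrow> base \<gamma> \<in> arrows \<Sigma>"
  and q_base: "\<gamma> \<in> arrows G \<Longrightarrow> q (base \<gamma>) = \<gamma>"
proof -
  assume g: "\<gamma> \<in> arrows G"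
  show "base \<gamma> \<in> arrows \<Sigma>" unfolding base_def by (rule lift_diff(2)) (use g in auto)
  have "ginv G (src G \<gamma>) = src G \<gamma>" by (rule ginv_unit) (use g in simp)
  then show "q (base \<gamma>) = \<gamma>" unfolding base_def using g lift_diff(3)[of \<gamma> "src G \<gamma>"] by simp
qed

lemma entry_base: "f \<in> CcT G T \<Longrightarrow> \<gamma> \<in> arrows G \<Longrightarrow> entry (regmat f) \<gamma> (src G \<gamma>) = f (base \<gamma>)"
  by (simp add: entry_regmat kernel_def base_def)

lemma norm_value:
  assumes f: "f \<in> CcT G T" and s: "\<sigma> \<in> arrows \<Sigma>"
  shows "norm (f \<sigma>) = norm (entry (regmat f) (q \<sigma>) (src G (q \<sigma>)))"
  using contra_norm[OF CcT_contra[OF f] s base_closed[of "q \<sigma>"]] s by (simp add: entry_base[OF f] q_base)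

lemma norm_kernel:
  assumes f: "f \<in> CcT G T" and st: "s \<in> arrows G" "t \<in> arrows G" "src G s = src G t"
  shows "norm (entry (regmat f) s t) = norm (f (base (mul G s (ginv G t))))"
  unfolding entry_regmat[OF f] using st lift_diff[OF st]
  by (simp add: kernel_def) (rule contra_norm[OF CcT_contra[OF f]], auto simp: base_closed q_base)

text \<open>Up to a phase every value is an entry. Together with \<open>red_norm_eq\<close> this
  says that \<open>j\<close> decreases norms on \<open>CcT\<close>.\<close>

lemma norm_value_le: "f \<in> CcT G T \<Longrightarrow> norm (f \<sigma>) \<le> norm (regmat f)"
  using norm_value[of f \<sigma>] CcT_off[of f \<sigma>] norm_entry_le[of "regmat f"] by (cases "\<sigma> \<in> arrows \<Sigma>") auto

lemma regmat_inj:
  assumes f: "f \<in> CcT G T" and g: "g \<in> CcT G T" and eq: "regmat f = regmat g"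
  shows "f = g"
proof
  fix \<sigma>
  have "norm (f \<sigma> - g \<sigma>) \<le> norm (regmat (\<lambda>\<sigma>. f \<sigma> - g \<sigma>))"
    using norm_value_le[OF CcT_diff[OF f g], of \<sigma>] .
  also have "\<dots> = 0" by (simp add: regmat_diff f g eq)
  finally show "f \<sigma> = g \<sigma>" by simp
qed

lemma entry_unit:
  assumes "f \<in> CcT G T" "x \<in> units G"
  shows "entry (regmat f) x x = expect0 G T f x"
  using assms units_arrows[OF assms(2)] by (simp add: entry_regmat kernel_def expect0_def rng_tot)

subsection \<open>The reduced norm\<close>

lemma act_free:
  assumes "\<sigma> \<in> arrows \<Sigma>" "z \<in> circle" "w \<in> circle" "act z \<sigma> = act w \<sigma>"
  shows "z = w"
proof -
  let ?x = "rng G (q \<sigma>)"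
  have x: "?x \<in> units G" using assms by simp
  have "tincl T (?x, z) = tincl T (?x, w)"
    by (rule Tot.mul_right_cancel[of _ _ \<sigma>])
       (use assms x in \<open>auto simp: act_eq i_src rng_tot\<close>)
  then show ?thesis using inj_onD[OF tincl_inj, of "(?x, z)" "(?x, w)"] x assms(2,3) by simp
qed

text \<open>The circle acts freely and transitively on each fibre of \<open>q\<close>, so a
  contravariant function may be prescribed at one lift per arrow. This turns vectors indexed by
  arrows into elements of \<open>L2\<close>.\<close>

lemma contra_extension:
  assumes F: "F \<subseteq> arrows G"
  obtains g where "contra g" "\<And>t. t \<in> F \<Longrightarrow> g (lift T t) = h t" "\<And>\<sigma>. \<sigma> \<notin> over T F \<Longrightarrow> g \<sigma> = 0"
proof -
  define g where "g \<sigma> = (if \<sigma> \<in> over T F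
    then cnj (THE z. z \<in> circle \<and> \<sigma> = act z (lift T (q \<sigma>))) * h (q \<sigma>) else 0)" for \<sigma>
  have val: "g (act z (lift T t)) = cnj z * h t" if "t \<in> F" "z \<in> circle" for t z
  proof -
    have t: "lift T t \<in> arrows \<Sigma>" "q (lift T t) = t" using that F by auto
    have "(THE w. w \<in> circle \<and> act z (lift T t) = act w (lift T t)) = z"
      using that(2) act_free[OF t(1)] by (intro the_equality) blast+
    then show ?thesis
      using that(1) act_closed[OF t(1) that(2)] act_q[OF t(1) that(2)] t(2)
      unfolding g_def over_def by simp
  qed
  have "contra g" unfolding contravariant_def
  proof (intro ballI)
    fix \<sigma> z assume s: "\<sigma> \<in> arrows \<Sigma>" and z: "z \<in> circle"
    show "g (act z \<sigma>) = cnj z * g \<sigma>"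
    proof (cases "q \<sigma> \<in> F")
      case True
      then have t: "lift T (q \<sigma>) \<in> arrows \<Sigma>" using F by auto
      obtain w where w: "w \<in> circle" "\<sigma> = act w (lift T (q \<sigma>))"
        using act_transitive[OF t s q_lift] True F by blast
      have "act z \<sigma> = act (z * w) (lift T (q \<sigma>))" using w act_act[OF t z w(1)] by simp
      then have "g (act z \<sigma>) = cnj (z * w) * h (q \<sigma>)" using val[OF True circle_mult[OF z w(1)]] by simp
      moreover have "g \<sigma> = cnj w * h (q \<sigma>)" using val[OF True w(1)] w(2) by simp
      ultimately show ?thesis by simp
    next
      case False
      then show ?thesis using act_q[OF s z] by (simp add: g_def over_def)
    qed
  qed
  moreover have "g (lift T t) = h t" if "t \<in> F" for t
    using val[OF that circle_1] that F by auto
  moreover have "g \<sigma> = 0" if "\<sigma> \<notin> over T F" for \<sigma> using that by (simp add: g_def)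
  ultimately show ?thesis using that by blast
qed

lemma conv_lift:
  assumes f: "f \<in> CcT G T" and g: "contra g" and s: "s \<in> arrows G"
    and S: "finite S" "{t. kernel f s t \<noteq> 0} \<subseteq> S"
  shows "conv G T f g (lift T s) = (\<Sum>t\<in>S. kernel f s t * g (lift T t))"
proof -
  let ?\<tau> = "src \<Sigma> (lift T s)"
  have \<tau>: "?\<tau> \<in> units \<Sigma>" "?\<tau> \<in> arrows \<Sigma>" using s by auto
  \<comment> \<open>Appending the inverse of a unit brings \<open>lift T s\<close> into the form
    that \<open>conv_fibre\<close> expects.\<close>
  have "conv G T f g (lift T s) = conv G T f g (mul \<Sigma> (lift T s) (ginv \<Sigma> ?\<tau>))"
    using s \<tau> Tot.ginv_unit[OF \<tau>(1)] by simp
  also have "\<dots> = (\<Sum>\<^sub>\<infinity>u\<in>src_fibre G (src G (q (lift T s))).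
        f (mul \<Sigma> (lift T s) (ginv \<Sigma> (lift T u))) * g (mul \<Sigma> (lift T u) (ginv \<Sigma> ?\<tau>)))"
    by (rule conv_fibre[OF CcT_contra[OF f] g]) (use s in auto)
  also have "\<dots> = (\<Sum>t\<in>S. kernel f s t * g (lift T t))"
  proof (rule infsum_eq_sum[OF S(1)])
    have u: "u \<in> arrows G" "src G u = src G s" "mul \<Sigma> (lift T u) (ginv \<Sigma> ?\<tau>) = lift T u"
      if "u \<in> src_fibre G (src G (q (lift T s)))" for u
    proof -
      show u: "u \<in> arrows G" "src G u = src G s" using that s by (auto simp: src_fibre_def)
      have "?\<tau> = src \<Sigma> (lift T u)" using lift_diff(1)[OF s u(1)] u(2) by simp
      then show "mul \<Sigma> (lift T u) (ginv \<Sigma> ?\<tau>) = lift T u"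
        using Tot.ginv_unit[OF \<tau>(1)] u(1) by simp
    qed
    fix u
    {
      assume "u \<in> src_fibre G (src G (q (lift T s)))" "u \<notin> S"
      moreover from this have "kernel f s u = 0" using S(2) by blast
      ultimately show "f (mul \<Sigma> (lift T s) (ginv \<Sigma> (lift T u))) * g (mul \<Sigma> (lift T u) (ginv \<Sigma> ?\<tau>)) = 0"
        using u[of u] s by (simp add: kernel_def)
    }
    {
      assume "u \<in> S" "u \<notin> src_fibre G (src G (q (lift T s)))"
      then have "kernel f s u = 0" using s kernel_fibre[of f s u] by (cases "kernel f s u = 0") (auto simp: src_fibre_def)
      then show "kernel f s u * g (lift T u) = 0" by simp
    }
    assume "u \<in> src_fibre G (src G (q (lift T s)))"
    then show "f (mul \<Sigma> (lift T s) (ginv \<Sigma> (lift T u))) * g (mul \<Sigma> (lift T u) (ginv \<Sigma> ?\<tau>)) = kernel f s u * g (lift T u)"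
      using u[of u] s by (simp add: kernel_def)
  qed
  finally show ?thesis .
qed

lemma L2_norm_conv_le:
  assumes f: "f \<in> CcT G T" and g: "g \<in> L2 G T x" "L2_norm G T x g \<le> 1"
  shows "L2_norm G T x (conv G T f g) \<le> norm (regmat f)"
proof -
  let ?u = "\<lambda>\<gamma>. (norm (conv G T f g (lift T \<gamma>)))\<^sup>2" and ?v = "\<lambda>\<gamma>. (norm (g (lift T \<gamma>)))\<^sup>2"
  have gc: "contra g" and gs: "?v summable_on src_fibre G x" using g by (auto simp: L2_def)
  have v1: "infsum ?v (src_fibre G x) \<le> 1" using g(2) by (simp add: L2_norm_def)
  have fin: "sum ?u F \<le> (norm (regmat f))\<^sup>2" if F: "finite F" "F \<subseteq> src_fibre G x" for F
  proof -
    \<comment> \<open>Only these columns meet the rows in \<open>F\<close>, so one finite block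
      computes the image vector on all of \<open>F\<close>.\<close>
    define S where "S = (\<Union>s\<in>F. {t. kernel f s t \<noteq> 0})"
    have S: "finite S" using F kernel_finite[OF f] by (auto simp: S_def)
    have SF: "S \<subseteq> src_fibre G x"
    proof
      fix t assume "t \<in> S"
      then obtain s where "s \<in> F" "kernel f s t \<noteq> 0" by (auto simp: S_def)
      then show "t \<in> src_fibre G x" using kernel_fibre[of f s t] F(2) by (auto simp: src_fibre_def)
    qed
    have "sum ?v S \<le> infsum ?v (src_fibre G x)" by (rule finite_sum_le_infsum[OF gs S SF]) simp
    then have l1: "L2_set (\<lambda>t. norm (g (lift T t))) S \<le> 1" using v1 by (simp add: L2_set_def)
    have "sum ?u F = (L2_set (\<lambda>s. norm (conv G T f g (lift T s))) F)\<^sup>2" by (simp add: L2_set_def sum_nonneg)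
    also have "L2_set (\<lambda>s. norm (conv G T f g (lift T s))) F =
        L2_set (\<lambda>s. norm (\<Sum>t\<in>S. entry (regmat f) s t * g (lift T t))) F"
    proof (rule L2_set_cong[OF refl])
      fix s assume s: "s \<in> F"
      then have "s \<in> arrows G" using F(2) by (auto simp: src_fibre_def)
      moreover have "{t. kernel f s t \<noteq> 0} \<subseteq> S" using s by (auto simp: S_def)
      ultimately show "norm (conv G T f g (lift T s)) = norm (\<Sum>t\<in>S. entry (regmat f) s t * g (lift T t))"
        by (simp add: conv_lift[OF f gc _ S] entry_regmat[OF f])
    qed
    also have "(\<dots>)\<^sup>2 \<le> (norm (regmat f) * L2_set (\<lambda>t. norm (g (lift T t))) S)\<^sup>2"
      by (intro power_mono mat_boundD[OF norm_bmat_bound] F S) simp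
    also have "\<dots> \<le> (norm (regmat f) * 1)\<^sup>2" by (intro power_mono mult_left_mono l1) auto
    finally show ?thesis by simp
  qed
  have "infsum ?u (src_fibre G x) \<le> (norm (regmat f))\<^sup>2"
  \<comment> \<open>For a family that is not summable \<open>infsum\<close> is 0, and the bound is
    trivial.\<close>
  proof (cases "?u summable_on src_fibre G x")
    case True
    then show ?thesis using infsum_le_finite_sums fin by blast
  qed (simp add: infsum_not_exists)
  then show ?thesis unfolding L2_norm_def by (simp add: real_le_lsqrt infsum_nonneg)
qed

lemma rep_norm_le: "f \<in> CcT G T \<Longrightarrow> rep_norm G T x f \<le> ennreal (norm (regmat f))"
  unfolding rep_norm_def by (intro SUP_least ennreal_leI) (auto intro: L2_norm_conv_le)

text \<open>Tests the representation at a finitely supported vector: \<open>h\<close> divided by its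
  length extends to a unit vector of \<open>L2\<close>, and the block on \<open>F\<close> sees a
  part of its image. A vector of length 0 has to be treated apart.\<close>

lemma rep_norm_fibre:
  assumes f: "f \<in> CcT G T" and F: "finite F" "F \<subseteq> src_fibre G x" and F': "finite F'" "F' \<subseteq> src_fibre G x"
    and r: "rep_norm G T x f \<le> ennreal r" "0 \<le> r"
  shows "L2_set (\<lambda>s. norm (\<Sum>t\<in>F'. kernel f s t * h t)) F \<le> r * L2_set (\<lambda>t. norm (h t)) F'"
proof (cases "L2_set (\<lambda>t. norm (h t)) F' = 0")
  case True
  then have "\<forall>t\<in>F'. h t = 0" using F'(1) by (simp add: L2_set_eq_0_iff)
  then have "(\<lambda>s. norm (\<Sum>t\<in>F'. kernel f s t * h t)) = (\<lambda>s. 0)" by auto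
  then show ?thesis using True by (simp add: L2_set_def)
next
  case False
  let ?c = "L2_set (\<lambda>t. norm (h t)) F'"
  have c: "?c > 0" using False by (metis L2_set_nonneg less_eq_real_def)
  have F'a: "F' \<subseteq> arrows G" using F'(2) by (auto simp: src_fibre_def)
  obtain g where g: "contra g" "\<And>t. t \<in> F' \<Longrightarrow> g (lift T t) = h t / ?c" "\<And>\<sigma>. \<sigma> \<notin> over T F' \<Longrightarrow> g \<sigma> = 0"
    using contra_extension[OF F'a, of "\<lambda>t. h t / complex_of_real ?c"] by metis
  have g0: "g (lift T t) = 0" if "t \<in> arrows G" "t \<notin> F'" for t
    using g(3)[of "lift T t"] that by (simp add: over_def)
  let ?v = "\<lambda>\<gamma>. (norm (g (lift T \<gamma>)))\<^sup>2" and ?u = "\<lambda>\<gamma>. (norm (conv G T f g (lift T \<gamma>)))\<^sup>2"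
  have "{\<gamma> \<in> src_fibre G x. ?v \<gamma> \<noteq> 0} \<subseteq> F'" using g0 by (auto simp: src_fibre_def)
  then have "?v summable_on src_fibre G x"
    using F'(1) finite_subset by (intro finite_nonzero_values_imp_summable_on) blast
  then have gL: "g \<in> L2 G T x" unfolding L2_def using g F'(2) by (auto simp: over_def)
  have "infsum ?v (src_fibre G x) = infsum ?v F'"
    by (rule infsum_cong_neutral) (use g0 F'(2) in \<open>auto simp: src_fibre_def\<close>)
  also have "\<dots> = (\<Sum>t\<in>F'. (norm (h t))\<^sup>2) / ?c\<^sup>2"
    using F'(1) by (simp add: g(2) norm_divide power_divide sum_divide_distrib)
  also have "\<dots> = 1"
  proof -
    have "(\<Sum>t\<in>F'. (norm (h t))\<^sup>2) = ?c\<^sup>2" by (simp add: L2_set_def sum_nonneg)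
    then show ?thesis using c by simp
  qed
  finally have g1: "L2_norm G T x g \<le> 1" by (simp add: L2_norm_def)
  have cl: "conv G T f g (lift T s) = (\<Sum>t\<in>F'. kernel f s t * h t) / ?c" if s: "s \<in> src_fibre G x" for s
  proof -
    have sa: "s \<in> arrows G" using s by (simp add: src_fibre_def)
    let ?S = "F' \<union> {t. kernel f s t \<noteq> 0}"
    have S: "finite ?S" using F'(1) kernel_finite[OF f] by simp
    have "conv G T f g (lift T s) = (\<Sum>t\<in>?S. kernel f s t * g (lift T t))"
      by (rule conv_lift[OF f g(1) sa S]) auto
    also have "\<dots> = (\<Sum>t\<in>F'. kernel f s t * g (lift T t))"
      using S kernel_fibre[of f s] g0 by (intro sum.mono_neutral_right) auto
    also have "\<dots> = (\<Sum>t\<in>F'. kernel f s t * h t) / ?c"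
      by (simp add: g(2) sum_divide_distrib)
    finally show ?thesis .
  qed
  have "{s \<in> src_fibre G x. ?u s \<noteq> 0} \<subseteq> (\<Union>t\<in>F'. {s. kernel f s t \<noteq> 0})"
  proof
    fix s assume "s \<in> {s \<in> src_fibre G x. ?u s \<noteq> 0}"
    then have "(\<Sum>t\<in>F'. kernel f s t * h t) \<noteq> 0" using cl by auto
    then obtain t where "t \<in> F'" "kernel f s t * h t \<noteq> 0" by (rule sum.not_neutral_contains_not_neutral)
    then show "s \<in> (\<Union>t\<in>F'. {s. kernel f s t \<noteq> 0})" by auto
  qed
  then have us: "?u summable_on src_fibre G x"
    using F'(1) kernel_finite[OF f] by (intro finite_nonzero_values_imp_summable_on) (meson finite_UN_I finite_subset)
  have "L2_set (\<lambda>s. norm (\<Sum>t\<in>F'. kernel f s t * h t)) F / ?c = L2_set (\<lambda>s. norm (\<Sum>t\<in>F'. kernel f s t * h t) * (1 / ?c)) F"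
    using c by (simp add: divide_inverse L2_set_left_distrib)
  also have "\<dots> = L2_set (\<lambda>s. norm (conv G T f g (lift T s))) F"
    using F(2) c by (intro L2_set_cong refl) (auto simp: cl norm_divide)
  also have "\<dots> = sqrt (sum ?u F)" by (simp add: L2_set_def)
  also have "\<dots> \<le> L2_norm G T x (conv G T f g)"
    unfolding L2_norm_def by (intro real_sqrt_le_mono finite_sum_le_infsum us F) simp
  also have "\<dots> \<le> r"
  proof -
    have "ennreal (L2_norm G T x (conv G T f g)) \<le> rep_norm G T x f"
      unfolding rep_norm_def by (rule SUP_upper) (use gL g1 in simp)
    then show ?thesis using r by (meson ennreal_le_iff order_trans)
  qed
  finally show ?thesis using c by (simp add: divide_le_eq)
qed

text \<open>The matrix of \<open>f\<close> is block diagonal, with one block for each source fibre.\<close>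

lemma red_norm_eq:
  assumes f: "f \<in> CcT G T"
  shows "red_norm G T f = norm (regmat f)"
proof -
  let ?S = "SUP x \<in> units G. rep_norm G T x f"
  have le: "(SUP x \<in> units G. rep_norm G T x f) \<le> ennreal (norm (regmat f))" using rep_norm_le[OF f] by (intro SUP_least) auto
  \<comment> \<open>The supremum is finite, so \<open>enn2real\<close> does not lose it.\<close>
  then have fin: "?S < top" by (simp add: order_le_less_trans[OF _ ennreal_less_top])
  let ?r = "red_norm G T f"
  have r: "?S = ennreal ?r" unfolding red_norm_def using fin by simp
  have r0: "0 \<le> ?r" by (simp add: red_norm_def)
  have "mat_bound (kernel f) ?r"
  proof (rule mat_boundI[OF r0])
    fix F F' :: "'a set" and h :: "'a \<Rightarrow> complex" assume F: "finite F" "finite F'"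
    define X where "X = src G ` ((F \<union> F') \<inter> arrows G)"
    have X: "finite X" "X \<subseteq> units G" using F by (auto simp: X_def)
    define u where "u s = (norm (\<Sum>t\<in>F'. kernel f s t * h t))\<^sup>2" for s
    have u0: "u s = 0" if "s \<notin> arrows G" for s
      using that by (simp add: u_def kernel_def)
    \<comment> \<open>Rows with source \<open>x\<close> see only columns with source
      \<open>x\<close>, so the vector splits orthogonally along \<open>X\<close> and each part is
      estimated in its own representation.\<close>
    have fib: "(\<Sum>s\<in>{s \<in> F \<inter> arrows G. src G s = x}. u s) \<le> ?r\<^sup>2 * (\<Sum>t\<in>{t \<in> F' \<inter> arrows G. src G t = x}. (norm (h t))\<^sup>2)"
      if x: "x \<in> X" for x
    proof -
      let ?F = "{s \<in> F \<inter> arrows G. src G s = x}" and ?F' = "{t \<in> F' \<inter> arrows G. src G t = x}"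
      have "(\<Sum>s\<in>?F. u s) = (L2_set (\<lambda>s. norm (\<Sum>t\<in>?F'. kernel f s t * h t)) ?F)\<^sup>2"
      proof -
        have "(\<Sum>t\<in>F'. kernel f s t * h t) = (\<Sum>t\<in>?F'. kernel f s t * h t)" if "s \<in> ?F" for s
          using that F kernel_fibre[of f s] by (intro sum.mono_neutral_right) auto
        then show ?thesis by (simp add: L2_set_def sum_nonneg u_def)
      qed
      also have "\<dots> \<le> (?r * L2_set (\<lambda>t. norm (h t)) ?F')\<^sup>2"
      proof (intro power_mono rep_norm_fibre[OF f, where x = x] r0)
        show "rep_norm G T x f \<le> ennreal ?r" unfolding r[symmetric] using x X(2) by (intro SUP_upper) auto
      qed (use F in \<open>auto simp: src_fibre_def\<close>)
      also have "\<dots> = ?r\<^sup>2 * (\<Sum>t\<in>?F'. (norm (h t))\<^sup>2)"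
        by (simp add: L2_set_def sum_nonneg power_mult_distrib)
      finally show ?thesis .
    qed
    have "(L2_set (\<lambda>s. norm (\<Sum>t\<in>F'. kernel f s t * h t)) F)\<^sup>2 = (\<Sum>s\<in>F. u s)"
      by (simp add: L2_set_def sum_nonneg u_def)
    also have "\<dots> = (\<Sum>s\<in>F \<inter> arrows G. u s)"
      using F u0 by (intro sum.mono_neutral_right) auto
    also have "\<dots> = (\<Sum>x\<in>X. \<Sum>s\<in>{s \<in> F \<inter> arrows G. src G s = x}. u s)"
      using F X(1) by (intro sum.group[symmetric]) (auto simp: X_def)
    also have "\<dots> \<le> (\<Sum>x\<in>X. ?r\<^sup>2 * (\<Sum>t\<in>{t \<in> F' \<inter> arrows G. src G t = x}. (norm (h t))\<^sup>2))"
      by (rule sum_mono[OF fib])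
    also have "\<dots> = ?r\<^sup>2 * (\<Sum>x\<in>X. \<Sum>t\<in>{t \<in> F' \<inter> arrows G. src G t = x}. (norm (h t))\<^sup>2)"
      by (simp add: sum_distrib_left)
    also have "(\<Sum>x\<in>X. \<Sum>t\<in>{t \<in> F' \<inter> arrows G. src G t = x}. (norm (h t))\<^sup>2) = (\<Sum>t\<in>F' \<inter> arrows G. (norm (h t))\<^sup>2)"
      using F X(1) by (intro sum.group) (auto simp: X_def)
    also have "?r\<^sup>2 * \<dots> \<le> ?r\<^sup>2 * (\<Sum>t\<in>F'. (norm (h t))\<^sup>2)"
      using F by (intro mult_left_mono sum_mono2) auto
    also have "\<dots> = (?r * L2_set (\<lambda>t. norm (h t)) F')\<^sup>2"
      by (simp add: L2_set_def sum_nonneg power_mult_distrib)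
    finally show "L2_set (\<lambda>s. norm (\<Sum>t\<in>F'. kernel f s t * h t)) F \<le> ?r * L2_set (\<lambda>t. norm (h t)) F'"
      by (rule power2_le_imp_le) (use r0 in simp)
  qed
  then have "norm (regmat f) \<le> ?r" by (intro norm_bmat_le) (simp add: entry_regmat[OF f])
  moreover have "?r \<le> norm (regmat f)" using le unfolding r by (simp add: ennreal_le_iff)
  ultimately show ?thesis by simp
qed

lemma red_dist_eq: "f \<in> CcT G T \<Longrightarrow> g \<in> CcT G T \<Longrightarrow> red_dist G T f g = norm (regmat f - regmat g)"
  by (simp add: red_dist_def red_norm_eq CcT_diff regmat_diff)

text \<open>\<open>Metric_space\<close> demands symmetry of the distance on the whole type, where no
  matrices are available; it is therefore checked on the definition of the norm.\<close>

lemma red_norm_uminus: "red_norm G T (\<lambda>\<sigma>. - f \<sigma>) = red_norm G T f"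
proof -
  have "conv G T (\<lambda>\<sigma>. - f \<sigma>) g = (\<lambda>\<sigma>. - conv G T f g \<sigma>)" for g
    by (auto simp: conv_def fun_eq_iff infsum_uminus)
  then show ?thesis by (simp add: red_norm_def rep_norm_def L2_norm_def)
qed

lemma red_metric: "Metric_space (CcT G T) (red_dist G T)"
proof
  fix f g h
  show "0 \<le> red_dist G T f g" by (simp add: red_dist_def red_norm_def)
  show "red_dist G T f g = red_dist G T g f"
    using red_norm_uminus[of "\<lambda>\<sigma>. f \<sigma> - g \<sigma>"] by (simp add: red_dist_def)
  assume fg: "f \<in> CcT G T" "g \<in> CcT G T"
  show "red_dist G T f g = 0 \<longleftrightarrow> f = g" using fg regmat_inj by (auto simp: red_dist_eq)
  assume "h \<in> CcT G T"
  then show "red_dist G T f h \<le> red_dist G T f g + red_dist G T g h"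
    using fg norm_triangle_ineq[of "regmat f - regmat g" "regmat g - regmat h"] by (simp add: red_dist_eq)
qed

lemma red_Cauchy_iff: "red_Cauchy G T f \<longleftrightarrow> (\<forall>k. f k \<in> CcT G T) \<and> Cauchy (\<lambda>k. regmat (f k))"
proof -
  have "(\<forall>k. f k \<in> CcT G T) \<Longrightarrow> (\<forall>\<epsilon>>0. \<exists>N. \<forall>n n'. N \<le> n \<longrightarrow> N \<le> n' \<longrightarrow> red_dist G T (f n) (f n') < \<epsilon>)
     \<longleftrightarrow> Cauchy (\<lambda>k. regmat (f k))"
    by (auto simp: Cauchy_def red_dist_eq dist_norm)
  then show ?thesis unfolding red_Cauchy_def Metric_space.MCauchy_def[OF red_metric] by blast
qed

end

section \<open>Computing in the reduced algebra\<close>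

text \<open>A Cauchy sequence in \<open>bmat\<close> need not have a limit there, hence this
  arithmetic of Cauchy sequences as such, in place of the usual limit rules.\<close>

lemma Cauchy_add_seq:
  fixes X Y :: "nat \<Rightarrow> 'c::real_normed_vector"
  assumes "Cauchy X" "Cauchy Y"
  shows "Cauchy (\<lambda>k. X k + Y k)"
proof (rule CauchyI)
  fix e :: real assume e: "0 < e"
  obtain M where M: "\<forall>m\<ge>M. \<forall>n\<ge>M. norm (X m - X n) < e/2"
    using CauchyD[OF assms(1), of "e/2"] e by auto
  obtain N where N: "\<forall>m\<ge>N. \<forall>n\<ge>N. norm (Y m - Y n) < e/2"
    using CauchyD[OF assms(2), of "e/2"] e by auto
  have "norm (X m + Y m - (X n + Y n)) < e" if "m \<ge> max M N" "n \<ge> max M N" for m n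
  proof -
    have "norm (X m + Y m - (X n + Y n)) \<le> norm (X m - X n) + norm (Y m - Y n)"
      using norm_triangle_ineq[of "X m - X n" "Y m - Y n"] by (simp add: algebra_simps)
    also have "\<dots> < e/2 + e/2" using M N that by (intro add_strict_mono) auto
    finally show ?thesis by simp
  qed
  then show "\<exists>M. \<forall>m\<ge>M. \<forall>n\<ge>M. norm (X m + Y m - (X n + Y n)) < e" by blast
qed

lemma Cauchy_uminus_seq:
  fixes X :: "nat \<Rightarrow> 'c::real_normed_vector"
  assumes "Cauchy X"
  shows "Cauchy (\<lambda>k. - X k)"
  using assms by (simp add: Cauchy_iff norm_minus_commute)

lemma Cauchy_diff_seq:
  fixes X Y :: "nat \<Rightarrow> 'c::real_normed_vector"
  assumes "Cauchy X" "Cauchy Y"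
  shows "Cauchy (\<lambda>k. X k - Y k)"
  using Cauchy_add_seq[OF assms(1) Cauchy_uminus_seq[OF assms(2)]] by simp

lemma tendsto_zero_Cauchy: "X \<longlonglongrightarrow> (0 :: 'c::real_normed_vector) \<Longrightarrow> Cauchy X"
  by (rule LIMSEQ_imp_Cauchy)


lemma Cauchy_mult_seq:
  fixes X Y :: "nat \<Rightarrow> 'c::real_normed_algebra"
  assumes "Cauchy X" "Cauchy Y"
  shows "Cauchy (\<lambda>k. X k * Y k)"
proof (rule CauchyI)
  fix e :: real assume e: "0 < e"
  obtain A where A: "A > 0" "\<And>k. norm (X k) \<le> A" using Cauchy_Bseq[OF assms(1)] by (metis BseqE)
  obtain B where B: "B > 0" "\<And>k. norm (Y k) \<le> B" using Cauchy_Bseq[OF assms(2)] by (metis BseqE)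
  obtain M where M: "\<forall>m\<ge>M. \<forall>n\<ge>M. norm (X m - X n) < e/(2*B)"
    using CauchyD[OF assms(1), of "e/(2*B)"] e B by auto
  obtain N where N: "\<forall>m\<ge>N. \<forall>n\<ge>N. norm (Y m - Y n) < e/(2*A)"
    using CauchyD[OF assms(2), of "e/(2*A)"] e A by auto
  have "norm (X m * Y m - X n * Y n) < e" if "m \<ge> max M N" "n \<ge> max M N" for m n
  proof -
    have "norm (X m * Y m - X n * Y n) = norm (X m * (Y m - Y n) + (X m - X n) * Y n)"
      by (simp add: algebra_simps)
    also have "\<dots> \<le> norm (X m) * norm (Y m - Y n) + norm (X m - X n) * norm (Y n)"
      by (intro order_trans[OF norm_triangle_ineq] add_mono norm_mult_ineq)
    also have "\<dots> \<le> A * norm (Y m - Y n) + norm (X m - X n) * B"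
      by (intro add_mono mult_right_mono mult_left_mono A B) auto
    also have "\<dots> < A * (e/(2*A)) + (e/(2*B)) * B"
      using M N that A B by (intro add_strict_mono mult_strict_left_mono mult_strict_right_mono) auto
    also have "\<dots> = e" using A B by simp
    finally show ?thesis .
  qed
  then show "\<exists>M. \<forall>m\<ge>M. \<forall>n\<ge>M. norm (X m * Y m - X n * Y n) < e" by blast
qed

lemma Cauchy_mult_null:
  fixes X Y :: "nat \<Rightarrow> 'c::real_normed_algebra"
  assumes "Cauchy X" "Y \<longlonglongrightarrow> 0"
  shows "(\<lambda>k. X k * Y k) \<longlonglongrightarrow> 0" "(\<lambda>k. Y k * X k) \<longlonglongrightarrow> 0"
proof -
  have X: "Bfun X sequentially" using Cauchy_Bseq[OF assms(1)] .
  have Y: "Zfun Y sequentially" using assms(2) by (simp add: tendsto_Zfun_iff)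
  show "(\<lambda>k. X k * Y k) \<longlonglongrightarrow> 0"
    using bounded_bilinear.Bfun_prod_Zfun[OF bounded_bilinear_mult X Y] by (simp add: tendsto_Zfun_iff)
  show "(\<lambda>k. Y k * X k) \<longlonglongrightarrow> 0"
    using bounded_bilinear.Zfun_prod_Bfun[OF bounded_bilinear_mult Y X] by (simp add: tendsto_Zfun_iff)
qed

lemma Cauchy_norm_seq:
  fixes X :: "nat \<Rightarrow> 'c::real_normed_vector"
  assumes "Cauchy X"
  shows "Cauchy (\<lambda>k. norm (X k))"
proof (rule CauchyI)
  fix e :: real assume "0 < e"
  then obtain M where M: "\<forall>m\<ge>M. \<forall>n\<ge>M. norm (X m - X n) < e"
    using CauchyD[OF assms] by blast
  have "norm (norm (X m) - norm (X n)) < e" if "m \<ge> M" "n \<ge> M" for m n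
    using M that norm_triangle_ineq3[of "X m" "X n"] by (metis order_le_less_trans real_norm_def)
  then show "\<exists>M. \<forall>m\<ge>M. \<forall>n\<ge>M. norm (norm (X m) - norm (X n)) < e" by blast
qed

lemma Cauchy_star: "Cauchy X \<Longrightarrow> Cauchy (\<lambda>k. star (X k))"
  by (simp add: Cauchy_iff flip: star_diff)

lemma Cauchy_const: "Cauchy (\<lambda>k. c :: 'c::real_normed_vector)"
  by (simp add: Cauchy_iff)

lemma Cauchy_entry: "Cauchy X \<Longrightarrow> Cauchy (\<lambda>k. entry (X k) s t)"
  unfolding Cauchy_iff by (metis norm_entry_le minus_bmat.rep_eq order_le_less_trans)

lemma tendsto_entry: "X \<longlonglongrightarrow> A \<Longrightarrow> (\<lambda>k. entry (X k) s t) \<longlonglongrightarrow> entry A s t"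
proof -
  assume "X \<longlonglongrightarrow> A"
  then have "(\<lambda>k. norm (X k - A)) \<longlonglongrightarrow> 0" by (simp add: LIM_zero tendsto_norm_zero)
  then have "(\<lambda>k. entry (X k) s t - entry A s t) \<longlonglongrightarrow> 0"
    by (rule Lim_null_comparison[rotated]) (intro always_eventually allI, metis norm_entry_le minus_bmat.rep_eq)
  then show ?thesis by (simp add: LIM_zero_iff)
qed

context ample_twist
begin

lemma red_CauchyD:
  assumes "red_Cauchy G T f"
  shows "f k \<in> CcT G T" "Cauchy (\<lambda>k. regmat (f k))"
  using assms by (auto simp: red_Cauchy_iff)

lemma cls_iff:
  assumes "\<And>k. f k \<in> CcT G T"
  shows "h \<in> cls G T f \<longleftrightarrow> red_Cauchy G T h \<and> (\<lambda>k. regmat (h k) - regmat (f k)) \<longlonglongrightarrow> 0"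
proof -
  have "red_Cauchy G T h \<Longrightarrow> (\<lambda>k. red_dist G T (h k) (f k)) = (\<lambda>k. norm (regmat (h k) - regmat (f k)))"
    using assms red_CauchyD by (auto simp: red_dist_eq)
  then show ?thesis by (auto simp: cls_def tendsto_norm_zero_iff)
qed

lemma cls_self: "red_Cauchy G T f \<Longrightarrow> f \<in> cls G T f"
  using red_CauchyD by (subst cls_iff) auto

lemma cls_eqI:
  assumes f: "\<And>k. f k \<in> CcT G T" and g: "\<And>k. g k \<in> CcT G T" and fg: "(\<lambda>k. regmat (f k) - regmat (g k)) \<longlonglongrightarrow> 0"
  shows "cls G T f = cls G T g"
proof (rule set_eqI)
  fix h
  have "(\<lambda>k. regmat (h k) - regmat (f k)) \<longlonglongrightarrow> 0 \<longleftrightarrow> (\<lambda>k. regmat (h k) - regmat (g k)) \<longlonglongrightarrow> 0"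
    using tendsto_add[OF _ fg, of "\<lambda>k. regmat (h k) - regmat (f k)" 0] tendsto_diff[OF _ fg, of "\<lambda>k. regmat (h k) - regmat (g k)" 0]
    by auto
  then show "h \<in> cls G T f \<longleftrightarrow> h \<in> cls G T g" by (simp add: cls_iff f g)
qed

lemma cls_eqD:
  assumes f: "red_Cauchy G T f" and g: "\<And>k. g k \<in> CcT G T" and eq: "cls G T f = cls G T g"
  shows "(\<lambda>k. regmat (f k) - regmat (g k)) \<longlonglongrightarrow> 0"
  using cls_self[OF f] eq cls_iff[of g f, OF g] by simp

lemma rep_cls:
  assumes f: "red_Cauchy G T f"
  shows "red_Cauchy G T (rep (cls G T f))" "(\<lambda>k. regmat (rep (cls G T f) k) - regmat (f k)) \<longlonglongrightarrow> 0"
proof -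
  have "rep (cls G T f) \<in> cls G T f"
    unfolding rep_def using cls_self[OF f] by (rule someI[of "\<lambda>h. h \<in> cls G T f"])
  then show "red_Cauchy G T (rep (cls G T f))" "(\<lambda>k. regmat (rep (cls G T f) k) - regmat (f k)) \<longlonglongrightarrow> 0"
    using cls_iff[of f] red_CauchyD(1)[OF f] by auto
qed

lemma cls_Cred: "red_Cauchy G T f \<Longrightarrow> cls G T f \<in> Cred G T"
  by (auto simp: Cred_def)

lemma Cauchy_conv:
  assumes "red_Cauchy G T f" "red_Cauchy G T g"
  shows "red_Cauchy G T (\<lambda>k. conv G T (f k) (g k))"
  using red_CauchyD[OF assms(1)] red_CauchyD[OF assms(2)]
  by (simp add: red_Cauchy_iff CcT_conv regmat_conv Cauchy_mult_seq)

text \<open>\<open>cmul\<close> multiplies arbitrarily chosen representatives; they differ from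
  \<open>f\<close> and \<open>g\<close> by null sequences, and null times Cauchy is null.\<close>

lemma cmul_cls:
  assumes f: "red_Cauchy G T f" and g: "red_Cauchy G T g"
  shows "cmul G T (cls G T f) (cls G T g) = cls G T (\<lambda>k. conv G T (f k) (g k))"
proof -
  let ?f = "rep (cls G T f)" and ?g = "rep (cls G T g)"
  note f' = rep_cls[OF f] and g' = rep_cls[OF g]
  have "(\<lambda>k. regmat (?f k) * regmat (?g k) - regmat (f k) * regmat (g k)) =
      (\<lambda>k. regmat (?f k) * (regmat (?g k) - regmat (g k)) + (regmat (?f k) - regmat (f k)) * regmat (g k))"
    by (simp add: algebra_simps)
  also have "\<dots> \<longlonglongrightarrow> 0 + 0"
    by (intro tendsto_add Cauchy_mult_null red_CauchyD f' g' g)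
  finally show ?thesis
    unfolding cmul_def using red_CauchyD(1)[OF f] red_CauchyD(1)[OF g] red_CauchyD(1)[OF f'(1)] red_CauchyD(1)[OF g'(1)]
    by (intro cls_eqI) (simp_all add: CcT_conv regmat_conv)
qed

lemma Cauchy_adj:
  assumes "red_Cauchy G T f"
  shows "red_Cauchy G T (\<lambda>k. adj T (f k))"
  using red_CauchyD[OF assms] by (simp add: red_Cauchy_iff CcT_adj regmat_adj Cauchy_star)

lemma cadj_cls:
  assumes f: "red_Cauchy G T f"
  shows "cadj G T (cls G T f) = cls G T (\<lambda>k. adj T (f k))"
proof -
  note f' = rep_cls[OF f]
  have "(\<lambda>k. star (regmat (rep (cls G T f) k) - regmat (f k))) \<longlonglongrightarrow> star 0"
    by (rule tendsto_star[OF f'(2)])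
  then show ?thesis
    unfolding cadj_def using red_CauchyD(1)[OF f] red_CauchyD(1)[OF f'(1)]
    by (intro cls_eqI) (simp_all add: CcT_adj regmat_adj star_diff)
qed

lemma cdist_cls:
  assumes f: "red_Cauchy G T f" and g: "red_Cauchy G T g"
  shows "(\<lambda>k. norm (regmat (f k) - regmat (g k))) \<longlonglongrightarrow> cdist G T (cls G T f) (cls G T g)"
proof -
  let ?f = "rep (cls G T f)" and ?g = "rep (cls G T g)"
  note f' = rep_cls[OF f] and g' = rep_cls[OF g]
  let ?d = "\<lambda>k. norm (regmat (?f k) - regmat (?g k))"
  have "Cauchy (\<lambda>k. regmat (?f k) - regmat (?g k))"
    by (intro Cauchy_diff_seq red_CauchyD(2) f'(1) g'(1))
  then have "Cauchy ?d" by (rule Cauchy_norm_seq)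
  then have "convergent ?d" by (simp add: Cauchy_convergent_iff)
  moreover have "(\<lambda>k. red_dist G T (?f k) (?g k)) = ?d"
    using red_CauchyD(1)[OF f'(1)] red_CauchyD(1)[OF g'(1)] by (simp add: red_dist_eq)
  ultimately have 1: "?d \<longlonglongrightarrow> cdist G T (cls G T f) (cls G T g)"
    by (simp add: cdist_def convergent_LIMSEQ_iff)
  have "(\<lambda>k. norm ((regmat (?f k) - regmat (f k)) - (regmat (?g k) - regmat (g k)))) \<longlonglongrightarrow> 0"
    using tendsto_norm_zero[OF tendsto_diff[OF f'(2) g'(2), simplified]] .
  then have "(\<lambda>k. norm (regmat (f k) - regmat (g k)) - ?d k) \<longlonglongrightarrow> 0"
  proof (rule Lim_null_comparison[rotated], intro always_eventually allI)
    fix k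
    have "\<bar>norm (regmat (f k) - regmat (g k)) - ?d k\<bar> \<le> norm ((regmat (f k) - regmat (g k)) - (regmat (?f k) - regmat (?g k)))"
      by (rule norm_triangle_ineq3)
    also have "\<dots> = norm ((regmat (?f k) - regmat (f k)) - (regmat (?g k) - regmat (g k)))"
      by (subst norm_minus_commute) (simp add: algebra_simps)
    finally show "norm (norm (regmat (f k) - regmat (g k)) - ?d k) \<le> norm ((regmat (?f k) - regmat (f k)) - (regmat (?g k) - regmat (g k)))"
      by simp
  qed
  from tendsto_add[OF this 1] show ?thesis by simp
qed

lemma expect_cls:
  assumes f: "red_Cauchy G T f" and x: "x \<in> units G"
  shows "(\<lambda>k. expect0 G T (f k) x) \<longlonglongrightarrow> expect G T (cls G T f) x"
proof -
  let ?f = "rep (cls G T f)"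
  note f' = rep_cls[OF f]
  have e: "expect0 G T (h k) x = entry (regmat (h k)) x x" if "red_Cauchy G T h" for h k
    using entry_unit[OF red_CauchyD(1)[OF that] x] by simp
  have "Cauchy (\<lambda>k. expect0 G T (?f k) x)"
    unfolding e[OF f'(1)] by (rule Cauchy_entry[OF red_CauchyD(2)[OF f'(1)]])
  then have 1: "(\<lambda>k. expect0 G T (?f k) x) \<longlonglongrightarrow> expect G T (cls G T f) x"
    by (simp add: expect_def Cauchy_convergent_iff convergent_LIMSEQ_iff)
  have "(\<lambda>k. expect0 G T (?f k) x - expect0 G T (f k) x) \<longlonglongrightarrow> 0"
    using tendsto_entry[OF f'(2), of x x] by (simp add: e[OF f'(1)] e[OF f] entry_simps)
  from tendsto_diff[OF 1 this] show ?thesis by simp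
qed


subsection \<open>Functions on the unit space\<close>

lemma Cc_mult:
  assumes "\<phi> \<in> Cc (unit_top G)" "continuous_map (unit_top G) euclidean \<psi>"
  shows "(\<lambda>x. \<psi> x * \<phi> x) \<in> Cc (unit_top G)"
proof -
  obtain K where "compactin (unit_top G) K" "\<forall>x\<in>units G. \<phi> x \<noteq> 0 \<longrightarrow> x \<in> K"
    using assms(1) by (auto simp: Cc_iff[OF Hausdorff_unit_top])
  then show ?thesis using assms
    by (auto simp: Cc_iff[OF Hausdorff_unit_top] intro!: continuous_map_complex_mult)
qed

definition chi :: "'a set \<Rightarrow> 'a \<Rightarrow> complex" where
  "chi K x = (if x \<in> K then 1 else 0)"

definition compact_open :: "'a set \<Rightarrow> bool" where
  "compact_open K \<longleftrightarrow> compactin (gtop G) K \<and> openin (gtop G) K \<and> K \<subseteq> units G"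

lemma chi_continuous:
  assumes "compact_open K"
  shows "continuous_map (unit_top G) euclidean (chi K)"
proof (rule continuous_map_clopen_extend[where A = K and c = 0])
  have "compactin (unit_top G) K" using assms by (simp add: compact_open_def compactin_unit_top)
  then show "closedin (unit_top G) K" by (rule compactin_imp_closedin[OF Hausdorff_unit_top])
  show "openin (unit_top G) K" using assms by (simp add: compact_open_def openin_unit_top)
  show "continuous_map (subtopology (unit_top G) K) euclidean (chi K)"
    by (rule continuous_map_eq[of _ _ "\<lambda>_. 1"]) (auto simp: chi_def)
qed (auto simp: chi_def)

lemma chi_Cc:
  assumes "compact_open K"
  shows "chi K \<in> Cc (unit_top G)"
proof -
  have "compactin (unit_top G) K \<and> (\<forall>x\<in>units G. chi K x \<noteq> 0 \<longrightarrow> x \<in> K)"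
    using assms by (auto simp: compact_open_def compactin_unit_top chi_def)
  moreover have "chi K x = 0" if "x \<notin> units G" for x using assms that by (auto simp: compact_open_def chi_def)
  ultimately show ?thesis using chi_continuous[OF assms] by (auto simp: Cc_iff[OF Hausdorff_unit_top])
qed

lemma compact_superlevel:
  fixes \<phi> :: "'a \<Rightarrow> complex"
  assumes \<phi>: "\<phi> \<in> Cc (unit_top G)" and e: "0 < e"
  shows "compactin (unit_top G) {x \<in> units G. e \<le> norm (\<phi> x)}"
proof -
  obtain K where K: "compactin (unit_top G) K" "\<forall>x\<in>units G. \<phi> x \<noteq> 0 \<longrightarrow> x \<in> K"
    and c: "continuous_map (unit_top G) euclidean \<phi>"
    using \<phi> by (auto simp: Cc_iff[OF Hausdorff_unit_top])
  have "closedin (unit_top G) {x \<in> topspace (unit_top G). \<phi> x \<in> {z. e \<le> norm z}}"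
    by (rule closedin_continuous_map_preimage[OF c]) (simp add: closed_Collect_le continuous_intros)
  moreover have "{x \<in> topspace (unit_top G). \<phi> x \<in> {z. e \<le> norm z}} \<subseteq> K" using K(2) e by auto
  ultimately show ?thesis using closed_compactin[OF K(1)] by simp
qed

lemma open_superlevel:
  fixes \<phi> :: "'a \<Rightarrow> complex"
  assumes "continuous_map (unit_top G) euclidean \<phi>"
  shows "openin (gtop G) {x \<in> units G. e < norm (\<phi> x)}"
proof -
  have "openin (unit_top G) {x \<in> topspace (unit_top G). \<phi> x \<in> {z. e < norm z}}"
    by (rule openin_continuous_map_preimage[OF assms]) (simp add: open_Collect_less continuous_intros)
  then show ?thesis by (simp add: openin_unit_top)
qed

lemma Cc_C0: "\<phi> \<in> Cc (unit_top G) \<Longrightarrow> \<phi> \<in> C0 (unit_top G)"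
  using compact_superlevel by (auto simp: C0_def Cc_def)

lemma chi_projection: "compact_open K \<Longrightarrow> projection G (chi K)"
  using Cc_C0[OF chi_Cc] by (auto simp: projection_def chi_def)

text \<open>The matrix of a function on the unit space is diagonal with the values of the function
  as entries, so the uniform norm bounds its norm.\<close>

lemma norm_regmat_iota0_diff:
  assumes "\<phi> \<in> Cc (unit_top G)" "\<psi> \<in> Cc (unit_top G)" "0 \<le> e"
    and "\<And>x. x \<in> units G \<Longrightarrow> norm (\<phi> x - \<psi> x) \<le> e"
  shows "norm (regmat (iota0 G T \<phi>) - regmat (iota0 G T \<psi>)) \<le> e"
  using assms
  by (intro norm_bmat_le mat_bound_partial_injection) (auto simp: entry_simps entry_iota0 split: if_splits)


definition approx :: "(nat \<Rightarrow> 'a \<Rightarrow> complex) \<Rightarrow> ('a \<Rightarrow> complex) \<Rightarrow> bool" where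
  "approx \<phi> u \<longleftrightarrow> (\<forall>k. \<phi> k \<in> Cc (unit_top G)) \<and> uniform_limit (units G) \<phi> u sequentially"

lemma approxD:
  "approx \<phi> u \<Longrightarrow> 0 < e \<Longrightarrow> \<forall>\<^sub>F k in sequentially. \<forall>x\<in>units G. dist (\<phi> k x) (u x) < e"
  unfolding approx_def uniform_limit_iff by blast

lemma approx_diff_tendsto:
  assumes "approx \<phi> u" "approx \<psi> u"
  shows "(\<lambda>k. regmat (iota0 G T (\<phi> k)) - regmat (iota0 G T (\<psi> k))) \<longlonglongrightarrow> 0"
proof (rule LIMSEQ_I)
  fix e :: real assume e: "0 < e"
  have "\<forall>\<^sub>F k in sequentially. \<forall>x\<in>units G. dist (\<phi> k x) (u x) < e/4"
       "\<forall>\<^sub>F k in sequentially. \<forall>x\<in>units G. dist (\<psi> k x) (u x) < e/4"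
    using approxD[OF assms(1), of "e/4"] approxD[OF assms(2), of "e/4"] e by simp_all
  then have "\<forall>\<^sub>F k in sequentially. norm (regmat (iota0 G T (\<phi> k)) - regmat (iota0 G T (\<psi> k)) - 0) < e"
  proof eventually_elim
    case (elim k)
    have "norm (regmat (iota0 G T (\<phi> k)) - regmat (iota0 G T (\<psi> k))) \<le> e/2"
    proof (rule norm_regmat_iota0_diff)
      fix x assume "x \<in> units G"
      then have "dist (\<phi> k x) (u x) < e/4" "dist (\<psi> k x) (u x) < e/4" using elim by auto
      then show "norm (\<phi> k x - \<psi> k x) \<le> e/2"
        using dist_triangle2[of "\<phi> k x" "\<psi> k x" "u x"] by (simp add: dist_norm)
    qed (use assms e in \<open>auto simp: approx_def\<close>)
    then show ?case using e by simp
  qed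
  then show "\<exists>N. \<forall>k\<ge>N. norm (regmat (iota0 G T (\<phi> k)) - regmat (iota0 G T (\<psi> k)) - 0) < e"
    by (simp add: eventually_sequentially)
qed

lemma approx_Cauchy:
  assumes "approx \<phi> u"
  shows "red_Cauchy G T (\<lambda>k. iota0 G T (\<phi> k))"
proof -
  have Cc: "\<phi> k \<in> Cc (unit_top G)" for k using assms by (simp add: approx_def)
  have "Cauchy (\<lambda>k. regmat (iota0 G T (\<phi> k)))"
  proof (rule CauchyI)
    fix e :: real assume e: "0 < e"
    then have "\<forall>\<^sub>F k in sequentially. \<forall>x\<in>units G. dist (\<phi> k x) (u x) < e/4"
      by (intro approxD[OF assms]) simp
    then obtain N where N: "\<And>k x. N \<le> k \<Longrightarrow> x \<in> units G \<Longrightarrow> dist (\<phi> k x) (u x) < e/4"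
      unfolding eventually_sequentially by blast
    have "norm (regmat (iota0 G T (\<phi> m)) - regmat (iota0 G T (\<phi> n))) < e" if "N \<le> m" "N \<le> n" for m n
    proof -
      have "norm (regmat (iota0 G T (\<phi> m)) - regmat (iota0 G T (\<phi> n))) \<le> e/2"
      proof (rule norm_regmat_iota0_diff[OF Cc Cc])
        fix x assume x: "x \<in> units G"
        show "norm (\<phi> m x - \<phi> n x) \<le> e/2"
          using dist_triangle2[of "\<phi> m x" "\<phi> n x" "u x"] N[OF that(1) x] N[OF that(2) x] by (simp add: dist_norm)
      qed (use e in simp)
      then show ?thesis using e by simp
    qed
    then show "\<exists>M. \<forall>m\<ge>M. \<forall>n\<ge>M. norm (regmat (iota0 G T (\<phi> m)) - regmat (iota0 G T (\<phi> n))) < e" by blast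
  qed
  then show ?thesis using iota0_CcT[OF Cc] by (simp add: red_Cauchy_iff)
qed

text \<open>Any two approximations of \<open>u\<close> differ by a null sequence of matrices, so the
  union in \<open>iota\<close> is over equal classes.\<close>

lemma iota_eq:
  assumes a: "approx \<phi> u"
  shows "iota G T u = cls G T (\<lambda>k. iota0 G T (\<phi> k))"
proof -
  have eq: "cls G T (\<lambda>k. iota0 G T (\<psi> k)) = cls G T (\<lambda>k. iota0 G T (\<phi> k))" if "approx \<psi> u" for \<psi>
    using that a by (intro cls_eqI approx_diff_tendsto) (auto simp: approx_def iota0_CcT)
  have "iota G T u = {h. \<exists>\<psi>. approx \<psi> u \<and> h \<in> cls G T (\<lambda>k. iota0 G T (\<psi> k))}"
    by (auto simp: iota_def approx_def)
  also have "\<dots> = cls G T (\<lambda>k. iota0 G T (\<phi> k))" using eq a by blast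
  finally show ?thesis .
qed

lemma approx_const: "\<phi> \<in> Cc (unit_top G) \<Longrightarrow> approx (\<lambda>_. \<phi>) \<phi>"
  by (simp add: approx_def uniform_limit_iff)

text \<open>Multiplying \<open>u\<close> by the indicator of a compact open set that contains the
  compact set where \<open>|u|\<close> is at least \<open>1/(k+1)\<close> changes it by less than
  \<open>1/(k+1)\<close>.\<close>

lemma C0_approx:
  assumes u: "u \<in> C0 (unit_top G)"
  obtains \<phi> where "approx \<phi> u"
proof -
  have uc: "continuous_map (unit_top G) euclidean u" using u by (simp add: C0_def)
  have "\<exists>K. compact_open K \<and> {x \<in> units G. 1 / Suc k \<le> norm (u x)} \<subseteq> K" for k
  proof -
    have "compactin (unit_top G) {x \<in> topspace (unit_top G). 1 / Suc k \<le> norm (u x)}"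
      using u unfolding C0_def by (simp del: topspace_unit_top)
    then have "compactin (gtop G) {x \<in> units G. 1 / Suc k \<le> norm (u x)}" by (simp add: compactin_unit_top)
    then show ?thesis
      using compact_open_between[OF _ units_open] unfolding compact_open_def by (metis (no_types, lifting) mem_Collect_eq subsetI)
  qed
  then obtain K where K: "\<And>k. compact_open (K k)" "\<And>k. {x \<in> units G. 1 / Suc k \<le> norm (u x)} \<subseteq> K k"
    by metis
  define \<phi> where "\<phi> k x = u x * chi (K k) x" for k x
  have "\<phi> k \<in> Cc (unit_top G)" for k
    unfolding \<phi>_def by (rule Cc_mult[OF chi_Cc[OF K(1)] uc])
  moreover have "uniform_limit (units G) \<phi> u sequentially"
    unfolding uniform_limit_iff
  proof (intro allI impI)
    fix e :: real assume e: "0 < e"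
    obtain N where N: "1 / Suc N < e" using e nat_approx_posE by blast
    have "dist (\<phi> k x) (u x) < e" if "N \<le> k" "x \<in> units G" for k x
    proof (cases "x \<in> K k")
      case False
      then have "norm (u x) < 1 / Suc k" using K(2)[of k] that(2) by fastforce
      also have "\<dots> \<le> 1 / Suc N" using that(1) by (simp add: frac_le)
      finally show ?thesis using N False by (simp add: \<phi>_def chi_def)
    qed (use e in \<open>simp add: \<phi>_def chi_def\<close>)
    then show "\<forall>\<^sub>F k in sequentially. \<forall>x\<in>units G. dist (\<phi> k x) (u x) < e"
      by (auto simp: eventually_sequentially)
  qed
  ultimately show ?thesis using that by (auto simp: approx_def)
qed

lemma approx_chi:
  assumes "approx \<phi> u" "compact_open K"
  shows "approx (\<lambda>k x. chi K x * \<phi> k x) (\<lambda>x. chi K x * u x)"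
proof -
  have "uniform_limit (units G) (\<lambda>k x. chi K x * \<phi> k x) (\<lambda>x. chi K x * u x) sequentially"
    unfolding uniform_limit_iff
  proof (intro allI impI)
    fix e :: real assume "0 < e"
    then have "\<forall>\<^sub>F k in sequentially. \<forall>x\<in>units G. dist (\<phi> k x) (u x) < e"
      using assms by (simp add: approx_def uniform_limit_iff)
    then show "\<forall>\<^sub>F k in sequentially. \<forall>x\<in>units G. dist (chi K x * \<phi> k x) (chi K x * u x) < e"
      by eventually_elim (use \<open>0 < e\<close> in \<open>auto simp: chi_def\<close>)
  qed
  then show ?thesis using assms Cc_mult chi_continuous by (simp add: approx_def)
qed

abbreviation "dg \<phi> \<equiv> regmat (iota0 G T \<phi>)"

lemma entry_dg_left:
  assumes "\<phi> \<in> Cc (unit_top G)"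
  shows "entry (dg \<phi> * A) s t = (if s \<in> arrows G then \<phi> (rng G s) else 0) * entry A s t"
proof -
  have f: "finite {u. entry A u t \<noteq> 0}" using entry_finite_lines[of A] by (simp add: finite_lines_def)
  have "entry (dg \<phi> * A) s t = (\<Sum>u\<in>insert s {u. entry A u t \<noteq> 0}. entry (dg \<phi>) s u * entry A u t)"
    unfolding times_bmat.rep_eq by (rule mat_mult_superset) (use f in auto)
  also have "\<dots> = (\<Sum>u\<in>{s}. entry (dg \<phi>) s u * entry A u t)"
    using f by (intro sum.mono_neutral_right) (auto simp: entry_iota0[OF assms])
  finally show ?thesis by (simp add: entry_iota0[OF assms])
qed

lemma entry_dg_right:
  assumes "\<phi> \<in> Cc (unit_top G)"
  shows "entry (A * dg \<phi>) s t = entry A s t * (if t \<in> arrows G then \<phi> (rng G t) else 0)"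
proof -
  have "entry (A * dg \<phi>) s t = (\<Sum>u\<in>{t}. entry A s u * entry (dg \<phi>) u t)"
    unfolding times_bmat.rep_eq
    by (rule mat_mult_superset) (auto simp: entry_iota0[OF assms] split: if_splits)
  then show ?thesis by (simp add: entry_iota0[OF assms])
qed

end

section \<open>Normalisers over effective groupoids\<close>

context ample_twist
begin

text \<open>Up to a null sequence the matrices are diagonal with uniformly convergent entries: they
  represent an element of \<open>C_0\<close> of the unit space, though the terms themselves need not
  be diagonal.\<close>

definition diag_limit :: "(nat \<Rightarrow> 'a bmat) \<Rightarrow> bool" where
  "diag_limit A \<longleftrightarrow> (\<exists>\<phi> u. approx \<phi> u \<and> (\<lambda>k. A k - dg (\<phi> k)) \<longlonglongrightarrow> 0)"

text \<open>The normaliser condition transferred to a representing sequence and tested on indicators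
  only; these suffice to separate ranges.\<close>

definition normalising :: "(nat \<Rightarrow> 'b \<Rightarrow> complex) \<Rightarrow> bool" where
  "normalising f \<longleftrightarrow> red_Cauchy G T f \<and> (\<forall>K. compact_open K \<longrightarrow>
     diag_limit (\<lambda>k. regmat (f k) * dg (chi K) * star (regmat (f k))) \<and>
     diag_limit (\<lambda>k. star (regmat (f k)) * dg (chi K) * regmat (f k)))"

lemma normalising_adj:
  assumes "normalising f"
  shows "normalising (\<lambda>k. adj T (f k))"
  using assms red_CauchyD(1)[of f] by (simp add: normalising_def Cauchy_adj regmat_adj)

lemma cls_iota_diag_limit:
  assumes g: "red_Cauchy G T g" and i: "cls G T g \<in> iota G T ` C0 (unit_top G)"
  shows "diag_limit (\<lambda>k. regmat (g k))"
proof -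
  obtain u where u: "u \<in> C0 (unit_top G)" "cls G T g = iota G T u" using i by auto
  obtain \<phi> where \<phi>: "approx \<phi> u" using C0_approx[OF u(1)] .
  have "(\<lambda>k. regmat (g k) - dg (\<phi> k)) \<longlonglongrightarrow> 0"
    by (rule cls_eqD[OF g]) (use \<phi> u(2) iota_eq[OF \<phi>] in \<open>auto simp: approx_def iota0_CcT\<close>)
  then show ?thesis using \<phi> by (auto simp: diag_limit_def)
qed

lemma chi_Cauchy: "compact_open K \<Longrightarrow> red_Cauchy G T (\<lambda>_. iota0 G T (chi K))"
  using approx_Cauchy[OF approx_const[OF chi_Cc]] .

lemma iota_chi: "compact_open K \<Longrightarrow> iota G T (chi K) = cls G T (\<lambda>_. iota0 G T (chi K))"
  using iota_eq[OF approx_const[OF chi_Cc]] .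

lemma normaliser_normalising:
  assumes f: "red_Cauchy G T f" and n: "normaliser G T (cls G T f)"
  shows "normalising f"
  unfolding normalising_def
proof (intro conjI allI impI f)
  fix K assume K: "compact_open K"
  let ?p = "iota0 G T (chi K)"
  have p: "?p \<in> CcT G T" by (rule iota0_CcT[OF chi_Cc[OF K]])
  have "iota G T (chi K) \<in> iota G T ` C0 (unit_top G)" using Cc_C0[OF chi_Cc[OF K]] by blast
  then have i: "cmul G T (cmul G T (cls G T f) (iota G T (chi K))) (cadj G T (cls G T f)) \<in> iota G T ` C0 (unit_top G)"
    "cmul G T (cmul G T (cadj G T (cls G T f)) (iota G T (chi K))) (cls G T f) \<in> iota G T ` C0 (unit_top G)"
    using n by (auto simp: normaliser_def)
  note pc = chi_Cauchy[OF K] and fa = Cauchy_adj[OF f]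
  have 1: "red_Cauchy G T (\<lambda>k. conv G T (conv G T (f k) ?p) (adj T (f k)))"
    by (intro Cauchy_conv f pc fa)
  have 2: "red_Cauchy G T (\<lambda>k. conv G T (conv G T (adj T (f k)) ?p) (f k))"
    by (intro Cauchy_conv f pc fa)
  have "diag_limit (\<lambda>k. regmat (conv G T (conv G T (f k) ?p) (adj T (f k))))"
    using i(1) unfolding iota_chi[OF K] cadj_cls[OF f] cmul_cls[OF f pc] cmul_cls[OF Cauchy_conv[OF f pc] fa]
    by (rule cls_iota_diag_limit[OF 1])
  then show "diag_limit (\<lambda>k. regmat (f k) * dg (chi K) * star (regmat (f k)))"
    by (simp add: regmat_conv CcT_conv CcT_adj regmat_adj p red_CauchyD(1)[OF f])
  have "diag_limit (\<lambda>k. regmat (conv G T (conv G T (adj T (f k)) ?p) (f k)))"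
    using i(2) unfolding iota_chi[OF K] cadj_cls[OF f] cmul_cls[OF fa pc] cmul_cls[OF Cauchy_conv[OF fa pc] f]
    by (rule cls_iota_diag_limit[OF 2])
  then show "diag_limit (\<lambda>k. star (regmat (f k)) * dg (chi K) * regmat (f k))"
    by (simp add: regmat_conv CcT_conv CcT_adj regmat_adj p red_CauchyD(1)[OF f])
qed

lemma dg_mult_zero:
  assumes K: "compact_open K" and L: "compact_open L" and KL: "K \<inter> L = {}" and \<psi>: "\<psi> \<in> Cc (unit_top G)"
  shows "dg (chi K) * (dg \<psi> * dg (chi L)) = 0"
proof (rule bmat_eqI)
  fix s t
  show "entry (dg (chi K) * (dg \<psi> * dg (chi L))) s t = entry 0 s t"
    using KL by (auto simp: entry_dg_left[OF chi_Cc[OF K]] entry_dg_right[OF chi_Cc[OF L]]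
        entry_iota0[OF \<psi>] entry_simps(1) chi_def)
qed

text \<open>The diagonal entry is the sum of the squared moduli of those entries in column
  \<open>x\<close> whose rows have range in \<open>K\<close>; a single one of them is kept.\<close>

lemma norm_sandwich_ge:
  assumes K: "compact_open K" and s: "s \<in> arrows G" "rng G s \<in> K"
  shows "(norm (entry F s x))\<^sup>2 \<le> norm (entry (star F * dg (chi K) * F) x x)"
proof -
  let ?S = "insert s {u. entry F u x \<noteq> 0}"
  have S: "finite ?S" using entry_finite_lines[of F] by (simp add: finite_lines_def)
  define c where "c u = (if u \<in> arrows G \<and> rng G u \<in> K then 1 else 0 :: real)" for u
  have PF: "entry (dg (chi K) * F) u x = of_real (c u) * entry F u x" for u
    by (simp add: entry_dg_left[OF chi_Cc[OF K]] c_def chi_def)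
  have "entry (star F * (dg (chi K) * F)) x x = (\<Sum>u\<in>?S. entry (star F) x u * entry (dg (chi K) * F) u x)"
    unfolding times_bmat.rep_eq[of "star F"] by (rule mat_mult_superset[OF S]) (auto simp: PF)
  also have "\<dots> = (\<Sum>u\<in>?S. of_real (c u * (norm (entry F u x))\<^sup>2))"
  proof (rule sum.cong[OF refl])
    fix u
    have "cnj (entry F u x) * entry F u x = of_real ((norm (entry F u x))\<^sup>2)"
      by (simp only: complex_norm_square mult.commute)
    then show "entry (star F) x u * entry (dg (chi K) * F) u x = of_real (c u * (norm (entry F u x))\<^sup>2)"
      unfolding PF star.rep_eq by (metis mult.left_commute of_real_mult)
  qed
  also have "\<dots> = of_real (\<Sum>u\<in>?S. c u * (norm (entry F u x))\<^sup>2)" by simp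
  finally have "norm (entry (star F * dg (chi K) * F) x x) = \<bar>\<Sum>u\<in>?S. c u * (norm (entry F u x))\<^sup>2\<bar>"
    by (simp only: mult.assoc norm_of_real)
  moreover have "0 \<le> (\<Sum>u\<in>?S. c u * (norm (entry F u x))\<^sup>2)" by (intro sum_nonneg) (simp add: c_def)
  ultimately have e: "norm (entry (star F * dg (chi K) * F) x x) = (\<Sum>u\<in>?S. c u * (norm (entry F u x))\<^sup>2)"
    by linarith
  have "(\<Sum>u\<in>{s}. c u * (norm (entry F u x))\<^sup>2) \<le> (\<Sum>u\<in>?S. c u * (norm (entry F u x))\<^sup>2)"
    using S by (intro sum_mono2) (auto simp: c_def)
  then show ?thesis using s unfolding e by (simp add: c_def)
qed

lemma compact_open_separate:
  assumes "x \<in> units G" "y \<in> units G" "x \<noteq> y"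
  obtains K L where "compact_open K" "compact_open L" "x \<in> K" "y \<in> L" "K \<inter> L = {}"
proof -
  have "x \<in> topspace (gtop G)" "y \<in> topspace (gtop G)" using assms units_subset by auto
  then have "\<exists>U V. openin (gtop G) U \<and> openin (gtop G) V \<and> x \<in> U \<and> y \<in> V \<and> disjnt U V"
    using Hausdorff assms(3) by (simp add: Hausdorff_space_def)
  then obtain U V where UV: "openin (gtop G) U" "openin (gtop G) V" "x \<in> U" "y \<in> V" "disjnt U V" by blast
  obtain K where K: "compactin (gtop G) K" "openin (gtop G) K" "x \<in> K" "K \<subseteq> U \<inter> units G"
    using compact_open_bisection[OF openin_Int[OF UV(1) units_open], of x] UV(3) assms(1) by blast
  obtain L where L: "compactin (gtop G) L" "openin (gtop G) L" "y \<in> L" "L \<subseteq> V \<inter> units G"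
    using compact_open_bisection[OF openin_Int[OF UV(2) units_open], of y] UV(4) assms(2) by blast
  have "K \<inter> L = {}" using K(4) L(4) UV(5) by (auto simp: disjnt_def)
  then show ?thesis using that[of K L] K L by (simp add: compact_open_def)
qed

lemma compact_open_nbhd:
  assumes "x \<in> units G"
  obtains K where "compact_open K" "x \<in> K"
  using compact_open_bisection[OF units_open assms] unfolding compact_open_def by metis

text \<open>For disjoint indicators \<open>p, p'\<close> and \<open>d\<close> with \<open>d(x) = 1\<close>, the product \<open>(n* p n) d (n* p' n) = n* p (n d n*) p' n\<close>
  vanishes because \<open>n d n*\<close> is diagonal; but the diagonal entries of \<open>n* p n\<close> and \<open>n* p' n\<close> at \<open>x\<close> dominate
  the squares of the entries of \<open>n\<close> with range in the supports of \<open>p\<close> and \<open>p'\<close>.\<close>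

lemma normalising_rng_eq:
  assumes n: "normalising f" and s: "s1 \<in> arrows G" "s2 \<in> arrows G" "x \<in> units G"
    and nz: "\<not> (\<lambda>k. entry (regmat (f k)) s1 x) \<longlonglongrightarrow> 0" "\<not> (\<lambda>k. entry (regmat (f k)) s2 x) \<longlonglongrightarrow> 0"
  shows "rng G s1 = rng G s2"
proof (rule ccontr)
  assume ne: "rng G s1 \<noteq> rng G s2"
  obtain K L where K: "compact_open K" and L: "compact_open L" and KL: "rng G s1 \<in> K" "rng G s2 \<in> L" "K \<inter> L = {}"
    using compact_open_separate[of "rng G s1" "rng G s2"] s ne by auto
  \<comment> \<open>The indicator of \<open>D\<close> serves as \<open>d\<close>; the constant 1
    need not vanish at infinity.\<close>
  obtain D where D: "compact_open D" "x \<in> D" using compact_open_nbhd[OF s(3)] .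
  define F where "F k = regmat (f k)" for k
  define P Q R where "P = dg (chi K)" and "Q = dg (chi L)" and "R = dg (chi D)"
  have Fc: "Cauchy F" unfolding F_def using n red_CauchyD(2) by (simp add: normalising_def)
  note Fs = Cauchy_star[OF Fc]
  obtain \<phi> u where \<phi>: "approx \<phi> u" "(\<lambda>k. star (F k) * P * F k - dg (\<phi> k)) \<longlonglongrightarrow> 0"
    using n K by (auto simp: normalising_def diag_limit_def F_def P_def)
  obtain \<theta> v where \<theta>: "approx \<theta> v" "(\<lambda>k. star (F k) * Q * F k - dg (\<theta> k)) \<longlonglongrightarrow> 0"
    using n L by (auto simp: normalising_def diag_limit_def F_def Q_def)
  obtain \<psi> w where \<psi>: "approx \<psi> w" "(\<lambda>k. F k * R * star (F k) - dg (\<psi> k)) \<longlonglongrightarrow> 0"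
    using n D by (auto simp: normalising_def diag_limit_def F_def R_def)
  let ?A = "\<lambda>k. star (F k) * P * F k" and ?C = "\<lambda>k. star (F k) * Q * F k" and ?W = "\<lambda>k. F k * R * star (F k)"
  \<comment> \<open>In the middle the product with \<open>d\<close> may be replaced by the diagonal
    \<open>\<psi>\<close>, which the orthogonal projections on its two sides then kill.\<close>
  have "P * (dg (\<psi> k) * Q) = 0" for k
    unfolding P_def Q_def using \<psi>(1) by (intro dg_mult_zero K L KL) (simp add: approx_def)
  then have "(\<lambda>k. ?A k * R * ?C k) = (\<lambda>k. star (F k) * P * (?W k - dg (\<psi> k)) * (Q * F k))"
    by (simp add: mult.assoc right_diff_distrib left_diff_distrib)
       (simp add: mult.assoc[symmetric])
  also have "\<dots> \<longlonglongrightarrow> 0"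
    by (intro Cauchy_mult_null(2) Cauchy_mult_null(1) Cauchy_mult_seq Fs Fc Cauchy_const \<psi>(2))
  finally have "(\<lambda>k. entry (?A k * R * ?C k) x x) \<longlonglongrightarrow> 0"
    using tendsto_entry[of _ 0 x x] by (simp add: entry_simps(1))
  have dgc: "Cauchy (\<lambda>k. dg (\<phi> k))" "Cauchy (\<lambda>k. dg (\<theta> k))"
    using red_CauchyD(2)[OF approx_Cauchy] \<phi>(1) \<theta>(1) by blast+
  \<comment> \<open>The outer factors are diagonal up to null sequences as well, so in the limit the
    entry at \<open>x\<close> of the product is a product of entries.\<close>
  have "(\<lambda>k. (?A k - dg (\<phi> k)) * (R * ?C k) + (dg (\<phi> k) * R) * (?C k - dg (\<theta> k))) \<longlonglongrightarrow> 0 + 0"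
    by (intro tendsto_add Cauchy_mult_null(2)[OF _ \<phi>(2)] Cauchy_mult_null(1)[OF _ \<theta>(2)]
        Cauchy_mult_seq Fs Fc Cauchy_const dgc)
  then have "(\<lambda>k. ?A k * R * ?C k - dg (\<phi> k) * R * dg (\<theta> k)) \<longlonglongrightarrow> 0"
    by (simp add: algebra_simps)
  from tendsto_entry[OF this, of x x] \<open>(\<lambda>k. entry (?A k * R * ?C k) x x) \<longlonglongrightarrow> 0\<close>
  have "(\<lambda>k. entry (dg (\<phi> k) * R * dg (\<theta> k)) x x) \<longlonglongrightarrow> 0"
    by (simp add: entry_simps(1,4)) (drule (1) tendsto_diff, simp)
  moreover have "entry (dg (\<phi> k) * R * dg (\<theta> k)) x x = \<phi> k x * \<theta> k x" for k
    using \<phi>(1) \<theta>(1) D s(3) units_arrows unfolding R_def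
    by (simp add: approx_def entry_dg_right entry_dg_left entry_iota0 chi_Cc chi_def)
  ultimately have pc: "(\<lambda>k. \<phi> k x * \<theta> k x) \<longlonglongrightarrow> 0" by simp
  have A: "(\<lambda>k. entry (?A k) x x - \<phi> k x) \<longlonglongrightarrow> 0"
    using tendsto_entry[OF \<phi>(2), of x x] \<phi>(1) s(3) units_arrows
    by (simp add: entry_simps(1,4) approx_def entry_iota0)
  have C: "(\<lambda>k. entry (?C k) x x - \<theta> k x) \<longlonglongrightarrow> 0"
    using tendsto_entry[OF \<theta>(2), of x x] \<theta>(1) s(3) units_arrows
    by (simp add: entry_simps(1,4) approx_def entry_iota0)
  have Ac: "Cauchy (\<lambda>k. entry (?C k) x x)" and pcc: "Cauchy (\<lambda>k. entry (dg (\<phi> k)) x x)"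
    by (intro Cauchy_entry Cauchy_mult_seq Fs Fc Cauchy_const dgc)+
  have pcc: "Cauchy (\<lambda>k. \<phi> k x)"
    using pcc \<phi>(1) s(3) units_arrows by (simp add: approx_def entry_iota0)
  have "(\<lambda>k. (entry (?A k) x x - \<phi> k x) * entry (?C k) x x + \<phi> k x * (entry (?C k) x x - \<theta> k x) + \<phi> k x * \<theta> k x) \<longlonglongrightarrow> 0 + 0 + 0"
    by (intro tendsto_add Cauchy_mult_null(2)[OF Ac A] Cauchy_mult_null(1)[OF pcc C] pc)
  then have "(\<lambda>k. entry (?A k) x x * entry (?C k) x x) \<longlonglongrightarrow> 0"
    by (simp add: algebra_simps)
  then have 0: "(\<lambda>k. norm (entry (?A k) x x) * norm (entry (?C k) x x)) \<longlonglongrightarrow> 0"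
    using tendsto_norm_zero by (fastforce simp: norm_mult)
  have "(\<lambda>k. (norm (entry (F k) s1 x))\<^sup>2 * (norm (entry (F k) s2 x))\<^sup>2) \<longlonglongrightarrow> 0"
  proof (rule Lim_null_comparison[OF _ 0], intro always_eventually allI)
    fix k
    have "(norm (entry (F k) s1 x))\<^sup>2 * (norm (entry (F k) s2 x))\<^sup>2 \<le> norm (entry (?A k) x x) * norm (entry (?C k) x x)"
      unfolding P_def Q_def by (intro mult_mono norm_sandwich_ge K L KL s) auto
    then show "norm ((norm (entry (F k) s1 x))\<^sup>2 * (norm (entry (F k) s2 x))\<^sup>2) \<le> norm (entry (?A k) x x) * norm (entry (?C k) x x)"
      by simp
  qed
  moreover obtain a b where ab: "(\<lambda>k. entry (F k) s1 x) \<longlonglongrightarrow> a" "(\<lambda>k. entry (F k) s2 x) \<longlonglongrightarrow> b"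
    using Cauchy_entry[OF Fc] by (meson Cauchy_convergent_iff convergentD)
  moreover have "(\<lambda>k. (norm (entry (F k) s1 x))\<^sup>2 * (norm (entry (F k) s2 x))\<^sup>2) \<longlonglongrightarrow> (norm a)\<^sup>2 * (norm b)\<^sup>2"
    by (intro tendsto_intros ab)
  ultimately have "(norm a)\<^sup>2 * (norm b)\<^sup>2 = 0" using LIMSEQ_unique by blast
  then have "a = 0 \<or> b = 0" by simp
  then show False using ab nz by (auto simp: F_def)
qed

text \<open>The arrows at which the limit function \<open>j(n)\<close> does not vanish. Vanishing
  does not depend on the lift, so \<open>base\<close> may be used.\<close>

definition supp :: "(nat \<Rightarrow> 'b \<Rightarrow> complex) \<Rightarrow> 'a set" where
  "supp f = {\<gamma> \<in> arrows G. \<not> (\<lambda>k. f k (base \<gamma>)) \<longlonglongrightarrow> 0}"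

lemma supp_adj:
  assumes f: "red_Cauchy G T f" and g: "\<gamma> \<in> arrows G"
  shows "ginv G \<gamma> \<in> supp (\<lambda>k. adj T (f k)) \<longleftrightarrow> \<gamma> \<in> supp f"
proof -
  have "norm (adj T (f k) (base (ginv G \<gamma>))) = norm (f k (base \<gamma>))" for k
  proof -
    have "norm (adj T (f k) (base (ginv G \<gamma>))) = norm (f k (ginv \<Sigma> (base (ginv G \<gamma>))))"
      using g base_closed[of "ginv G \<gamma>"] by (simp add: adj_def)
    also have "\<dots> = norm (f k (base \<gamma>))"
      using g by (intro contra_norm[OF CcT_contra[OF red_CauchyD(1)[OF f]]]) (simp_all add: base_closed q_base)
    finally show ?thesis .
  qed
  then have "(\<lambda>k. adj T (f k) (base (ginv G \<gamma>))) \<longlonglongrightarrow> 0 \<longleftrightarrow> (\<lambda>k. f k (base \<gamma>)) \<longlonglongrightarrow> 0"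
    using tendsto_norm_zero_iff[of "\<lambda>k. adj T (f k) (base (ginv G \<gamma>))"] tendsto_norm_zero_iff[of "\<lambda>k. f k (base \<gamma>)"]
    by simp
  then show ?thesis using g by (simp add: supp_def)
qed

text \<open>Values converge uniformly by \<open>norm_value_le\<close>. One late term exceeds
  \<open>e/2\<close> near \<open>\<gamma>\<close> by continuity, and all late terms are within
  \<open>e/4\<close> of it, so none of them drops below \<open>e/4\<close> there.\<close>

lemma supp_open:
  assumes f: "red_Cauchy G T f" and g: "\<gamma> \<in> supp f"
  obtains V where "openin (gtop G) V" "\<gamma> \<in> V" "V \<subseteq> supp f"
proof -
  have ga: "\<gamma> \<in> arrows G" using g by (simp add: supp_def)
  have fC: "f k \<in> CcT G T" for k using red_CauchyD[OF f] by blast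
  obtain e where e: "0 < e" "\<And>N. \<exists>k\<ge>N. e \<le> norm (f k (base \<gamma>))"
    using g by (auto simp: supp_def LIMSEQ_iff not_less) 
  obtain N where N: "\<And>m n. N \<le> m \<Longrightarrow> N \<le> n \<Longrightarrow> norm (regmat (f m) - regmat (f n)) < e/4"
    using CauchyD[OF red_CauchyD(2)[OF f], of "e/4"] e(1) by auto
  obtain k where k: "N \<le> k" "e \<le> norm (f k (base \<gamma>))" using e(2) by blast
  obtain B S where B: "trivial_piece B S" "\<gamma> \<in> B" using trivial_piece_exists[OF openin_topspace] ga by (metis arrows_def)
  have Bo: "openin (gtop G) B" and Sc: "continuous_map (subtopology (gtop G) B) (gtop \<Sigma>) S"
    using B by (auto simp: trivial_piece_def)
  have SB: "norm (h (S \<beta>)) = norm (h (base \<beta>))" if "\<beta> \<in> B" "h \<in> CcT G T" for \<beta> h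
    using trivial_piece_section[OF B(1) that(1)] trivial_piece_subset[OF B(1)] that
    by (intro contra_norm[OF CcT_contra]) (auto simp: base_closed q_base)
  define V where "V = {\<beta> \<in> topspace (subtopology (gtop G) B). (f k \<circ> S) \<beta> \<in> {z. e/2 < norm z}}"
  have "continuous_map (gtop \<Sigma>) euclidean (f k)" using fC by (simp add: CcT_iff)
  from continuous_map_compose[OF Sc this]
  have "openin (subtopology (gtop G) B) V" unfolding V_def
    by (rule openin_continuous_map_preimage) (simp add: open_Collect_less continuous_intros)
  then have "openin (gtop G) V" using Bo openin_trans_full by blast
  moreover have "\<gamma> \<in> V" using B(2) ga k(2) SB[OF B(2) fC[of k]] e(1) by (simp add: V_def arrows_def)
  moreover have "V \<subseteq> supp f"
  proof
    fix \<beta> assume b: "\<beta> \<in> V"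
    then have ba: "\<beta> \<in> arrows G" "\<beta> \<in> B" by (auto simp: V_def arrows_def)
    have big: "e/2 < norm (f k (base \<beta>))" using b SB[OF ba(2) fC[of k]] by (simp add: V_def)
    have "e/4 \<le> norm (f m (base \<beta>))" if "N \<le> m" for m
    proof -
      have "norm (f k (base \<beta>) - f m (base \<beta>)) \<le> norm (regmat (f k) - regmat (f m))"
        using norm_value_le[OF CcT_diff[OF fC[of k] fC[of m]]] by (simp add: regmat_diff fC)
      also have "\<dots> < e/4" using N[OF k(1) that] .
      finally show ?thesis using big norm_triangle_ineq2[of "f k (base \<beta>)" "f m (base \<beta>)"] by linarith
    qed
    have "\<not> (\<lambda>m. f m (base \<beta>)) \<longlonglongrightarrow> 0"
    proof
      assume "(\<lambda>m. f m (base \<beta>)) \<longlonglongrightarrow> 0"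
      from LIMSEQ_D[OF this, of "e/4"] e(1) obtain M where "\<forall>m\<ge>M. norm (f m (base \<beta>)) < e/4" by auto
      then show False using \<open>\<And>m. N \<le> m \<Longrightarrow> e/4 \<le> norm (f m (base \<beta>))\<close>[of "max M N"] by (simp add: not_less[symmetric])
    qed
    then show "\<beta> \<in> supp f" using ba by (simp add: supp_def)
  qed
  ultimately show ?thesis using that by blast
qed

lemma supp_rng_eq:
  assumes n: "normalising f" and g: "\<gamma>1 \<in> supp f" "\<gamma>2 \<in> supp f" "src G \<gamma>1 = src G \<gamma>2"
  shows "rng G \<gamma>1 = rng G \<gamma>2"
proof -
  have f: "f k \<in> CcT G T" for k using n red_CauchyD(1) by (simp add: normalising_def)
  have a: "\<gamma>1 \<in> arrows G" "\<gamma>2 \<in> arrows G" using g by (auto simp: supp_def)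
  show ?thesis
    by (rule normalising_rng_eq[OF n a src_units[OF a(1)]])
       (use g a entry_base[OF f, of \<gamma>1] entry_base[OF f, of \<gamma>2] in \<open>auto simp: supp_def\<close>)
qed

lemma supp_src_inj:
  assumes eff: "effective G" and n: "normalising f"
    and g: "\<gamma>1 \<in> supp f" "\<gamma>2 \<in> supp f" "src G \<gamma>1 = src G \<gamma>2"
  shows "\<gamma>1 = \<gamma>2"
proof -
  have f: "red_Cauchy G T f" using n by (simp add: normalising_def)
  have a: "\<gamma>1 \<in> arrows G" "\<gamma>2 \<in> arrows G" using g by (auto simp: supp_def)
  obtain V1 where V1: "openin (gtop G) V1" "\<gamma>1 \<in> V1" "V1 \<subseteq> supp f" using supp_open[OF f g(1)] .
  obtain V2 where V2: "openin (gtop G) V2" "\<gamma>2 \<in> V2" "V2 \<subseteq> supp f" using supp_open[OF f g(2)] .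
  obtain B where B: "openin (gtop G) B" "bisection G B" "\<gamma>1 \<in> B" "B \<subseteq> V1"
    using compact_open_bisection[OF V1(1,2)] by metis
  obtain \<beta> where \<beta>: "continuous_map (subtopology (gtop G) (rng G ` B)) (gtop G) \<beta>"
    "\<And>x. x \<in> B \<Longrightarrow> \<beta> (rng G x) = x"
    using bisection_section[OF B(2)] by metis
  have Ba: "B \<subseteq> arrows G" using B(1) openin_subset by (auto simp: arrows_def)
  have ro: "openin (gtop G) (rng G ` B)" by (rule bisection_image_open(1)[OF B(2,1)]) simp
  define O1 where "O1 = {\<delta> \<in> topspace (gtop G). rng G \<delta> \<in> rng G ` B}"
  have O1: "openin (gtop G) O1" unfolding O1_def by (rule openin_continuous_map_preimage[OF continuous_rng ro])
  let ?X = "subtopology (gtop G) O1"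
  have tX: "topspace ?X = O1" by (auto simp: O1_def)
  have O1a: "O1 \<subseteq> arrows G" by (auto simp: O1_def arrows_def)
  have \<beta>O: "\<beta> (rng G \<delta>) \<in> B" "rng G (\<beta> (rng G \<delta>)) = rng G \<delta>" if "\<delta> \<in> O1" for \<delta>
    using that \<beta>(2) by (auto simp: O1_def)
  have "continuous_map ?X (subtopology (gtop G) (rng G ` B)) (rng G)"
    using continuous_map_from_subtopology[OF continuous_rng, of O1]
    by (auto simp: continuous_map_in_subtopology O1_def)
  from continuous_map_compose[OF this \<beta>(1)]
  have c1: "continuous_map ?X (gtop G) (\<lambda>\<delta>. \<beta> (rng G \<delta>))" by (simp add: o_def)
  have id: "continuous_map ?X (gtop G) (\<lambda>\<delta>. \<delta>)" by (simp add: continuous_map_from_subtopology)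
  have c2: "continuous_map ?X (gtop G) (\<lambda>\<delta>. mul G (ginv G \<delta>) (\<beta> (rng G \<delta>)))"
    by (rule continuous_map_mul[OF topological continuous_map_ginv[OF topological id] c1])
       (use \<beta>O O1a in \<open>auto simp: tX\<close>)
  define W where "W = {\<delta> \<in> topspace ?X. mul G (ginv G \<delta>) (\<beta> (rng G \<delta>)) \<in> V2}"
  have "openin ?X W" unfolding W_def by (rule openin_continuous_map_preimage[OF c2 V2(1)])
  then have Wo: "openin (gtop G) W" using O1 openin_trans_full by blast
  have "W \<subseteq> isotropy G"
  proof
    fix \<delta> assume d: "\<delta> \<in> W"
    then have dO: "\<delta> \<in> O1" "\<delta> \<in> arrows G" using O1a by (auto simp: W_def tX)
    let ?b = "\<beta> (rng G \<delta>)"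
    have b: "?b \<in> arrows G" "?b \<in> supp f" "rng G ?b = rng G \<delta>"
      using \<beta>O[OF dO(1)] Ba B(4) V1(3) by auto
    have c: "mul G (ginv G \<delta>) ?b \<in> supp f" using d V2(3) by (auto simp: W_def)
    have "rng G (mul G (ginv G \<delta>) ?b) = rng G ?b"
      by (rule supp_rng_eq[OF n c b(2)]) (use dO b in simp)
    then show "\<delta> \<in> isotropy G" using dO b by (simp add: isotropy_def)
  qed
  then have "W \<subseteq> gtop G interior_of isotropy G" using Wo by (rule interior_of_maximal)
  then have Wu: "W \<subseteq> units G" using eff by (simp add: effective_def)
  let ?d = "mul G \<gamma>1 (ginv G \<gamma>2)"
  have da: "?d \<in> arrows G" "rng G ?d = rng G \<gamma>1" using a g(3) by auto
  have "mul G (ginv G ?d) \<gamma>1 = \<gamma>2" using a g(3) by (simp add: mul_unit_right mul_assoc)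
  then have "?d \<in> W" using da B(3) V2(2) \<beta>(2)[OF B(3)] by (simp add: W_def tX O1_def arrows_def)
  then have "?d \<in> units G" using Wu by blast
  then show ?thesis using mul_ginv_unit_iff[OF a g(3)] by simp
qed

text \<open>Taking adjoints preserves the normalising property and inverts the support, so this is
  \<open>supp_src_inj\<close> for the adjoint.\<close>

lemma supp_rng_inj:
  assumes eff: "effective G" and n: "normalising f"
    and g: "\<gamma>1 \<in> supp f" "\<gamma>2 \<in> supp f" "rng G \<gamma>1 = rng G \<gamma>2"
  shows "\<gamma>1 = \<gamma>2"
proof -
  have f: "red_Cauchy G T f" using n by (simp add: normalising_def)
  have a: "\<gamma>1 \<in> arrows G" "\<gamma>2 \<in> arrows G" using g by (auto simp: supp_def)
  have "ginv G \<gamma>1 = ginv G \<gamma>2"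
    by (rule supp_src_inj[OF eff normalising_adj[OF n]]) (use supp_adj[OF f] a g in auto)
  then show ?thesis using a by (metis ginv_ginv)
qed

lemma base_unit:
  assumes x: "x \<in> units G"
  shows "base x = tincl T (x, 1)"
  using x units_arrows[OF x] by (simp add: base_def rng_tot)

lemma expect0_base: "x \<in> units G \<Longrightarrow> expect0 G T h x = h (base x)"
  by (simp add: expect0_def base_unit)

text \<open>Diagonal entries are bounded by the matrix norm, so a Cauchy sequence has uniformly
  convergent restrictions to the unit space.\<close>

lemma expect_approx:
  assumes f: "red_Cauchy G T f"
  shows "approx (\<lambda>k. expect0 G T (f k)) (expect G T (cls G T f))"
proof -
  have fC: "f k \<in> CcT G T" for k using red_CauchyD[OF f] by blast
  have "uniform_limit (units G) (\<lambda>k. expect0 G T (f k)) (expect G T (cls G T f)) sequentially"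
    unfolding uniform_limit_iff
  proof (intro allI impI)
    fix e :: real assume e: "0 < e"
    obtain N where N: "\<And>m n. N \<le> m \<Longrightarrow> N \<le> n \<Longrightarrow> norm (regmat (f m) - regmat (f n)) < e/2"
      using CauchyD[OF red_CauchyD(2)[OF f], of "e/2"] e by auto
    have "dist (expect0 G T (f k) x) (expect G T (cls G T f) x) < e" if k: "N \<le> k" and x: "x \<in> units G" for k x
    proof -
      have "(\<lambda>m. dist (expect0 G T (f k) x) (expect0 G T (f m) x)) \<longlonglongrightarrow> dist (expect0 G T (f k) x) (expect G T (cls G T f) x)"
        by (intro tendsto_intros expect_cls[OF f x])
      moreover have "\<forall>\<^sub>F m in sequentially. dist (expect0 G T (f k) x) (expect0 G T (f m) x) \<le> e/2"
      proof (rule eventually_sequentiallyI[of N])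
        fix m assume m: "N \<le> m"
        have "dist (expect0 G T (f k) x) (expect0 G T (f m) x) = norm (entry (regmat (f k) - regmat (f m)) x x)"
          using entry_unit[OF fC x] by (simp add: dist_norm entry_simps)
        then show "dist (expect0 G T (f k) x) (expect0 G T (f m) x) \<le> e/2"
          using norm_entry_le[of "regmat (f k) - regmat (f m)" x x] N[OF k m] by simp
      qed
      ultimately have "dist (expect0 G T (f k) x) (expect G T (cls G T f) x) \<le> e/2"
        by (rule tendsto_upperbound) simp
      then show ?thesis using e by simp
    qed
    then show "\<forall>\<^sub>F k in sequentially. \<forall>x\<in>units G. dist (expect0 G T (f k) x) (expect G T (cls G T f) x) < e"
      by (auto simp: eventually_sequentially)
  qed
  then show ?thesis using expect0_Cc[OF fC] by (simp add: approx_def)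
qed

text \<open>Since \<open>u\<close> is given as a uniform limit, level sets are taken for one
  \<open>\<phi> m\<close> within \<open>c/4\<close> of it: where \<open>|u|\<close> is at least
  \<open>c\<close>, \<open>|\<phi> m|\<close> exceeds \<open>c/2\<close>, and where
  \<open>|\<phi> m|\<close> exceeds \<open>c/4\<close>, \<open>u\<close> is not 0. A compact open
  set between these two levels works.\<close>

lemma superlevel_cover:
  assumes a: "approx \<phi> u" and c: "0 < c"
  obtains K where "compact_open K" "\<And>x. x \<in> units G \<Longrightarrow> c \<le> norm (u x) \<Longrightarrow> x \<in> K" "\<And>x. x \<in> K \<Longrightarrow> u x \<noteq> 0"
proof -
  obtain m where m: "\<And>x. x \<in> units G \<Longrightarrow> dist (\<phi> m x) (u x) < c/4"
    using approxD[OF a, of "c/4"] c by (auto simp: eventually_sequentially)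
  have mC: "\<phi> m \<in> Cc (unit_top G)" using a by (simp add: approx_def)
  let ?A = "{x \<in> units G. c/2 \<le> norm (\<phi> m x)}" and ?W = "{x \<in> units G. c/4 < norm (\<phi> m x)}"
  have A: "compactin (gtop G) ?A" using compact_superlevel[OF mC, of "c/2"] c by (simp add: compactin_unit_top)
  have W: "openin (gtop G) ?W" using mC by (intro open_superlevel) (simp add: Cc_def)
  have "?A \<subseteq> ?W" using c by auto
  then obtain K where K: "compactin (gtop G) K" "openin (gtop G) K" "?A \<subseteq> K" "K \<subseteq> ?W"
    by (rule compact_open_between[OF A W])
  show ?thesis
  proof (rule that[of K])
    show "compact_open K" using K by (auto simp: compact_open_def)
    fix x
    {
      assume x: "x \<in> units G" "c \<le> norm (u x)"
      have "norm (u x) \<le> norm (\<phi> m x) + dist (\<phi> m x) (u x)"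
        using norm_triangle_sub[of "u x" "\<phi> m x"] by (simp add: dist_norm norm_minus_commute)
      then show "x \<in> K" using K(3) x m[OF x(1)] c by auto
    }
    assume "x \<in> K"
    then have x: "x \<in> units G" "c/4 < norm (\<phi> m x)" using K(4) by auto
    show "u x \<noteq> 0"
    proof
      assume "u x = 0"
      then show False using m[OF x(1)] x(2) by simp
    qed
  qed
qed

text \<open>Each unit \<open>x\<close> in \<open>K\<close> is itself in the support, so by
  injectivity of range and source on the support no other arrow of it starts or ends at
  \<open>x\<close>. Cutting by \<open>chi K\<close> on either side therefore removes every
  off-diagonal entry in the limit.\<close>

lemma cut_to_expectation:
  assumes eff: "effective G" and n: "normalising f" and K: "compact_open K"
    and nz: "\<And>x. x \<in> K \<Longrightarrow> expect G T (cls G T f) x \<noteq> 0"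
  shows "cmul G T (iota G T (chi K)) (cls G T f) = iota G T (\<lambda>x. chi K x * expect G T (cls G T f) x)" (is ?left)
    and "cmul G T (cls G T f) (iota G T (chi K)) = iota G T (\<lambda>x. chi K x * expect G T (cls G T f) x)" (is ?right)
proof -
  have f: "red_Cauchy G T f" using n by (simp add: normalising_def)
  have fC: "f k \<in> CcT G T" for k using red_CauchyD[OF f] by blast
  define e where "e m x = chi K x * expect0 G T (f m) x" for m x
  have ap: "approx e (\<lambda>x. chi K x * expect G T (cls G T f) x)"
    using approx_chi[OF expect_approx[OF f] K] by (simp add: e_def[abs_def])
  have eC: "e m \<in> Cc (unit_top G)" for m using ap by (simp add: approx_def)
  note pC = iota0_CcT[OF chi_Cc[OF K]]
  have KS: "x \<in> units G" "x \<in> supp f" if "x \<in> K" for x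
  proof -
    show x: "x \<in> units G" using K that by (auto simp: compact_open_def)
    have "\<not> (\<lambda>k. f k (base x)) \<longlonglongrightarrow> 0"
      using expect_cls[OF f x] nz[OF that] LIMSEQ_unique by (simp add: expect0_base[OF x]) blast
    then show "x \<in> supp f" using units_arrows[OF x] by (simp add: supp_def)
  qed
  have off: "(\<lambda>m. entry (regmat (f m)) s t) \<longlonglongrightarrow> 0"
    if st: "s \<noteq> t" "s \<in> arrows G" "t \<in> arrows G" and x: "rng G s \<in> K \<or> rng G t \<in> K" for s t
  proof (cases "src G s = src G t")
    case False
    then show ?thesis by (simp add: entry_regmat[OF fC] kernel_def)
  next
    case True
    let ?g = "mul G s (ginv G t)"
    have g: "?g \<in> arrows G" "rng G ?g = rng G s" "src G ?g = rng G t" using True st by auto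
    have nu: "?g \<notin> units G" using mul_ginv_unit_iff[OF st(2,3) True] st(1) by simp
    have "?g \<notin> supp f"
    proof
      assume gs: "?g \<in> supp f"
      from x show False
      proof
        assume k: "rng G s \<in> K"
        have "?g = rng G s" by (rule supp_rng_inj[OF eff n gs KS(2)[OF k]]) (use g st in simp)
        then show False using nu st by simp
      next
        assume k: "rng G t \<in> K"
        have "?g = rng G t" by (rule supp_src_inj[OF eff n gs KS(2)[OF k]]) (use g st in simp)
        then show False using nu st by simp
      qed
    qed
    then have "(\<lambda>m. f m (base ?g)) \<longlonglongrightarrow> 0" using g by (simp add: supp_def)
    then have "(\<lambda>m. norm (entry (regmat (f m)) s t)) \<longlonglongrightarrow> 0"
      using tendsto_norm_zero norm_kernel[OF fC st(2,3) True] by fastforce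
    then show ?thesis by (rule tendsto_norm_zero_cancel)
  qed
  have diag: "entry (regmat (f m)) s s = expect0 G T (f m) (rng G s)" if "s \<in> arrows G" for m s
    using that by (simp add: entry_regmat[OF fC] kernel_def rng_tot expect0_def)
  have Fc: "Cauchy (\<lambda>m. regmat (f m))" "Cauchy (\<lambda>m. dg (e m))"
    using red_CauchyD(2)[OF f] red_CauchyD(2)[OF approx_Cauchy[OF ap]] by auto
  have z: "(\<lambda>m. dg (chi K) * regmat (f m) - dg (e m)) \<longlonglongrightarrow> 0"
  \<comment> \<open>The off-diagonal entries are only known to tend to 0 one at a time; the Cauchy
    property upgrades this to convergence in norm.\<close>
  proof (rule Cauchy_entries_tendsto_0)
    show "Cauchy (\<lambda>m. dg (chi K) * regmat (f m) - dg (e m))"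
      by (intro Cauchy_diff_seq Cauchy_mult_seq Cauchy_const Fc)
    fix s t
    have ent: "entry (dg (chi K) * regmat (f m) - dg (e m)) s t =
        (if s \<in> arrows G \<and> rng G s \<in> K \<and> s \<noteq> t then entry (regmat (f m)) s t else 0)" for m
      by (auto simp: entry_simps(4) entry_dg_left[OF chi_Cc[OF K]] entry_iota0[OF eC] chi_def e_def diag)
    show "(\<lambda>m. entry (dg (chi K) * regmat (f m) - dg (e m)) s t) \<longlonglongrightarrow> 0"
    proof (cases "s \<in> arrows G \<and> rng G s \<in> K \<and> s \<noteq> t \<and> t \<in> arrows G")
      case True
      then show ?thesis using off[of s t] by (simp add: ent)
    next
      case False
      then have "entry (dg (chi K) * regmat (f m) - dg (e m)) s t = 0" for m
        unfolding ent by (auto simp: entry_regmat[OF fC] kernel_def)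
      then show ?thesis by simp
    qed
  qed
  have "cmul G T (iota G T (chi K)) (cls G T f) = cls G T (\<lambda>m. conv G T (iota0 G T (chi K)) (f m))"
    unfolding iota_chi[OF K] by (rule cmul_cls[OF chi_Cauchy[OF K] f])
  also have "\<dots> = cls G T (\<lambda>m. iota0 G T (e m))"
    using z by (intro cls_eqI) (simp_all add: CcT_conv pC fC iota0_CcT[OF eC] regmat_conv)
  also have "\<dots> = iota G T (\<lambda>x. chi K x * expect G T (cls G T f) x)" by (rule iota_eq[OF ap, symmetric])
  finally show ?left .
  have z: "(\<lambda>m. regmat (f m) * dg (chi K) - dg (e m)) \<longlonglongrightarrow> 0"
  proof (rule Cauchy_entries_tendsto_0)
    show "Cauchy (\<lambda>m. regmat (f m) * dg (chi K) - dg (e m))"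
      by (intro Cauchy_diff_seq Cauchy_mult_seq Cauchy_const Fc)
    fix s t
    have ent: "entry (regmat (f m) * dg (chi K) - dg (e m)) s t =
        (if t \<in> arrows G \<and> rng G t \<in> K \<and> s \<noteq> t then entry (regmat (f m)) s t else 0)" for m
      by (auto simp: entry_simps(4) entry_dg_right[OF chi_Cc[OF K]] entry_iota0[OF eC] chi_def e_def diag)
    show "(\<lambda>m. entry (regmat (f m) * dg (chi K) - dg (e m)) s t) \<longlonglongrightarrow> 0"
    proof (cases "t \<in> arrows G \<and> rng G t \<in> K \<and> s \<noteq> t \<and> s \<in> arrows G")
      case True
      then show ?thesis using off[of s t] by (simp add: ent)
    next
      case False
      then have "entry (regmat (f m) * dg (chi K) - dg (e m)) s t = 0" for m
        unfolding ent by (auto simp: entry_regmat[OF fC] kernel_def)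
      then show ?thesis by simp
    qed
  qed
  have "cmul G T (cls G T f) (iota G T (chi K)) = cls G T (\<lambda>m. conv G T (f m) (iota0 G T (chi K)))"
    unfolding iota_chi[OF K] by (rule cmul_cls[OF f chi_Cauchy[OF K]])
  also have "\<dots> = cls G T (\<lambda>m. iota0 G T (e m))"
    using z by (intro cls_eqI) (simp_all add: CcT_conv pC fC iota0_CcT[OF eC] regmat_conv)
  also have "\<dots> = iota G T (\<lambda>x. chi K x * expect G T (cls G T f) x)" by (rule iota_eq[OF ap, symmetric])
  finally show ?right .
qed

lemma iota_Cred_unit:
  assumes "approx \<phi> u"
  shows "iota G T u \<in> Cred_unit G T"
proof -
  have c: "red_Cauchy G T (\<lambda>k. iota0 G T (\<phi> k))" by (rule approx_Cauchy[OF assms])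
  have "iota0 G T (\<phi> k) \<in> CcT_unit G T" for k using assms by (intro iota0_CcT_unit) (simp add: approx_def)
  then have "\<exists>f\<in>cls G T (\<lambda>k. iota0 G T (\<phi> k)). \<forall>k. f k \<in> CcT_unit G T"
    using cls_self[OF c] by (intro bexI[where x = "\<lambda>k. iota0 G T (\<phi> k)"]) auto
  then show ?thesis unfolding iota_eq[OF assms] Cred_unit_def using cls_Cred[OF c] by simp
qed

theorem effective_projections_cut:
  assumes eff: "effective G" and nn: "normaliser G T n"
  shows "projections_cut_to_expectation G T n"
proof -
  obtain f where f: "red_Cauchy G T f" "n = cls G T f" using nn by (auto simp: normaliser_def Cred_def)
  have n: "normalising f" using normaliser_normalising f nn by blast
  let ?E = "expect G T n"
  have apE: "approx (\<lambda>k. expect0 G T (f k)) ?E" using expect_approx[OF f(1)] f(2) by simp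
  \<comment> \<open>The projections will be the indicators of these sets. The level is
    \<open>1/(k+1)\<close>, so that \<open>k = 0\<close> makes sense too.\<close>
  have "\<exists>K. compact_open K \<and> (\<forall>x\<in>units G. 1 / real (Suc k) \<le> norm (?E x) \<longrightarrow> x \<in> K) \<and> (\<forall>x\<in>K. ?E x \<noteq> 0)" for k
  proof -
    have "0 < 1 / real (Suc k)" by simp
    from superlevel_cover[OF apE this] show ?thesis by metis
  qed
  then obtain K where K: "\<And>k. compact_open (K k)" "\<And>k x. x \<in> units G \<Longrightarrow> 1 / real (Suc k) \<le> norm (?E x) \<Longrightarrow> x \<in> K k"
     "\<And>k x. x \<in> K k \<Longrightarrow> ?E x \<noteq> 0" by metis
  have ap: "approx (\<lambda>m x. chi (K k) x * expect0 G T (f m) x) (\<lambda>x. chi (K k) x * ?E x)" for k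
    by (rule approx_chi[OF apE K(1)])
  have cut: "cmul G T (iota G T (chi (K k))) n = iota G T (\<lambda>x. chi (K k) x * ?E x)"
    "cmul G T n (iota G T (chi (K k))) = iota G T (\<lambda>x. chi (K k) x * ?E x)" for k
    using cut_to_expectation[OF eff n K(1)[of k]] K(3)[of _ k] unfolding f(2) by blast+
  have comm: "(\<lambda>x. ?E x * chi (K k) x) = (\<lambda>x. chi (K k) x * ?E x)" for k by (simp add: mult.commute)
  have "(\<lambda>k. cdist G T (cmul G T (iota G T (chi (K k))) n) (iota G T ?E)) \<longlonglongrightarrow> 0"
  proof (rule Lim_null_comparison[OF always_eventually LIMSEQ_inverse_real_of_nat], rule allI)
    fix k
    let ?d = "\<lambda>m. norm (dg (\<lambda>x. chi (K k) x * expect0 G T (f m) x) - dg (expect0 G T (f m)))"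
    have lim: "?d \<longlonglongrightarrow> cdist G T (cmul G T (iota G T (chi (K k))) n) (iota G T ?E)"
      unfolding cut iota_eq[OF ap] iota_eq[OF apE] by (rule cdist_cls[OF approx_Cauchy[OF ap] approx_Cauchy[OF apE]])
    \<comment> \<open>Off \<open>K k\<close> the expectation has modulus at most
      \<open>1/(k+1)\<close>; the extra \<open>e\<close> absorbs its distance from the approximant
      and is arbitrary.\<close>
    have "cdist G T (cmul G T (iota G T (chi (K k))) n) (iota G T ?E) \<le> 1 / real (Suc k) + e" if e: "0 < e" for e
    proof (rule tendsto_upperbound[OF lim])
      show "\<forall>\<^sub>F m in sequentially. ?d m \<le> 1 / real (Suc k) + e"
        using approxD[OF apE e]
      proof eventually_elim
        case (elim m)
        show ?case
        proof (rule norm_regmat_iota0_diff)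
          show "(\<lambda>x. chi (K k) x * expect0 G T (f m) x) \<in> Cc (unit_top G)" "expect0 G T (f m) \<in> Cc (unit_top G)"
            using ap apE by (simp_all add: approx_def)
          show "0 \<le> 1 / real (Suc k) + e" using e by simp
          fix x assume x: "x \<in> units G"
          show "norm (chi (K k) x * expect0 G T (f m) x - expect0 G T (f m) x) \<le> 1 / real (Suc k) + e"
          proof (cases "x \<in> K k")
            case True
            then show ?thesis using e by (simp add: chi_def)
          next
            case False
            then have "norm (?E x) \<le> 1 / real (Suc k)" using K(2)[OF x, of k] by linarith
            moreover have "norm (expect0 G T (f m) x) \<le> norm (?E x) + dist (expect0 G T (f m) x) (?E x)"
              using norm_triangle_sub[of "expect0 G T (f m) x" "?E x"] by (simp add: dist_norm)
            moreover have "dist (expect0 G T (f m) x) (?E x) < e" using elim x by blast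
            ultimately show ?thesis using False by (simp add: chi_def)
          qed
        qed
      qed
    qed simp
    then have "cdist G T (cmul G T (iota G T (chi (K k))) n) (iota G T ?E) \<le> 1 / real (Suc k)"
      by (rule field_le_epsilon)
    moreover have "0 \<le> cdist G T (cmul G T (iota G T (chi (K k))) n) (iota G T ?E)"
      by (rule tendsto_lowerbound[OF lim]) auto
    ultimately show "norm (cdist G T (cmul G T (iota G T (chi (K k))) n) (iota G T ?E)) \<le> inverse (real (Suc k))"
      by (simp add: inverse_eq_divide)
  qed
  then show ?thesis
    unfolding projections_cut_to_expectation_def
    using chi_projection[OF K(1)] iota_Cred_unit[OF ap]
    by (intro exI[of _ "\<lambda>k. chi (K k)"]) (simp add: cut comm)
qed

end

section \<open>Non-effective groupoids\<close>

lemma geometric_sum_ring: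
  fixes X :: "'c::ring_1"
  shows "(1 - X) * (\<Sum>j<k. X ^ j) = 1 - X ^ k" "(\<Sum>j<k. X ^ j) * (1 - X) = 1 - X ^ k"
proof -
  let ?S = "\<lambda>k. \<Sum>j<k. X ^ j"
  show "(1 - X) * ?S k = 1 - X ^ k"
  proof (induction k)
    case (Suc k)
    have "(1 - X) * ?S (Suc k) = (1 - X) * ?S k + (X ^ k - X * X ^ k)" by (simp add: algebra_simps)
    then show ?case by (simp add: Suc)
  qed simp
  show "?S k * (1 - X) = 1 - X ^ k"
  proof (induction k)
    case (Suc k)
    have "?S (Suc k) * (1 - X) = ?S k * (1 - X) + (X ^ k - X ^ k * X)" by (simp add: algebra_simps)
    then show ?case by (simp add: Suc power_commutes)
  qed simp
qed

lemma commute_power: "(a :: 'c::monoid_mult) * b = b * a \<Longrightarrow> a * b ^ k = b ^ k * a"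
  by (induction k) (simp_all add: mult.assoc, metis mult.assoc)

lemma commute_sum:
  "(\<And>j. j \<in> J \<Longrightarrow> (a :: 'c::semiring_0) * f j = f j * a) \<Longrightarrow> a * sum f J = sum f J * a"
  by (simp add: sum_distrib_left sum_distrib_right)

text \<open>Without completeness \<open>1 - X\<close> need not be invertible for small
  \<open>X\<close>; this lower bound still allows cancelling it from norm estimates.\<close>

lemma norm_one_minus_mult_ge:
  fixes X Y :: "'c::real_normed_algebra_1"
  shows "(1 - norm X) * norm Y \<le> norm ((1 - X) * Y)"
proof -
  have "norm Y \<le> norm ((1 - X) * Y) + norm (X * Y)"
    using norm_triangle_ineq[of "(1 - X) * Y" "X * Y"] by (simp add: left_diff_distrib)
  then show ?thesis using norm_mult_ineq[of X Y] by (simp add: left_diff_distrib)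
qed

lemma power_tendsto_zero:
  fixes X :: "'c::real_normed_algebra_1"
  assumes "norm X < 1"
  shows "(\<lambda>k. X ^ k) \<longlonglongrightarrow> 0"
proof (rule Lim_null_comparison[OF always_eventually])
  show "\<forall>k. norm (X ^ k) \<le> norm X ^ k" by (simp add: norm_power_ineq)
  show "(\<lambda>k. norm X ^ k) \<longlonglongrightarrow> 0" using assms by (simp add: LIMSEQ_power_zero)
qed

text \<open>Multiplication by \<open>1 - X\<close> turns a difference of partial sums into a
  difference of powers, which is small; \<open>norm_one_minus_mult_ge\<close> then removes the
  factor.\<close>

lemma geometric_Cauchy:
  fixes X :: "'c::real_normed_algebra_1"
  assumes "norm X < 1"
  shows "Cauchy (\<lambda>k. \<Sum>j<k. X ^ j)"
proof (rule CauchyI)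
  fix e :: real assume e: "0 < e"
  let ?S = "\<lambda>k. \<Sum>j<k. X ^ j"
  have "0 < (1 - norm X) * e" using e assms by simp
  then obtain M where M: "\<And>m n. M \<le> m \<Longrightarrow> M \<le> n \<Longrightarrow> norm (X ^ m - X ^ n) < (1 - norm X) * e"
    using CauchyD[OF tendsto_zero_Cauchy[OF power_tendsto_zero[OF assms]]] by blast
  have "norm (?S m - ?S n) < e" if "M \<le> m" "M \<le> n" for m n
  proof -
    have "(1 - norm X) * norm (?S m - ?S n) \<le> norm ((1 - X) * (?S m - ?S n))"
      by (rule norm_one_minus_mult_ge)
    also have "(1 - X) * (?S m - ?S n) = X ^ n - X ^ m"
      by (simp only: right_diff_distrib geometric_sum_ring) simp
    also have "norm \<dots> < (1 - norm X) * e" using M that by simp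
    finally show ?thesis using assms by simp
  qed
  then show "\<exists>M. \<forall>m\<ge>M. \<forall>n\<ge>M. norm (?S m - ?S n) < e" by blast
qed

text \<open>The Cayley transform \<open>(1 + X) / (1 - X)\<close> of a skew-adjoint \<open>X\<close> is unitary; here it is truncated and
  cut down by a projection \<open>P\<close> commuting with \<open>X\<close>.\<close>

lemma cayley_identities:
  fixes P X :: "'a bmat"
  assumes P: "star P = P" "P * P = P" and PX: "P * X = X * P" and X: "star X = - X"
  defines "N \<equiv> \<lambda>k. P * ((1 + X) * (\<Sum>j<k. X ^ j))"
  shows "N k * star (N k) = P * ((1 - X ^ k) * (1 - (- X) ^ k))"
    and "star (N k) * N k = P * ((1 - X ^ k) * (1 - (- X) ^ k))"
proof -
  define S where "S = (\<Sum>j<k. X ^ j)"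
  define S' where "S' = (\<Sum>j<k. (- X) ^ j)"
  have star_sum: "star (sum f J) = (\<Sum>j\<in>J. star (f j))" for f :: "nat \<Rightarrow> 'a bmat" and J
    by (induction J rule: infinite_finite_induct) (simp_all add: star_add)
  have "star S = S'" by (simp add: S_def S'_def star_sum star_power X)
  then have sN: "star (N k) = S' * (1 - X) * P"
    by (simp add: N_def S_def[symmetric] star_mult star_add X P)
  let ?A = "1 + X" and ?B = "1 - X" and ?Y = "1 - X ^ k" and ?Y' = "1 - (- X) ^ k"
  have XS: "X * S = S * X" "X * S' = S' * X"
    unfolding S_def S'_def by (intro commute_sum commute_power; simp)+
  have XP: "X * (- X) ^ k = (- X) ^ k * X" by (intro commute_power) simp
  have YY: "?Y * ?Y' = ?Y' * ?Y"
    using commute_power[of "X ^ k" "- X" k] commute_power[of "- X" X k] by (simp add: algebra_simps)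
  have AS: "?A * S = S * ?A" "?A * S' = S' * ?A" using XS by (simp_all add: distrib_left distrib_right)
  have BY: "?Y' * ?B = ?B * ?Y'" using XP by (simp add: algebra_simps)
  have AB: "?B * ?A = ?A * ?B" by (simp add: algebra_simps)
  have AS': "?A * S' = ?Y'" using geometric_sum_ring(1)[of "- X" k] by (simp add: S'_def)
  have BS: "?B * S = ?Y" "S * ?B = ?Y" using geometric_sum_ring[of X k] by (simp_all add: S_def)
  have PS: "P * S' = S' * P" "P * S = S * P"
    unfolding S_def S'_def using PX by (intro commute_sum commute_power; simp)+
  have PA: "P * ?A = ?A * P" "P * ?B = ?B * P" using PX by (simp_all add: distrib_left distrib_right left_diff_distrib right_diff_distrib)
  \<comment> \<open>All factors commute: \<open>S\<close> absorbs \<open>1 - X\<close>, and its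
    adjoint \<open>S'\<close> absorbs \<open>1 + X\<close>, which leaves \<open>1 - X^k\<close> and
    \<open>1 - (-X)^k\<close>.\<close>
  have Z: "?A * S * S' * ?B = ?Y * ?Y'"
  proof -
    have "?A * S * S' * ?B = S * (?A * S') * ?B" by (simp only: AS(1) mult.assoc)
    also have "\<dots> = (S * ?B) * ?Y'" by (simp only: AS' BY mult.assoc)
    finally show ?thesis by (simp only: BS)
  qed
  have Z': "S' * ?B * (?A * S) = ?Y * ?Y'"
  proof -
    have "S' * ?B * (?A * S) = (S' * ?A) * (?B * S)" by (metis AB mult.assoc)
    also have "\<dots> = ?Y' * ?Y" by (simp only: BS(1) AS(2)[symmetric] AS')
    finally show ?thesis by (simp only: YY)
  qed
  have PZ: "P * (?Y * ?Y') = ?Y * ?Y' * P"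
    unfolding Z[symmetric] by (metis PA PS mult.assoc)
  have NN: "N k = P * (?A * S)" by (simp add: N_def S_def)
  have "N k * star (N k) = P * ((?A * S * S' * ?B) * P)" unfolding sN unfolding NN by (simp only: mult.assoc)
  also have "\<dots> = P * (?Y * ?Y')" unfolding Z PZ[symmetric] by (simp only: mult.assoc[symmetric] P(2))
  finally show "N k * star (N k) = P * (?Y * ?Y')" .
  have "star (N k) * N k = S' * ?B * (P * P) * (?A * S)" unfolding sN unfolding NN by (simp only: mult.assoc)
  also have "\<dots> = P * (S' * ?B * (?A * S))" unfolding P(2) by (metis PA(2) PS(1) mult.assoc)
  finally show "star (N k) * N k = P * (?Y * ?Y')" unfolding Z' .
qed

text \<open>Multiplied by \<open>1 - X\<close> the remainder is exactly
  \<open>2X^2 - (1 + X) X^k\<close>. For \<open>k\<close> at least 3 the norm of this is at most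
  2/25 + 6/625, and division by 4/5 gives less than 3/20. That this is below 1/5, twice the entry
  1/10 of \<open>X\<close> met later, is what counts.\<close>

lemma cayley_remainder:
  fixes X :: "'c::real_normed_algebra_1"
  assumes X: "norm X \<le> 1/5" and k: "3 \<le> k"
  shows "norm ((1 + X) * (\<Sum>j<k. X ^ j) - 1 - 2 *\<^sub>R X) \<le> 3/20"
proof -
  let ?R = "(1 + X) * (\<Sum>j<k. X ^ j) - 1 - 2 *\<^sub>R X"
  have "(1 - X) * ((1 + X) * (\<Sum>j<k. X ^ j)) = (1 + X) * ((1 - X) * (\<Sum>j<k. X ^ j))"
    by (simp add: algebra_simps)
  also have "\<dots> = (1 + X) * (1 - X ^ k)" by (simp only: geometric_sum_ring)
  finally have "(1 - X) * ?R = (1 + X) * (1 - X ^ k) - (1 - X) - (1 - X) * (2 *\<^sub>R X)"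
    by (simp only: right_diff_distrib mult_1_right)
  also have "\<dots> = 2 *\<^sub>R (X * X) - (1 + X) * X ^ k"
    by (simp add: algebra_simps scaleR_2)
  finally have R: "(1 - X) * ?R = 2 *\<^sub>R (X * X) - (1 + X) * X ^ k" .
  have "norm (X * X) \<le> norm X * norm X" by (rule norm_mult_ineq)
  also have "\<dots> \<le> 1/5 * (1/5)" by (intro mult_mono X) auto
  finally have 1: "norm (X * X) \<le> 1/25" by simp
  have "norm (X ^ k) \<le> norm X ^ k" by (rule norm_power_ineq)
  also have "\<dots> \<le> (1/5) ^ k" by (intro power_mono X) simp
  also have "\<dots> \<le> (1/5) ^ 3" using k by (intro power_decreasing) auto
  finally have 2: "norm (X ^ k) \<le> 1/125" by (simp add: power3_eq_cube)
  have "norm ((1 + X) * X ^ k) \<le> norm (1 + X) * norm (X ^ k)" by (rule norm_mult_ineq)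
  also have "\<dots> \<le> (6/5) * (1/125)"
    using norm_triangle_ineq[of 1 X] X 2 by (intro mult_mono) auto
  finally have 3: "norm ((1 + X) * X ^ k) \<le> 6/625" by simp
  have "norm (2 *\<^sub>R (X * X) - (1 + X) * X ^ k) \<le> 2 * norm (X * X) + norm ((1 + X) * X ^ k)"
    by (rule order_trans[OF norm_triangle_ineq4]) simp
  then have "norm ((1 - X) * ?R) \<le> 2/25 + 6/625" unfolding R using 1 3 by linarith
  then have "(1 - norm X) * norm ?R \<le> 2/25 + 6/625"
    using norm_one_minus_mult_ge[of X ?R] by linarith
  moreover have "(4/5) * norm ?R \<le> (1 - norm X) * norm ?R" using X by (intro mult_right_mono) auto
  ultimately show ?thesis by simp
qed

lemma C0_chi_mult:
  assumes "u \<in> C0 (unit_top (G :: 'a tgroupoid))" "Hausdorff_space (unit_top G)" "continuous_map (unit_top G) euclidean c"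
    and c: "\<And>x. c x = 0 \<or> c x = 1" and "closedin (unit_top G) {x \<in> topspace (unit_top G). c x = 1}"
  shows "(\<lambda>x. c x * u x) \<in> C0 (unit_top G)"
proof -
  have "compactin (unit_top G) {x \<in> topspace (unit_top G). e \<le> norm (c x * u x)}" if e: "0 < e" for e :: real
  proof -
    have "{x \<in> topspace (unit_top G). e \<le> norm (c x * u x)} =
      {x \<in> topspace (unit_top G). c x = 1} \<inter> {x \<in> topspace (unit_top G). e \<le> norm (u x)}"
    proof (rule set_eqI)
      fix x
      show "x \<in> {x \<in> topspace (unit_top G). e \<le> norm (c x * u x)} \<longleftrightarrow>
        x \<in> {x \<in> topspace (unit_top G). c x = 1} \<inter> {x \<in> topspace (unit_top G). e \<le> norm (u x)}"
        using c[of x] e by auto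
    qed
    moreover have "compactin (unit_top G) ({x \<in> topspace (unit_top G). c x = 1} \<inter>
        {x \<in> topspace (unit_top G). e \<le> norm (u x)})"
      by (rule closed_Int_compactin[OF assms(5)]) (use assms(1) e in \<open>simp add: C0_def\<close>)
    ultimately show ?thesis by simp
  qed
  then show ?thesis using assms continuous_map_complex_mult by (auto simp: C0_def)
qed

context ample_twist
begin

lemma norm_regmat_bisection:
  assumes f: "f \<in> CcT G T" and B: "bisection G B" and off: "\<And>\<sigma>. \<sigma> \<notin> over T B \<Longrightarrow> f \<sigma> = 0"
    and C: "\<And>\<sigma>. norm (f \<sigma>) \<le> C"
  shows "norm (regmat f) \<le> C"
proof -
  have row: "t = t'" if "kernel f s t \<noteq> 0" "kernel f s t' \<noteq> 0" for s t t'
    by (rule kernel_bisection(1)[OF B _ that]) (rule off)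
  have col: "s = s'" if "kernel f s t \<noteq> 0" "kernel f s' t \<noteq> 0" for s s' t
    by (rule kernel_bisection(2)[OF B _ that]) (rule off)
  have C0: "0 \<le> C" using C norm_ge_zero order_trans by blast
  have "mat_bound (kernel f) C"
    by (rule mat_bound_partial_injection[OF C0 _ row col]) (use C C0 in \<open>auto simp: kernel_def\<close>)
  then show ?thesis by (intro norm_bmat_le) (simp add: entry_regmat[OF f])
qed

lemma star_dg_chi: "compact_open K \<Longrightarrow> star (dg (chi K)) = dg (chi K)"
  by (rule bmat_eqI) (auto simp: star.rep_eq entry_iota0 chi_Cc chi_def)

lemma dg_mult: "\<phi> \<in> Cc (unit_top G) \<Longrightarrow> compact_open K \<Longrightarrow> dg (chi K) * dg \<phi> = dg (\<lambda>x. chi K x * \<phi> x)"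
  by (rule bmat_eqI) (auto simp: entry_dg_left[OF chi_Cc] entry_iota0 entry_iota0[OF Cc_mult[OF _ chi_continuous]])

lemma dg_chi_idem: "compact_open K \<Longrightarrow> dg (chi K) * dg (chi K) = dg (chi K)"
  by (rule bmat_eqI) (auto simp: entry_dg_left chi_Cc entry_iota0 chi_def)

text \<open>The entry at \<open>s\<close>, \<open>t\<close> lies over \<open>s t^-1\<close>. If this
  arrow is isotropic, \<open>s\<close> and \<open>t\<close> have equal range, so scaling rows and
  scaling columns by values at ranges agree.\<close>

lemma isotropic_commute:
  assumes f: "f \<in> CcT G T" and off: "\<And>\<sigma>. \<sigma> \<notin> over T (isotropy G) \<Longrightarrow> f \<sigma> = 0" and \<phi>: "\<phi> \<in> Cc (unit_top G)"
  shows "dg \<phi> * regmat f = regmat f * dg \<phi>"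
proof (rule bmat_eqI)
  fix s t
  show "entry (dg \<phi> * regmat f) s t = entry (regmat f * dg \<phi>) s t"
  proof (cases "kernel f s t = 0")
    case True
    then show ?thesis by (simp add: entry_dg_left[OF \<phi>] entry_dg_right[OF \<phi>] entry_regmat[OF f])
  next
    case False
    note st = kernel_fibre[OF False]
    have "mul \<Sigma> (lift T s) (ginv \<Sigma> (lift T t)) \<in> over T (isotropy G)"
      using False off st by (auto simp: kernel_def)
    then have "rng G s = rng G t" using lift_diff(3)[OF st] st by (simp add: over_def isotropy_def)
    then show ?thesis using st by (simp add: entry_dg_left[OF \<phi>] entry_dg_right[OF \<phi>])
  qed
qed


text \<open>The function behind the truncated geometric series. The algebra need not have a unit, so
  \<open>chi K\<close> stands in for the term of degree 0, and the matrix of the sum acquires the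
  factor \<open>dg (chi K)\<close>.\<close>

fun partial_geom :: "'a set \<Rightarrow> ('b \<Rightarrow> complex) \<Rightarrow> nat \<Rightarrow> 'b \<Rightarrow> complex" where
  "partial_geom K f 0 = (\<lambda>_. 0)"
| "partial_geom K f (Suc k) = (\<lambda>\<sigma>. iota0 G T (chi K) \<sigma> + conv G T f (partial_geom K f k) \<sigma>)"

lemma partial_geom:
  assumes f: "f \<in> CcT G T" and K: "compact_open K"
  shows "partial_geom K f k \<in> CcT G T \<and> regmat (partial_geom K f k) = (\<Sum>j<k. regmat f ^ j) * dg (chi K)"
proof (induction k)
  case 0
  then show ?case by (simp add: CcT_zero regmat_zero)
next
  case (Suc k)
  have "(\<Sum>j<Suc k. regmat f ^ j) = 1 + regmat f * (\<Sum>j<k. regmat f ^ j)"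
    by (subst sum.lessThan_Suc_shift) (simp add: sum_distrib_left)
  then show ?case using Suc iota0_CcT[OF chi_Cc[OF K]] f
    by (simp add: CcT_add CcT_conv regmat_add regmat_conv distrib_right mult.assoc)
qed

lemma cls_mult_iota0_eq:
  assumes f: "red_Cauchy G T f" and \<phi>: "approx \<phi> \<beta>" and K: "compact_open K"
    and u: "(\<lambda>x. chi K x * \<beta> x) \<in> C0 (unit_top G)"
    and lim: "(\<lambda>k. regmat (f k) - dg (chi K) * dg (\<phi> k)) \<longlonglongrightarrow> 0"
  shows "cls G T f \<in> iota G T ` C0 (unit_top G)"
proof -
  have \<phi>C: "\<phi> k \<in> Cc (unit_top G)" for k using \<phi> by (simp add: approx_def)
  have ap: "approx (\<lambda>k x. chi K x * \<phi> k x) (\<lambda>x. chi K x * \<beta> x)" by (rule approx_chi[OF \<phi> K])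
  have "cls G T f = cls G T (\<lambda>k. iota0 G T (\<lambda>x. chi K x * \<phi> k x))"
    by (rule cls_eqI) (use red_CauchyD(1)[OF f] ap lim in \<open>simp_all add: approx_def iota0_CcT dg_mult[OF \<phi>C K]\<close>)
  also have "\<dots> = iota G T (\<lambda>x. chi K x * \<beta> x)" by (rule iota_eq[OF ap, symmetric])
  finally show ?thesis using u by blast
qed

text \<open>If \<open>p n\<close> is diagonal, its entry \<open>p(x) n(\<gamma>)\<close> in row
  \<open>\<gamma>\<close> and column \<open>x\<close> vanishes, so \<open>p(x) = 0\<close>. The
  entry of \<open>p n - E(n)\<close> at \<open>x\<close> is then \<open>-E(n)(x)\<close>, of modulus
  at least 1/2 for every such \<open>p\<close>, and the distances cannot tend to 0.\<close>

lemma not_cut_to_expectation: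
  assumes f: "red_Cauchy G T f" and g: "\<gamma> \<in> arrows G" "rng G \<gamma> = x" "src G \<gamma> = x" "\<gamma> \<noteq> x"
    and big: "\<And>k. 3 \<le> k \<Longrightarrow> 1/20 \<le> norm (entry (regmat (f k)) \<gamma> x)" "\<And>k. 3 \<le> k \<Longrightarrow> 1/2 \<le> norm (entry (regmat (f k)) x x)"
  shows "\<not> projections_cut_to_expectation G T (cls G T f)"
proof
  let ?n = "cls G T f"
  let ?E = "expect G T ?n"
  have x: "x \<in> units G" "x \<in> arrows G" using g rng_units units_arrows by auto
  have fC: "f k \<in> CcT G T" for k using red_CauchyD[OF f] by blast
  assume "projections_cut_to_expectation G T ?n"
  then obtain p where p: "\<And>k. 1 \<le> k \<Longrightarrow> projection G (p k)"
    "\<And>k. 1 \<le> k \<Longrightarrow> cmul G T (iota G T (p k)) ?n = iota G T (\<lambda>x. p k x * ?E x)"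
    and lim: "(\<lambda>k. cdist G T (cmul G T (iota G T (p k)) ?n) (iota G T ?E)) \<longlonglongrightarrow> 0"
    unfolding projections_cut_to_expectation_def by blast
  have "1/2 \<le> cdist G T (cmul G T (iota G T (p k)) ?n) (iota G T ?E)" if k: "1 \<le> k" for k
  proof -
    have "p k \<in> C0 (unit_top G)" using p(1)[OF k] by (simp add: projection_def)
    \<comment> \<open>The projection enters products only through approximants
      \<open>\<pi> m\<close>; their values at \<open>x\<close> are what is shown to tend to
      0.\<close>
    then obtain \<pi> where \<pi>: "approx \<pi> (p k)" by (rule C0_approx)
    have \<pi>C: "\<pi> m \<in> Cc (unit_top G)" for m using \<pi> by (simp add: approx_def)
    define h where "h m = conv G T (iota0 G T (\<pi> m)) (f m)" for m
    have hC: "red_Cauchy G T h" unfolding h_def by (rule Cauchy_conv[OF approx_Cauchy[OF \<pi>] f])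
    have Mh: "regmat (h m) = dg (\<pi> m) * regmat (f m)" for m by (simp add: h_def regmat_conv iota0_CcT[OF \<pi>C] fC)
    have L: "cmul G T (iota G T (p k)) ?n = cls G T h"
      unfolding iota_eq[OF \<pi>] h_def by (rule cmul_cls[OF approx_Cauchy[OF \<pi>] f])
    have "h \<in> iota G T (\<lambda>x. p k x * ?E x)" using cls_self[OF hC] L p(2)[OF k] by simp
    then obtain \<phi> where \<phi>: "approx \<phi> (\<lambda>x. p k x * ?E x)" unfolding iota_def approx_def by blast
    have \<phi>C: "\<phi> m \<in> Cc (unit_top G)" for m using \<phi> by (simp add: approx_def)
    have "(\<lambda>m. regmat (h m) - dg (\<phi> m)) \<longlonglongrightarrow> 0"
      by (rule cls_eqD[OF hC]) (use L p(2)[OF k] iota_eq[OF \<phi>] iota0_CcT[OF \<phi>C] in auto)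
    from tendsto_entry[OF this, of \<gamma> x]
    have "(\<lambda>m. \<pi> m x * entry (regmat (f m)) \<gamma> x) \<longlonglongrightarrow> 0"
      using g by (simp add: entry_simps(1,4) Mh entry_dg_left[OF \<pi>C] entry_iota0[OF \<phi>C])
    \<comment> \<open>The factor 20 undoes the lower bound 1/20 on the entry at
      \<open>\<gamma>\<close>.\<close>
    then have "(\<lambda>m. 20 * norm (\<pi> m x * entry (regmat (f m)) \<gamma> x)) \<longlonglongrightarrow> 20 * 0"
      by (intro tendsto_mult tendsto_const tendsto_norm_zero)
    then have *: "(\<lambda>m. 20 * norm (\<pi> m x * entry (regmat (f m)) \<gamma> x)) \<longlonglongrightarrow> 0" by simp
    have \<pi>0: "(\<lambda>m. \<pi> m x) \<longlonglongrightarrow> 0"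
    proof (rule Lim_null_comparison[OF _ *], rule eventually_sequentiallyI[of 3])
      fix m :: nat assume "3 \<le> m"
      then have "norm (\<pi> m x) * (1/20) \<le> norm (\<pi> m x) * norm (entry (regmat (f m)) \<gamma> x)"
        by (intro mult_left_mono big(1)) auto
      then show "norm (\<pi> m x) \<le> 20 * norm (\<pi> m x * entry (regmat (f m)) \<gamma> x)" by (simp add: norm_mult)
    qed
    have apE: "approx (\<lambda>m. expect0 G T (f m)) ?E" by (rule expect_approx[OF f])
    have eC: "expect0 G T (f m) \<in> Cc (unit_top G)" for m using apE by (simp add: approx_def)
    have cd: "(\<lambda>m. norm (regmat (h m) - dg (expect0 G T (f m)))) \<longlonglongrightarrow> cdist G T (cls G T h) (iota G T ?E)"
      unfolding iota_eq[OF apE] by (rule cdist_cls[OF hC approx_Cauchy[OF apE]])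
    have lb: "(\<lambda>m. norm (\<pi> m x - 1) * (1/2)) \<longlonglongrightarrow> norm (0 - 1 :: complex) * (1/2)"
      by (intro tendsto_intros \<pi>0)
    have "norm (0 - 1 :: complex) * (1/2) \<le> cdist G T (cls G T h) (iota G T ?E)"
    proof (rule LIMSEQ_le[OF lb cd], intro exI[of _ 3] allI impI)
      fix m :: nat assume m: "3 \<le> m"
      have "entry (regmat (h m) - dg (expect0 G T (f m))) x x = (\<pi> m x - 1) * entry (regmat (f m)) x x"
        using x entry_unit[OF fC x(1)]
        by (simp add: entry_simps(4) Mh entry_dg_left[OF \<pi>C] entry_iota0[OF eC] left_diff_distrib)
      then have "norm (\<pi> m x - 1) * norm (entry (regmat (f m)) x x) \<le> norm (regmat (h m) - dg (expect0 G T (f m)))"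
        using norm_entry_le[of "regmat (h m) - dg (expect0 G T (f m))" x x] by (simp add: norm_mult)
      moreover have "norm (\<pi> m x - 1) * (1/2) \<le> norm (\<pi> m x - 1) * norm (entry (regmat (f m)) x x)"
        by (intro mult_left_mono big(2)[OF m]) simp
      ultimately show "norm (\<pi> m x - 1) * (1/2) \<le> norm (regmat (h m) - dg (expect0 G T (f m)))" by linarith
    qed
    then show ?thesis by (simp add: L)
  qed
  then have "\<forall>\<^sub>F k in sequentially. 1/2 \<le> cdist G T (cmul G T (iota G T (p k)) ?n) (iota G T ?E)"
    by (rule eventually_sequentiallyI)
  from tendsto_lowerbound[OF lim this] show False by simp
qed

lemma cayley_counterexample:
  assumes B: "compactin (gtop G) B" "openin (gtop G) B" "bisection G B" "B \<subseteq> isotropy G" "B \<inter> units G = {}"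
    and g: "\<gamma> \<in> B" and v: "v \<in> CcT G T" and off: "\<And>\<sigma>. \<sigma> \<notin> over T B \<Longrightarrow> v \<sigma> = 0" and v1: "\<And>\<sigma>. norm (v \<sigma>) \<le> 1"
    and big: "1 \<le> norm (v (base \<gamma>) - adj T v (base \<gamma>))"
  shows "\<exists>n. normaliser G T n \<and> \<not> projections_cut_to_expectation G T n"
proof -
  \<comment> \<open>As \<open>B\<close> is isotropic, \<open>K\<close> is also its source image and
    contains the source of \<open>\<gamma>\<close>; the indicator \<open>P\<close> of
    \<open>K\<close> will play the part of the unit.\<close>
  define K where "K = rng G ` B"
  have Ba: "B \<subseteq> arrows G" using openin_subset[OF B(2)] by (simp add: arrows_def)
  have K: "compact_open K" unfolding compact_open_def K_def
    using image_compactin[OF B(1) continuous_rng] bisection_image_open(1)[OF B(3,2)] Ba by auto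
  \<comment> \<open>The matrices of \<open>v\<close> and of its adjoint have norm at most 1, so the
    factor 1/10 makes the norm of \<open>X\<close> at most 1/5, as \<open>cayley_remainder\<close>
    requires.\<close>
  define w where "w \<sigma> = complex_of_real (1/10) * (v \<sigma> - adj T v \<sigma>)" for \<sigma>
  have wC: "w \<in> CcT G T" unfolding w_def by (intro CcT_scale CcT_diff v CcT_adj)
  define X where "X = regmat w"
  have X: "X = (1/10) *\<^sub>R (regmat v - star (regmat v))"
    unfolding X_def w_def by (subst regmat_scale) (simp_all add: CcT_diff v CcT_adj regmat_diff regmat_adj)
  have wz: "q \<sigma> \<in> B \<or> ginv G (q \<sigma>) \<in> B" "\<sigma> \<in> arrows \<Sigma>" if "w \<sigma> \<noteq> 0" for \<sigma>
  proof -
    show s: "\<sigma> \<in> arrows \<Sigma>" using CcT_off[OF wC] that by blast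
    have "v \<sigma> \<noteq> 0 \<or> v (ginv \<Sigma> \<sigma>) \<noteq> 0" using that s by (auto simp: w_def adj_def)
    then have "\<sigma> \<in> over T B \<or> ginv \<Sigma> \<sigma> \<in> over T B" using off by blast
    then show "q \<sigma> \<in> B \<or> ginv G (q \<sigma>) \<in> B" using s by (auto simp: over_def)
  qed
  have wo: "\<sigma> \<in> over T (isotropy G)" "q \<sigma> \<notin> units G" if "w \<sigma> \<noteq> 0" for \<sigma>
  proof -
    have s: "\<sigma> \<in> arrows \<Sigma>" "q \<sigma> \<in> arrows G" using wz[OF that] by auto
    from wz(1)[OF that] have "q \<sigma> \<in> isotropy G \<and> q \<sigma> \<notin> units G"
    proof
      assume "q \<sigma> \<in> B"
      then show ?thesis using B(4,5) by blast
    next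
      assume b: "ginv G (q \<sigma>) \<in> B"
      then have "ginv G (q \<sigma>) \<in> isotropy G" using B(4) by blast
      then have "q \<sigma> \<in> isotropy G" using s by (simp add: isotropy_def)
      moreover have "q \<sigma> \<notin> units G" using b B(5) by (metis disjoint_iff ginv_unit)
      ultimately show ?thesis by blast
    qed
    then show "\<sigma> \<in> over T (isotropy G)" "q \<sigma> \<notin> units G" using s by (auto simp: over_def)
  qed
  define P where "P = dg (chi K)"
  have sX: "star X = - X" unfolding X by (simp add: star_scaleR star_diff scaleR_diff_right)
  have dX: "dg \<phi> * X = X * dg \<phi>" if "\<phi> \<in> Cc (unit_top G)" for \<phi>
    unfolding X_def using wo(1) that by (intro isotropic_commute wC) blast
  have PX: "P * X = X * P" unfolding P_def by (rule dX[OF chi_Cc[OF K]])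
  have sP: "star P = P" and PP: "P * P = P" unfolding P_def by (rule star_dg_chi[OF K], rule dg_chi_idem[OF K])
  have "norm (regmat v) \<le> 1" by (rule norm_regmat_bisection[OF v B(3) off v1])
  then have Xn: "norm X \<le> 1/5" unfolding X
    using norm_triangle_ineq4[of "regmat v" "star (regmat v)"] by simp
  define S where "S k = (\<Sum>j<k. X ^ j)" for k
  \<comment> \<open>Its matrix is \<open>P (1 + X)\<close> times the truncated series for the
    inverse of \<open>1 - X\<close>.\<close>
  define f where "f k = conv G T (\<lambda>\<sigma>. iota0 G T (chi K) \<sigma> + w \<sigma>) (partial_geom K w k)" for k
  have iC: "iota0 G T (chi K) \<in> CcT G T" by (rule iota0_CcT[OF chi_Cc[OF K]])
  have fC: "f k \<in> CcT G T" for k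
    unfolding f_def using partial_geom[OF wC K] by (intro CcT_conv CcT_add iC wC) auto
  have PS: "P * S k = S k * P" for k unfolding S_def using PX by (intro commute_sum commute_power)
  have F: "regmat (f k) = P * ((1 + X) * S k)" for k
  proof -
    have "regmat (f k) = (P + X) * (S k * P)"
      unfolding f_def using partial_geom[OF wC K, of k] iC wC
      by (simp add: regmat_conv CcT_add regmat_add P_def X_def S_def)
    also have "\<dots> = (P + X) * P * S k" by (simp only: PS[symmetric] mult.assoc)
    also have "(P + X) * P = P * (1 + X)" using PX PP by (simp add: distrib_left distrib_right)
    finally show ?thesis by (simp only: mult.assoc)
  qed
  have fc: "red_Cauchy G T f" unfolding red_Cauchy_iff F
    using Xn by (auto intro!: fC Cauchy_mult_seq Cauchy_const simp: S_def intro: geometric_Cauchy)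
  define Z where "Z k = (1 - X ^ k) * (1 - (- X) ^ k)" for k
  \<comment> \<open>Since \<open>Z k - 1\<close> is null, both products tend to \<open>P\<close>:
    the limit is unitary on the corner cut out by \<open>P\<close>.\<close>
  have NN: "regmat (f k) * star (regmat (f k)) = P * Z k" "star (regmat (f k)) * regmat (f k) = P * Z k" for k
    unfolding F S_def Z_def using cayley_identities[OF sP PP PX sX, of k] by auto
  have "Z \<longlonglongrightarrow> (1 - 0) * (1 - 0)"
  proof -
    have "norm X < 1" using Xn by simp
    then show ?thesis unfolding Z_def
      by (intro tendsto_mult tendsto_diff tendsto_const power_tendsto_zero) simp_all
  qed
  then have Z0: "(\<lambda>k. Z k - 1) \<longlonglongrightarrow> 0" by (simp add: LIM_zero)
  have Kclosed: "closedin (unit_top G) {x \<in> topspace (unit_top G). chi K x = 1}"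
  proof -
    have "{x \<in> topspace (unit_top G). chi K x = 1} = K" using K by (auto simp: chi_def compact_open_def)
    moreover have "compactin (unit_top G) K" using K by (simp add: compact_open_def compactin_unit_top)
    ultimately show ?thesis using compactin_imp_closedin[OF Hausdorff_unit_top] by simp
  qed
  have "normaliser G T (cls G T f)" unfolding normaliser_def
  proof (intro conjI ballI cls_Cred fc)
    fix b assume "b \<in> iota G T ` C0 (unit_top G)"
    then obtain \<beta> where \<beta>: "\<beta> \<in> C0 (unit_top G)" "b = iota G T \<beta>" by auto
    obtain \<phi> where \<phi>: "approx \<phi> \<beta>" using C0_approx[OF \<beta>(1)] .
    have \<phi>C: "\<phi> k \<in> Cc (unit_top G)" for k using \<phi> by (simp add: approx_def)
    note ic = approx_Cauchy[OF \<phi>] and fa = Cauchy_adj[OF fc]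
    have b: "b = cls G T (\<lambda>k. iota0 G T (\<phi> k))" using \<beta>(2) iota_eq[OF \<phi>] by simp
    have u: "(\<lambda>x. chi K x * \<beta> x) \<in> C0 (unit_top G)"
      by (rule C0_chi_mult[OF \<beta>(1) Hausdorff_unit_top chi_continuous[OF K] _ Kclosed]) (simp add: chi_def)
    have dP: "dg (\<phi> k) * P = P * dg (\<phi> k)" for k
      unfolding P_def by (rule bmat_eqI) (simp add: entry_dg_left[OF \<phi>C] entry_dg_right[OF \<phi>C] entry_iota0[OF chi_Cc[OF K]])
    have dS: "dg (\<phi> k) * S k = S k * dg (\<phi> k)" for k
      unfolding S_def using dX[OF \<phi>C] by (intro commute_sum commute_power)
    \<comment> \<open>The matrices commute with those of functions on the unit space, so both
      conjugates of \<open>b\<close> reduce to the product of \<open>b\<close> with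
      \<open>P\<close>, again a function on the unit space.\<close>
    have dF: "dg (\<phi> k) * regmat (f k) = regmat (f k) * dg (\<phi> k)" for k
    proof -
      have "dg (\<phi> k) * (1 + X) = (1 + X) * dg (\<phi> k)" using dX[OF \<phi>C] by (simp add: distrib_left distrib_right)
      then show ?thesis unfolding F by (metis dP dS mult.assoc)
    qed
    have "(\<lambda>k. (dg (\<phi> k) * P) * (Z k - 1)) \<longlonglongrightarrow> 0"
      by (intro Cauchy_mult_null(1) Cauchy_mult_seq Cauchy_const red_CauchyD(2)[OF ic] Z0)
    then have lim: "(\<lambda>k. dg (\<phi> k) * (P * Z k) - P * dg (\<phi> k)) \<longlonglongrightarrow> 0"
      by (simp add: right_diff_distrib mult.assoc dP[symmetric])
    have 1: "red_Cauchy G T (\<lambda>k. conv G T (conv G T (f k) (iota0 G T (\<phi> k))) (adj T (f k)))"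
      by (intro Cauchy_conv fc ic fa)
    have "regmat (conv G T (conv G T (f k) (iota0 G T (\<phi> k))) (adj T (f k))) = dg (\<phi> k) * (P * Z k)" for k
      by (simp add: regmat_conv CcT_conv CcT_adj regmat_adj fC iota0_CcT[OF \<phi>C] dF[symmetric] mult.assoc NN(1))
    then have "cls G T (\<lambda>k. conv G T (conv G T (f k) (iota0 G T (\<phi> k))) (adj T (f k))) \<in> iota G T ` C0 (unit_top G)"
      using lim by (intro cls_mult_iota0_eq[OF 1 \<phi> K u]) (simp add: P_def)
    then show "cmul G T (cmul G T (cls G T f) b) (cadj G T (cls G T f)) \<in> iota G T ` C0 (unit_top G)"
      unfolding b cadj_cls[OF fc] cmul_cls[OF fc ic] cmul_cls[OF Cauchy_conv[OF fc ic] fa] .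
    have 2: "red_Cauchy G T (\<lambda>k. conv G T (conv G T (adj T (f k)) (iota0 G T (\<phi> k))) (f k))"
      by (intro Cauchy_conv fc ic fa)
    have "regmat (conv G T (conv G T (adj T (f k)) (iota0 G T (\<phi> k))) (f k)) = (P * Z k) * dg (\<phi> k)" for k
      by (simp add: regmat_conv CcT_conv CcT_adj regmat_adj fC iota0_CcT[OF \<phi>C] dF mult.assoc flip: NN(2))
    moreover have "(P * Z k) * dg (\<phi> k) = dg (\<phi> k) * (P * Z k)" for k
    proof -
      have "dg (\<phi> k) * (1 - X ^ k) = (1 - X ^ k) * dg (\<phi> k)" "dg (\<phi> k) * (1 - (- X) ^ k) = (1 - (- X) ^ k) * dg (\<phi> k)"
        using commute_power[OF dX[OF \<phi>C], of k k] commute_power[of "dg (\<phi> k)" "- X" k] dX[OF \<phi>C, of k]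
        by (simp_all add: left_diff_distrib right_diff_distrib)
      then show ?thesis unfolding Z_def by (metis dP mult.assoc)
    qed
    ultimately have "cls G T (\<lambda>k. conv G T (conv G T (adj T (f k)) (iota0 G T (\<phi> k))) (f k)) \<in> iota G T ` C0 (unit_top G)"
      using lim by (intro cls_mult_iota0_eq[OF 2 \<phi> K u]) (simp add: P_def)
    then show "cmul G T (cmul G T (cadj G T (cls G T f)) b) (cls G T f) \<in> iota G T ` C0 (unit_top G)"
      unfolding b cadj_cls[OF fc] cmul_cls[OF fa ic] cmul_cls[OF Cauchy_conv[OF fa ic] fc] .
  qed
  moreover have "\<not> projections_cut_to_expectation G T (cls G T f)"
  proof -
    have ga: "\<gamma> \<in> arrows G" "rng G \<gamma> = src G \<gamma>" "rng G \<gamma> \<in> K" using g Ba B(4) by (auto simp: isotropy_def K_def)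
    define x where "x = src G \<gamma>"
    have x': "x \<in> units G" "x \<in> arrows G" "x \<in> K" using ga by (simp_all add: x_def)
    have x: "x \<in> units G" "x \<in> arrows G" "x \<in> K" "\<gamma> \<noteq> x" using x' g B(5) by blast+
    define R where "R k = (1 + X) * S k - 1 - 2 *\<^sub>R X" for k
    have Rn: "norm (R k) \<le> 3/20" if "3 \<le> k" for k
      unfolding R_def S_def by (rule cayley_remainder[OF Xn that])
    \<comment> \<open>The Cayley transform is \<open>1 + 2X\<close> up to \<open>R\<close>, and rows
      with range in \<open>K\<close> are not affected by \<open>P\<close>.\<close>
    have ent: "entry (regmat (f k)) s x = (if s = x then 1 else 0) + 2 * entry X s x + entry (R k) s x"
      if "s \<in> arrows G" "rng G s \<in> K" for s k
    proof -
      have "(1 + X) * S k = 1 + 2 *\<^sub>R X + R k" by (simp add: R_def)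
      then show ?thesis unfolding F P_def
        using that by (simp add: entry_dg_left[OF chi_Cc[OF K]] chi_def entry_simps(2,3,7))
    qed
    have "norm (entry X \<gamma> x) = norm (w (base \<gamma>))" unfolding X_def x_def using entry_base[OF wC ga(1)] by simp
    also have "\<dots> = 1/10 * norm (v (base \<gamma>) - adj T v (base \<gamma>))" by (simp add: w_def norm_mult norm_divide)
    finally have Xg: "1/10 \<le> norm (entry X \<gamma> x)" using big by simp
    \<comment> \<open>Neither \<open>B\<close> nor its inverse contains a unit, so \<open>X\<close>
      has diagonal entry 0 at \<open>x\<close> and the entry of the transform there stays near
      1.\<close>
    have "w (base x) = 0" using wo(2)[of "base x"] x q_base by auto
    then have Xx: "entry X x x = 0" using entry_base[OF wC x(2)] x(1) by (simp add: X_def)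
    show ?thesis
    proof (rule not_cut_to_expectation[OF fc ga(1)])
      show "rng G \<gamma> = x" "src G \<gamma> = x" "\<gamma> \<noteq> x" using ga x by (auto simp: x_def)
      fix k :: nat assume k: "3 \<le> k"
      have "norm (entry (R k) s x) \<le> 3/20" for s using norm_entry_le[of "R k" s x] Rn[OF k] by linarith
      note r = this
      \<comment> \<open>At \<open>\<gamma>\<close>, twice 1/10 from \<open>X\<close> against 3/20
        from the remainder leaves 1/20; at the unit, 1 against 3/20 leaves more than 1/2.\<close>
      have "norm (2 * entry X \<gamma> x) \<le> norm (entry (regmat (f k)) \<gamma> x) + norm (entry (R k) \<gamma> x)"
        using ent[OF ga(1,3), of k] x(4) norm_triangle_ineq4[of "entry (regmat (f k)) \<gamma> x" "entry (R k) \<gamma> x"] by simp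
      then show "1/20 \<le> norm (entry (regmat (f k)) \<gamma> x)" using r[of \<gamma>] Xg by (simp add: norm_mult)
      have "norm (1 :: complex) \<le> norm (entry (regmat (f k)) x x) + norm (entry (R k) x x)"
        using ent[of x k] x Xx norm_triangle_ineq4[of "entry (regmat (f k)) x x" "entry (R k) x x"] by simp
      then show "1/2 \<le> norm (entry (regmat (f k)) x x)" using r[of x] by simp
    qed
  qed
  ultimately show ?thesis by blast
qed

end

section \<open>The trivial twist\<close>

definition trivial_twist :: "'a tgroupoid \<Rightarrow> ('a, 'a \<times> complex) twist" where
  "trivial_twist G =
     \<lparr> total = \<lparr> gtop = prod_topology (gtop G) (top_of_set circle),
         src = (\<lambda>(x, z). (src G x, 1)), rng = (\<lambda>(x, z). (rng G x, 1)),
         mul = (\<lambda>(x, z) (y, w). (mul G x y, z * w)), ginv = (\<lambda>(x, z). (ginv G x, cnj z)) \<rparr>,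
       tincl = (\<lambda>p. p), tproj = fst \<rparr>"

lemma image_Times_circle:
  fixes F :: "'c \<times> complex \<Rightarrow> 'd \<times> complex"
  assumes "\<And>x z. x \<in> A \<Longrightarrow> z \<in> circle \<Longrightarrow> F (x, z) = (f x, 1)"
  shows "F ` (A \<times> circle) = f ` A \<times> {1}"
proof (intro equalityI subsetI)
  fix p assume "p \<in> f ` A \<times> {1 :: complex}"
  then obtain a where "a \<in> A" "p = (f a, 1)" by auto
  then show "p \<in> F ` (A \<times> circle)" using assms[of a 1] by (intro rev_image_eqI[of "(a, 1)"]) auto
qed (use assms in auto)

context ample_groupoid
begin

abbreviation "H \<equiv> total (trivial_twist G)"

lemma trivial_simps [simp]:
  "gtop H = prod_topology (gtop G) (top_of_set circle)"
  "src H (x, z) = (src G x, 1)" "rng H (x, z) = (rng G x, 1)" "mul H (x, z) (y, w) = (mul G x y, z * w)"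
  "ginv H (x, z) = (ginv G x, cnj z)" "tincl (trivial_twist G) = (\<lambda>p. p)" "tproj (trivial_twist G) = fst"
  by (simp_all add: trivial_twist_def)

lemma arrows_H: "arrows H = arrows G \<times> circle"
  by (simp add: arrows_def)

lemma circle_inv: "cmod z = 1 \<Longrightarrow> cnj z * z = 1"
  using circle_mult_cnj by simp

lemma is_groupoid_H: "is_groupoid H"
  unfolding is_groupoid_def composable_def arrows_H
  by (intro conjI ballI allI impI) (auto simp: circle_inv norm_mult mul_assoc)

lemma units_H: "units H = units G \<times> {1}"
proof -
  have "units H = src H ` (arrows G \<times> circle)" by (simp add: units_def arrows_H)
  also have "\<dots> = (src G ` arrows G) \<times> {1}" by (rule image_Times_circle) simp
  finally show ?thesis by (simp only: units_def[of G])
qed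

lemma continuous_into_circle:
  assumes "continuous_map X euclidean f" "\<And>x. x \<in> topspace X \<Longrightarrow> f x \<in> circle"
  shows "continuous_map X (top_of_set circle) f"
  using assms by (auto simp: continuous_map_in_subtopology)

lemma continuous_snd_complex: "continuous_map (gtop H) euclidean snd"
  using continuous_map_snd[of "gtop G" "top_of_set circle"] by (simp add: continuous_map_in_subtopology)

lemma topological_H: "topological_groupoid H"
  unfolding topological_groupoid_def
proof (intro conjI is_groupoid_H)
  let ?P = "subtopology (prod_topology (gtop H) (gtop H)) (composable H)"
  have 1: "continuous_map ?P (gtop H) fst" and 2: "continuous_map ?P (gtop H) snd"
    by (intro continuous_map_from_subtopology continuous_map_fst continuous_map_snd)+
  have f: "continuous_map (gtop H) (gtop G) fst" by (simp add: continuous_map_fst)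
  have f1: "continuous_map ?P (gtop G) (\<lambda>p. fst (fst p))" "continuous_map ?P (gtop G) (\<lambda>p. fst (snd p))"
    using continuous_map_compose[OF 1 f] continuous_map_compose[OF 2 f] by (simp_all only: o_def)
  have s1: "continuous_map ?P euclidean (\<lambda>p. snd (fst p))" "continuous_map ?P euclidean (\<lambda>p. snd (snd p))"
    using continuous_map_compose[OF 1 continuous_snd_complex] continuous_map_compose[OF 2 continuous_snd_complex]
    by (simp_all only: o_def)
  have cm: "src G (fst (fst p)) = rng G (fst (snd p)) \<and> snd (fst p) \<in> circle \<and> snd (snd p) \<in> circle"
    if "p \<in> topspace ?P" for p
    using that by (auto simp: composable_def arrows_H)
  have "continuous_map ?P (prod_topology (gtop G) (top_of_set circle))
      (\<lambda>p. (mul G (fst (fst p)) (fst (snd p)), snd (fst p) * snd (snd p)))"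
    by (intro continuous_map_pairedI continuous_map_mul[OF topological f1] continuous_into_circle
        continuous_map_complex_mult s1) (use cm circle_mult in blast)+
  then have "continuous_map ?P (gtop H) (\<lambda>p. (mul G (fst (fst p)) (fst (snd p)), snd (fst p) * snd (snd p)))"
    by (simp only: trivial_simps(1))
  then show "continuous_map ?P (gtop H) (\<lambda>(x, y). mul H x y)"
    by (rule continuous_map_eq) auto
  have "continuous_map (gtop H) (gtop H) (\<lambda>p. (ginv G (fst p), cnj (snd p)))"
    unfolding trivial_simps(1)
    by (intro continuous_map_pairedI continuous_map_ginv[OF topological] continuous_map_fst
        continuous_into_circle continuous_map_complex_cnj continuous_snd_complex[unfolded trivial_simps(1)]) auto
  then show "continuous_map (gtop H) (gtop H) (ginv H)"
    by (rule continuous_map_eq) auto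
  show "Hausdorff_space (unit_top H)" unfolding unit_top_def trivial_simps(1)
    using Hausdorff by (intro Hausdorff_space_subtopology) (simp add: Hausdorff_space_prod_topology Hausdorff_space_subtopology)
qed

lemma subtopology_over:
  "subtopology (gtop H) (over (trivial_twist G) U) = prod_topology (subtopology (gtop G) U) (top_of_set circle)"
proof -
  have "over (trivial_twist G) U = (arrows G \<inter> U) \<times> circle" by (auto simp: over_def arrows_H)
  moreover have "subtopology (gtop G) (arrows G \<inter> U) = subtopology (gtop G) U"
    by (simp add: arrows_def subtopology_restrict)
  ultimately show ?thesis by (simp add: subtopology_Times subtopology_subtopology)
qed

text \<open>The global section \<open>\<beta> \<mapsto> (\<beta>, 1)\<close> makes every chart the
  identity map, so local triviality reduces to \<open>subtopology_over\<close>.\<close>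

lemma is_twist_trivial: "is_twist G (trivial_twist G)"
  unfolding is_twist_def
proof (intro conjI ballI)
  note cb = is_groupoid_circle_bundle[OF is_groupoid]
  have ua: "units G \<subseteq> arrows G" using units_arrows by blast
  show "topological_groupoid H" by (rule topological_H)
  show "Hausdorff_space (gtop H)"
    using Hausdorff by (simp add: Hausdorff_space_prod_topology Hausdorff_space_subtopology)
  show "units H = tincl (trivial_twist G) ` (units G \<times> {1})" by (simp add: units_H)
  show "groupoid_hom (circle_bundle G) H (tincl (trivial_twist G))"
    unfolding groupoid_hom_def composable_def cb arrows_H
    using ua by (auto simp: circle_bundle_def mul_unit_right units_arrows)
  have gcb: "gtop (circle_bundle G) = prod_topology (unit_top G) (top_of_set circle)" by (simp add: circle_bundle_def)
  show "continuous_map (gtop (circle_bundle G)) (gtop H) (tincl (trivial_twist G))"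
  proof -
    have "continuous_map (gtop (circle_bundle G)) (gtop H) (\<lambda>p. (fst p, snd p))"
      unfolding gcb trivial_simps(1)
      by (intro continuous_map_pairedI continuous_map_snd)
         (use continuous_map_fst[of "unit_top G" "top_of_set circle"] in \<open>simp add: unit_top_def continuous_map_in_subtopology\<close>)
    then show ?thesis by simp
  qed
  have ucb: "units (circle_bundle G) = units G \<times> {1}"
  proof -
    have "units (circle_bundle G) = src (circle_bundle G) ` (units G \<times> circle)" by (simp add: units_def[of "circle_bundle G"] cb)
    also have "\<dots> = (\<lambda>x. x) ` units G \<times> {1}" by (rule image_Times_circle) (simp add: circle_bundle_def)
    finally show ?thesis by simp
  qed
  have "unit_top (circle_bundle G) = unit_top H"
  proof -
    have "gtop (circle_bundle G) = subtopology (gtop H) (units G \<times> circle)"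
      unfolding gcb unit_top_def by (simp add: subtopology_Times subtopology_subtopology)
    then show ?thesis unfolding unit_top_def[of "circle_bundle G"] unit_top_def[of H] ucb units_H
      by (simp add: subtopology_subtopology Times_Int_Times)
  qed
  then show "homeomorphic_map (unit_top (circle_bundle G)) (unit_top H) (tincl (trivial_twist G))"
    using homeomorphic_map_id[of "unit_top H" "unit_top H"] by (simp add: id_def)
  show "groupoid_hom H G (tproj (trivial_twist G))"
    unfolding groupoid_hom_def composable_def arrows_H by auto
  show "continuous_map (gtop H) (gtop G) (tproj (trivial_twist G))" by (simp add: continuous_map_fst)
  show "homeomorphic_map (unit_top H) (unit_top G) (tproj (trivial_twist G))"
  proof -
    have ttH: "topspace (unit_top H) = units G \<times> {1}"
      using ua by (auto simp: unit_top_def units_H arrows_def)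
    have "continuous_map (unit_top H) (gtop G) fst"
      unfolding unit_top_def trivial_simps(1) by (intro continuous_map_from_subtopology continuous_map_fst)
    then have "continuous_map (unit_top H) (unit_top G) fst"
      unfolding unit_top_def[of G] continuous_map_in_subtopology using ttH by auto
    moreover have "continuous_map (unit_top G) (unit_top H) (\<lambda>x. (x, 1))"
      unfolding unit_top_def[of H] continuous_map_in_subtopology trivial_simps(1) units_H
      by (intro conjI continuous_map_pairedI)
         (auto simp: unit_top_def intro: continuous_map_from_subtopology)
    ultimately have "homeomorphic_maps (unit_top H) (unit_top G) fst (\<lambda>x. (x, 1))"
      using ttH by (auto simp: homeomorphic_maps_def)
    then show ?thesis by (auto simp: homeomorphic_map_maps)
  qed
  show "inj_on (tincl (trivial_twist G)) (units G \<times> circle)" by (simp add: inj_on_def)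
  show "tproj (trivial_twist G) ` arrows H = arrows G"
  proof -
    have "circle \<noteq> ({} :: complex set)" using circle_1 by blast
    then show ?thesis by (simp add: arrows_H fst_image_times)
  qed
  show "over (trivial_twist G) (units G) = tincl (trivial_twist G) ` (units G \<times> circle)"
    using ua by (auto simp: over_def arrows_H)
  fix x assume "x \<in> units G"
  then show "tproj (trivial_twist G) (tincl (trivial_twist G) (x, 1)) = x" by simp
next
  fix \<sigma> z assume "\<sigma> \<in> arrows H" "z \<in> circle"
  then show "cact G (trivial_twist G) z \<sigma> = mul H \<sigma> (tincl (trivial_twist G) (src G (tproj (trivial_twist G) \<sigma>), z))"
    by (auto simp: cact_def arrows_H mult.commute)
next
  fix \<alpha> assume "\<alpha> \<in> arrows G"
  then obtain U where U: "openin (gtop G) U" "bisection G U" "\<alpha> \<in> U"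
    using compact_open_bisection[OF openin_topspace] unfolding arrows_def by metis
  have Ua: "U \<subseteq> arrows G" using openin_subset[OF U(1)] by (simp add: arrows_def)
  let ?X = "prod_topology (subtopology (gtop G) U) (top_of_set circle)"
  have "homeomorphic_map ?X (subtopology (gtop H) (over (trivial_twist G) U)) (\<lambda>p. p)"
    unfolding subtopology_over using homeomorphic_map_id[of ?X ?X] by (simp add: id_def)
  then have "homeomorphic_map ?X (subtopology (gtop H) (over (trivial_twist G) U))
      (\<lambda>(\<beta>, z). mul H (tincl (trivial_twist G) (rng G \<beta>, z)) (\<beta>, 1))"
    by (rule homeomorphic_map_eq) (use Ua in auto)
  moreover have "continuous_map (subtopology (gtop G) U) (gtop H) (\<lambda>\<beta>. (\<beta>, 1))"
    unfolding trivial_simps(1) by (intro continuous_map_pairedI continuous_map_from_subtopology) auto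
  ultimately show "\<exists>U S. openin (gtop G) U \<and> bisection G U \<and> \<alpha> \<in> U
      \<and> continuous_map (subtopology (gtop G) U) (gtop H) S
      \<and> (\<forall>\<beta>\<in>U. tproj (trivial_twist G) (S \<beta>) = \<beta>)
      \<and> homeomorphic_map (prod_topology (subtopology (gtop G) U) (top_of_set circle))
          (subtopology (gtop H) (over (trivial_twist G) U))
          (\<lambda>(\<beta>, z). mul H (tincl (trivial_twist G) (rng G \<beta>, z)) (S \<beta>))"
    using U by (intro exI[of _ U] exI[of _ "\<lambda>\<beta>. (\<beta>, 1)"]) simp
qed

lemma not_effective_counterexample:
  assumes "\<not> effective G"
  shows "\<exists>n. normaliser G (trivial_twist G) n \<and> \<not> projections_cut_to_expectation G (trivial_twist G) n"
proof -
  let ?T = "trivial_twist G"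
  interpret Tr: ample_twist G ?T by unfold_locales (rule is_twist_trivial)
  let ?I = "gtop G interior_of isotropy G"
  have "units G \<subseteq> isotropy G" using units_arrows by (auto simp: isotropy_def)
  then have "units G \<subseteq> ?I" using units_open by (rule interior_of_maximal)
  then obtain \<gamma> where \<gamma>: "\<gamma> \<in> ?I" "\<gamma> \<notin> units G" using assms by (auto simp: effective_def)
  \<comment> \<open>The unit space is closed because \<open>G\<close> is Hausdorff; this leaves an
    open set of isotropy around \<open>\<gamma>\<close> that misses the units.\<close>
  have I: "openin (gtop G) (?I - units G)" by (rule openin_diff[OF openin_interior_of units_closed])
  have "\<gamma> \<in> ?I - units G" using \<gamma> by blast
  then obtain B where B: "compactin (gtop G) B" "openin (gtop G) B" "bisection G B" "\<gamma> \<in> B" "B \<subseteq> ?I - units G"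
    by (rule compact_open_bisection[OF I])
  have Biso: "B \<subseteq> isotropy G" "B \<inter> units G = {}"
    using B(5) interior_of_subset[of "gtop G" "isotropy G"] by blast+
  have Ba: "B \<subseteq> arrows G" using openin_subset[OF B(2)] by (simp add: arrows_def)
  \<comment> \<open>The factor \<open>cnj z\<close> makes \<open>v\<close> contravariant. If the
    inverse of \<open>\<gamma>\<close> also lies in \<open>B\<close>, for instance if
    \<open>\<gamma>\<close> is its own inverse, a real multiple of the indicator would cancel
    against its adjoint at \<open>\<gamma>\<close>; with \<open>\<i>\<close> the two contributions
    add up to modulus 2.\<close>
  define v where "v = (\<lambda>(\<delta>, z). if \<delta> \<in> B \<and> z \<in> circle then \<i> * cnj z else 0)"
  have off: "v \<sigma> = 0" if "\<sigma> \<notin> over ?T B" for \<sigma>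
    using that Ba by (auto simp: v_def over_def arrows_H split: prod.split)
  have vC: "v \<in> CcT G ?T" unfolding Tr.CcT_iff
  proof (intro conjI)
    show "continuous_map (gtop H) euclidean v"
    proof (rule continuous_map_clopen_extend[where A = "over ?T B" and c = 0])
      show "openin (gtop H) (over ?T B)" by (rule Tr.over_open[OF B(2)])
      show "closedin (gtop H) (over ?T B)" by (rule Tr.over_closed[OF compact_closed[OF B(1)]])
      have "continuous_map (subtopology (gtop H) (over ?T B)) euclidean (\<lambda>p. \<i> * cnj (snd p))"
        by (intro continuous_map_complex_mult continuous_map_complex_cnj
            continuous_map_from_subtopology[OF continuous_snd_complex]) simp
      then show "continuous_map (subtopology (gtop H) (over ?T B)) euclidean v"
        by (rule continuous_map_eq) (auto simp: v_def over_def arrows_H)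
    qed (use off in auto)
    show "contravariant G ?T v" unfolding contravariant_def
      by (auto simp: arrows_H cact_def v_def norm_mult)
    have "compactin (gtop H) (B \<times> circle)"
      using B(1) by (simp add: compactin_Times compactin_subtopology)
    then show "\<exists>K. compactin (gtop H) K \<and> (\<forall>\<sigma>\<in>arrows H. v \<sigma> \<noteq> 0 \<longrightarrow> \<sigma> \<in> K)"
      by (intro exI[of _ "B \<times> circle"]) (auto simp: v_def arrows_H)
    show "\<forall>\<sigma>. \<sigma> \<notin> arrows H \<longrightarrow> v \<sigma> = 0" using off by (auto simp: over_def)
  qed
  have v1: "norm (v \<sigma>) \<le> 1" for \<sigma>
    by (auto simp: v_def norm_mult split: prod.split)
  have big: "1 \<le> norm (v (Tr.base \<gamma>) - adj ?T v (Tr.base \<gamma>))"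
  proof -
    have ga: "\<gamma> \<in> arrows G" using B(4) Ba by blast
    obtain w where w: "Tr.base \<gamma> = (\<gamma>, w)" "w \<in> circle"
      using Tr.base_closed[OF ga] Tr.q_base[OF ga] by (cases "Tr.base \<gamma>") (auto simp: arrows_H)
    have "v (Tr.base \<gamma>) - adj ?T v (Tr.base \<gamma>) = \<i> * cnj w * (if ginv G \<gamma> \<in> B then 2 else 1)"
      using w ga B(4) by (simp add: v_def adj_def arrows_H)
    then show ?thesis using w(2) by (simp add: norm_mult)
  qed
  show ?thesis
    by (rule Tr.cayley_counterexample[OF B(1-3) Biso B(4) vC _ v1 big]) (rule off)
qed

end

text \<open>Types cannot be quantified inside a formula. The equivalence is therefore stated for
  twists whose total groupoid lives on \<open>'a \<times> complex\<close>, where the trivial twist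
  is found, and the forward implication is added for an arbitrary type \<open>'b\<close>.\<close>

theorem corollary3p2:
  fixes G :: "'a tgroupoid"
  assumes "ample G"
    and "locally_compact_space (gtop G)"
    and "Hausdorff_space (gtop G)"
  shows "(effective G \<longleftrightarrow>
            (\<forall>(T :: ('a, 'a \<times> complex) twist) n.
               is_twist G T \<and> normaliser G T n \<longrightarrow> projections_cut_to_expectation G T n))
       \<and> (effective G \<longrightarrow>
            (\<forall>(T :: ('a, 'b) twist) n.
               is_twist G T \<and> normaliser G T n \<longrightarrow> projections_cut_to_expectation G T n))"
proof -
  interpret ample_groupoid G using assms by unfold_locales
  \<comment> \<open>The type \<open>'c\<close> is not fixed by the context, so this fact can be used
    at both types of twist.\<close>
  have cut: "projections_cut_to_expectation G T n"
    if "effective G" "is_twist G T" "normaliser G T n" for T :: "('a, 'c) twist" and n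
  proof -
    interpret ample_twist G T by unfold_locales (rule that(2))
    show ?thesis by (rule effective_projections_cut[OF that(1,3)])
  qed
  have "\<forall>(T :: ('a, 'a \<times> complex) twist) n.
      is_twist G T \<and> normaliser G T n \<longrightarrow> projections_cut_to_expectation G T n" if "effective G"
    using cut that by blast
  moreover have "\<forall>(T :: ('a, 'b) twist) n.
      is_twist G T \<and> normaliser G T n \<longrightarrow> projections_cut_to_expectation G T n" if "effective G"
    using cut that by blast
  moreover have "effective G" if "\<forall>(T :: ('a, 'a \<times> complex) twist) n.
               is_twist G T \<and> normaliser G T n \<longrightarrow> projections_cut_to_expectation G T n"
    using that not_effective_counterexample is_twist_trivial by blast
  ultimately show ?thesis by blast
qed

end
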